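(* There are infinitely many (pairwise non-isomorphic) critical $2$-degenerate graphs $H$ such that $\mathrm{ex}(n,H) = O(n^{3/2})$.
   Context: A graph is $r$-degenerate if each of its subgraphs has minimum degree at most $r$. A graph $G$ is critical $r$-degenerate if $G$ is $r$-degenerate, exactly one vertex of $G$ has degree $r$, and every other vertex has degree at least $r+1$. $\mathrm{ex}(n,H)$ is the maximum number of edges in an $n$-vertex graph containing no subgraph isomorphic to $H$; $O$ refers to $n\to\infty$ with constants depending on $H$. *)

theory Defs
  imports Complex_Main "HOL-Library.Landau_Symbols"
begin

datatype 'a graph = Graph (verts: "'a set") (edges: "'a set set")

definition simple_graph :: "'a graph \<Rightarrow> bool" where
  "simple_graph G \<longleftrightarrow> finite (verts G) \<and> (\<forall>e\<in>edges G. e \<subseteq> verts G \<and> card e = 2)"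

definition subgraph :: "'a graph \<Rightarrow> 'a graph \<Rightarrow> bool" where
  "subgraph K G \<longleftrightarrow> simple_graph K \<and> verts K \<subseteq> verts G \<and> edges K \<subseteq> edges G"

definition isomorphic :: "'a graph \<Rightarrow> 'b graph \<Rightarrow> bool" where
  "isomorphic G H \<longleftrightarrow>
     (\<exists>f. bij_betw f (verts G) (verts H) \<and> edges H = (\<lambda>e. f ` e) ` edges G)"

definition contains_copy :: "'a graph \<Rightarrow> 'b graph \<Rightarrow> bool" where
  "contains_copy G H \<longleftrightarrow> (\<exists>K. subgraph K G \<and> isomorphic H K)"

definition degree :: "'a graph \<Rightarrow> 'a \<Rightarrow> nat" where
  "degree G v = card {e \<in> edges G. v \<in> e}"

definition min_degree :: "'a graph \<Rightarrow> nat" where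
  "min_degree G = Min (degree G ` verts G)"

text \<open>Only subgraphs with at least one vertex are considered, since the minimum degree of the
  null graph is not defined.\<close>

definition degenerate :: "nat \<Rightarrow> 'a graph \<Rightarrow> bool" where
  "degenerate r G \<longleftrightarrow> (\<forall>K. subgraph K G \<and> verts K \<noteq> {} \<longrightarrow> min_degree K \<le> r)"

definition critical_degenerate :: "nat \<Rightarrow> 'a graph \<Rightarrow> bool" where
  "critical_degenerate r G \<longleftrightarrow>
     degenerate r G \<and>
     (\<exists>v\<in>verts G. degree G v = r \<and> (\<forall>u\<in>verts G - {v}. degree G u \<ge> r + 1))"

text \<open>Every \<open>n\<close>-vertex graph is isomorphic to one whose vertices are natural numbers, so it
  suffices to let \<open>G\<close> range over these. The set of edge numbers is always finite; it is nonempty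
  whenever \<open>H\<close> has an edge, which is the only case in which the value is meaningful for
  every \<open>n\<close>.\<close>

definition ex_number :: "nat \<Rightarrow> 'a graph \<Rightarrow> nat" where
  "ex_number n H =
     Max {card (edges G) | G :: nat graph.
            simple_graph G \<and> card (verts G) = n \<and> \<not> contains_copy G H}"

lemma finite_edge_numbers:
  "finite {card (edges G) | G :: nat graph.
            simple_graph G \<and> card (verts G) = n \<and> \<not> contains_copy G H}"
proof (rule finite_subset)
  show "{card (edges G) | G :: nat graph.
            simple_graph G \<and> card (verts G) = n \<and> \<not> contains_copy G H} \<subseteq> {..2 ^ n}"
  proof
    fix m
    assume "m \<in> {card (edges G) | G :: nat graph.
              simple_graph G \<and> card (verts G) = n \<and> \<not> contains_copy G H}"
    then obtain G :: "nat graph"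
      where G: "m = card (edges G)" "simple_graph G" "card (verts G) = n"
      by blast
    then have "edges G \<subseteq> Pow (verts G)" "finite (verts G)"
      by (auto simp: simple_graph_def)
    then have "card (edges G) \<le> card (Pow (verts G))"
      by (simp add: card_mono)
    then show "m \<in> {..2 ^ n}"
      using G \<open>finite (verts G)\<close> by (simp add: card_Pow)
  qed
qed simp

lemma edge_numbers_nonempty:
  assumes "edges H \<noteq> {}"
  shows "{card (edges G) | G :: nat graph.
            simple_graph G \<and> card (verts G) = n \<and> \<not> contains_copy G H} \<noteq> {}"
proof -
  let ?G = "Graph {..<n} {} :: nat graph"
  have "simple_graph ?G \<and> card (verts ?G) = n \<and> \<not> contains_copy ?G H"
    using assms by (auto simp: simple_graph_def contains_copy_def subgraph_def isomorphic_def)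
  then show ?thesis by blast
qed

end

theory Submission
  imports Defs "HOL-Analysis.Convex" "HOL-Library.Nat_Bijection"
begin

text \<open>The graphs are hexagonal brick walls on a torus, with one rung replaced by a path through two
  new vertices; the last vertex of this path has degree two, and from there the whole wall peels off.

  To find such a graph in a host graph with many edges, pass to a subgraph that maximises the number
  of edges divided by the number of vertices to the power \<open>3/2\<close>. By maximality, large degrees can be
  cut off and almost no closed walk contains two vertices at distance two with polynomially many
  common neighbours. Prune the set of closed walks of length 32 so that replacing one vertex, or one
  pair of consecutive vertices, is always possible in many ways inside the set. Reading such a walk
  as two adjacent rows of 16 vertices, a wall is a closed walk in the graph of rows. A step hits a
  given vertex only with polynomially small probability, whereas the trace of a high even power of
  the transition kernel drops by a smaller factor when the exponent is raised by two; hence some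
  closed walk in the graph of rows never repeats a vertex. The two extra vertices are then found by
  replacing single vertices of a pruned closed walk.\<close>

section \<open>Closed walks of a symmetric kernel\<close>

text \<open>With \<open>c * n^(3/2)\<close> edges, two vertices have on average about
  \<open>c^2\<close> common neighbours, with no power of \<open>n\<close>, so replacing one vertex
  of a walk cannot beat a polynomial loss. Replacing two consecutive vertices offers about
  \<open>c^3 * n^(1/2)\<close> choices; this is why a row is cut into pairs that are consecutive on
  the walk. Fixing one vertex of a pair leaves at most a codegree, cut off at
  \<open>t = c^2 * n^(2/5)\<close>, so a new row meets a prescribed vertex with probability about
  \<open>n^(-1/10) / c\<close>.

  No regularity of the kernels is available; log-convexity of the even traces replaces it. The last
  ratio of consecutive even traces is at most the geometric mean of all of them, so a crude count of
  states suffices for long walks. Length 32 makes the loss on vertices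
  \<open>n^(1/16) <= n^(1/10)\<close>, and is a power of two for the repeated squaring behind the
  lower bound. There are at most \<open>2 * n^16\<close> rows, so closed walks of
  \<open>2 * k\<close> rows with \<open>k >= 161\<close> lose at most \<open>n^(1/10)\<close>, which
  the conflict probability absorbs with \<open>1 / c\<close> to spare.

  The wall alone is cubic, hence not 2-degenerate; the rerouted rung supplies the vertex where the
  peeling starts.\<close>

fun walk_weight :: "('a \<Rightarrow> 'a \<Rightarrow> real) \<Rightarrow> 'a list \<Rightarrow> real" where
  "walk_weight M (x # y # zs) = M x y * walk_weight M (y # zs)"
| "walk_weight M xs = 1"

definition closed_weight :: "('a \<Rightarrow> 'a \<Rightarrow> real) \<Rightarrow> 'a list \<Rightarrow> real" where
  "closed_weight M xs = walk_weight M (xs @ [hd xs])"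

definition lists_of :: "'a set \<Rightarrow> nat \<Rightarrow> 'a list set" where
  "lists_of S n = {xs. set xs \<subseteq> S \<and> length xs = n}"

lemma finite_lists_of: "finite S \<Longrightarrow> finite (lists_of S n)"
  by (simp add: lists_of_def finite_lists_length_eq)

lemma card_lists_of: "finite S \<Longrightarrow> card (lists_of S n) = card S ^ n"
  by (simp add: lists_of_def card_lists_length_eq)

lemma lists_of_Suc: "lists_of S (Suc n) = (\<lambda>(x, xs). x # xs) ` (S \<times> lists_of S n)"
  by (auto simp: lists_of_def length_Suc_conv)

lemma sum_lists_of_Suc:
  "(\<Sum>xs\<in>lists_of S (Suc n). f xs) = (\<Sum>x\<in>S. \<Sum>xs\<in>lists_of S n. f (x # xs))"
proof -
  have "(\<Sum>xs\<in>lists_of S (Suc n). f xs) = (\<Sum>p\<in>S \<times> lists_of S n. f (fst p # snd p))"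
    unfolding lists_of_Suc by (subst sum.reindex) (auto simp: inj_on_def case_prod_beta)
  then show ?thesis by (simp add: sum.cartesian_product case_prod_beta)
qed

lemma sum_lists_of_split:
  "(\<Sum>xs\<in>lists_of S (m + Suc n). f xs) =
   (\<Sum>ys\<in>lists_of S m. \<Sum>x\<in>S. \<Sum>zs\<in>lists_of S n. f (ys @ x # zs))"
proof (induction m arbitrary: f)
  case 0
  have "lists_of S 0 = {[]}" by (auto simp: lists_of_def)
  then show ?case by (simp add: sum_lists_of_Suc)
next
  case (Suc m)
  show ?case
    by (simp only: add_Suc sum_lists_of_Suc Suc.IH append_Cons)
qed

lemma walk_weight_append:
  "walk_weight M (xs @ b # ys) = walk_weight M (xs @ [b]) * walk_weight M (b # ys)"
proof (induction xs)
  case (Cons x xs)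
  then show ?case by (cases xs) auto
qed simp

lemma walk_weight_nonzero:
  "walk_weight M xs \<noteq> 0 \<Longrightarrow> Suc i < length xs \<Longrightarrow> M (xs ! i) (xs ! Suc i) \<noteq> 0"
proof (induction M xs arbitrary: i rule: walk_weight.induct)
  case (1 M x y zs)
  then show ?case by (cases i) auto
qed auto

lemma closed_weight_nonzero:
  assumes "closed_weight M xs \<noteq> 0" "i < length xs"
  shows "M (xs ! i) (xs ! (Suc i mod length xs)) \<noteq> 0"
proof -
  have "M ((xs @ [hd xs]) ! i) ((xs @ [hd xs]) ! Suc i) \<noteq> 0"
    using assms walk_weight_nonzero[of M "xs @ [hd xs]" i] by (simp add: closed_weight_def)
  moreover have "(xs @ [hd xs]) ! Suc i = xs ! (Suc i mod length xs)"
    using assms(2) by (cases "Suc i = length xs"; cases xs) (auto simp: nth_append)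
  ultimately show ?thesis using assms(2) by (simp add: nth_append)
qed

lemma closed_weight_rotate1: "closed_weight M (rotate1 xs) = closed_weight M xs"
proof (cases xs)
  case (Cons x ys)
  show ?thesis
  proof (cases ys)
    case (Cons y zs)
    have "closed_weight M (rotate1 xs) = walk_weight M ((y # zs) @ x # [y])"
      by (simp add: closed_weight_def \<open>xs = x # ys\<close> Cons)
    also have "\<dots> = walk_weight M ((y # zs) @ [x]) * M x y"
      by (subst walk_weight_append) simp
    also have "\<dots> = closed_weight M xs"
      by (simp add: closed_weight_def \<open>xs = x # ys\<close> Cons mult.commute)
    finally show ?thesis .
  qed (simp add: \<open>xs = x # ys\<close>)
qed simp

lemma closed_weight_rotate: "closed_weight M (rotate m xs) = closed_weight M xs"
  by (induction m) (simp_all add: closed_weight_rotate1)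

lemma bij_rotate_lists_of: "bij_betw (rotate m) (lists_of S n) (lists_of S n)"
proof (rule bij_betwI[where g = "rotate (n - m mod n)"])
  have *: "rotate (n - m mod n) (rotate m x) = x \<and> rotate m (rotate (n - m mod n) x) = x"
    if "x \<in> lists_of S n" for x
  proof (cases "n = 0")
    case False
    have l: "length x = n" using that by (simp add: lists_of_def)
    have "n - m mod n + m = n + n * (m div n)"
      using False mod_less_divisor[of n m] mult_div_mod_eq[of n m] by linarith
    then have "(n - m mod n + m) mod n = 0" by simp
    then show ?thesis using l by (simp add: rotate_rotate add.commute)
  qed (use that in \<open>auto simp: lists_of_def\<close>)
  then show "rotate (n - m mod n) (rotate m x) = x" if "x \<in> lists_of S n" for x
    using that by blast
  show "rotate m (rotate (n - m mod n) x) = x" if "x \<in> lists_of S n" for x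
    using that * by blast
qed (auto simp: lists_of_def)

lemma cauchy_schwarz_double_sum:
  fixes f g :: "'a \<Rightarrow> 'b \<Rightarrow> real"
  shows "(\<Sum>a\<in>A. \<Sum>b\<in>B. f a b * g a b)\<^sup>2 \<le> (\<Sum>a\<in>A. \<Sum>b\<in>B. (f a b)\<^sup>2) * (\<Sum>a\<in>A. \<Sum>b\<in>B. (g a b)\<^sup>2)"
  using Cauchy_Schwarz_ineq_sum[of "\<lambda>p. f (fst p) (snd p)" "\<lambda>p. g (fst p) (snd p)" "A \<times> B"]
  by (simp add: sum.cartesian_product case_prod_beta)

section \<open>Traces of powers of a symmetric kernel\<close>

locale sym_kernel =
  fixes S :: "'a set" and M :: "'a \<Rightarrow> 'a \<Rightarrow> real"
  assumes fin: "finite S"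
    and nonneg: "\<And>a b. M a b \<ge> 0"
    and sym: "\<And>a b. M a b = M b a"
begin

text \<open>Entries of the matrix powers of \<open>M\<close> over the index set \<open>S\<close>;
  \<open>tr\<close> is their trace.\<close>

primrec mp :: "nat \<Rightarrow> 'a \<Rightarrow> 'a \<Rightarrow> real" where
  "mp 0 = (\<lambda>a b. of_bool (a = b))"
| "mp (Suc n) = (\<lambda>a b. \<Sum>c\<in>S. M a c * mp n c b)"

definition tr :: "nat \<Rightarrow> real" where
  "tr n = (\<Sum>a\<in>S. mp n a a)"

lemma delta_sum [simp]:
  "a \<in> S \<Longrightarrow> (\<Sum>c\<in>S. of_bool (a = c) * f c) = (f a :: real)"
  "a \<in> S \<Longrightarrow> (\<Sum>c\<in>S. f c * of_bool (c = a)) = (f a :: real)"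
  using fin by (simp_all add: of_bool_def if_distrib if_distribR sum.delta sum.delta' cong: if_cong)

lemma mp_nonneg: "mp n a b \<ge> 0"
  by (induction n arbitrary: a) (auto intro!: sum_nonneg mult_nonneg_nonneg nonneg)

lemma mp_1: "b \<in> S \<Longrightarrow> mp (Suc 0) a b = M a b"
  by (simp del: One_nat_def)

lemma mp_add: "a \<in> S \<Longrightarrow> mp (i + j) a b = (\<Sum>c\<in>S. mp i a c * mp j c b)"
proof (induction i arbitrary: a)
  case (Suc i)
  have "mp (Suc i + j) a b = (\<Sum>c\<in>S. M a c * (\<Sum>e\<in>S. mp i c e * mp j e b))"
    using Suc.IH by (auto intro!: sum.cong)
  also have "\<dots> = (\<Sum>e\<in>S. \<Sum>c\<in>S. M a c * mp i c e * mp j e b)"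
    by (subst sum.swap) (simp add: sum_distrib_left mult.assoc)
  finally show ?case by (simp add: sum_distrib_right)
qed simp

lemma mp_sym: "a \<in> S \<Longrightarrow> b \<in> S \<Longrightarrow> mp n a b = mp n b a"
proof (induction n arbitrary: a b)
  case (Suc n)
  have "mp (Suc n) b a = (\<Sum>c\<in>S. mp n b c * M c a)"
    using mp_add[of b n "Suc 0" a] Suc.prems mp_1[of a] by (simp del: mp.simps)
  also have "\<dots> = (\<Sum>c\<in>S. M a c * mp n c b)"
    using Suc by (intro sum.cong refl) (metis mult.commute sym)
  finally show ?case by simp
qed auto

lemma tr_add: "tr (i + j) = (\<Sum>a\<in>S. \<Sum>b\<in>S. mp i a b * mp j b a)"
  unfolding tr_def by (intro sum.cong refl mp_add)

lemma tr_double: "tr (2 * j) = (\<Sum>a\<in>S. \<Sum>b\<in>S. (mp j a b)\<^sup>2)"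
proof -
  have "tr (j + j) = (\<Sum>a\<in>S. \<Sum>b\<in>S. (mp j a b)\<^sup>2)"
    unfolding tr_add power2_eq_square by (intro sum.cong refl) (simp add: mp_sym)
  then show ?thesis by (simp add: mult_2)
qed

lemma tr_nonneg: "tr n \<ge> 0"
  unfolding tr_def by (intro sum_nonneg mp_nonneg)

lemma tr_0: "tr 0 = card S"
  by (simp add: tr_def)

text \<open>Splitting the exponent as \<open>j + (j + 2)\<close> makes the middle trace the inner
  product of \<open>mp j\<close> and \<open>mp (j + 2)\<close>, whose squared norms are the outer
  traces; this is Cauchy-Schwarz.\<close>

lemma tr_log_convex: "(tr (2 * Suc j))\<^sup>2 \<le> tr (2 * j) * tr (2 * Suc (Suc j))"
proof -
  have "tr (2 * Suc j) = tr (j + Suc (Suc j))" by (rule arg_cong[of _ _ tr]) simp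
  also have "\<dots> = (\<Sum>a\<in>S. \<Sum>b\<in>S. mp j a b * mp (Suc (Suc j)) a b)"
    unfolding tr_add by (rule sum.cong[OF refl], rule sum.cong[OF refl]) (simp only: mp_sym)
  finally show ?thesis
    using cauchy_schwarz_double_sum[where f = "mp j" and g = "mp (Suc (Suc j))" and A = S and B = S]
    by (simp only: tr_double)
qed

text \<open>By log-convexity the ratios \<open>tr (2 * j) / tr (2 * Suc j)\<close> do not increase
  with \<open>j\<close>. The last one is therefore at most their geometric mean, which the
  hypothesis on \<open>tr 0\<close> bounds by \<open>\<rho>\<close>.\<close>

lemma tr_ratio:
  assumes \<rho>: "\<rho> > 0" and pos: "tr (2 * Suc k) > 0" and b: "tr 0 \<le> \<rho> ^ Suc k * tr (2 * Suc k)"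
  shows "tr (2 * k) \<le> \<rho> * tr (2 * Suc k)"
proof (rule ccontr)
  assume "\<not> ?thesis"
  then have *: "tr (2 * k) > \<rho> * tr (2 * Suc k)" by simp
  \<comment> \<open>Downward induction from \<open>k\<close>: a ratio above \<open>\<rho>\<close> is
    passed on to all smaller indices. Positivity is carried along because the log-convexity
    inequality has to be cancelled.\<close>
  have "tr (2 * (k - i)) > \<rho> * tr (2 * Suc (k - i)) \<and> tr (2 * Suc (k - i)) > 0" if "i \<le> k" for i
    using that
  proof (induction i)
    case (Suc i)
    define j where "j = k - Suc i"
    have j: "k - i = Suc j" using Suc.prems by (simp add: j_def)
    have IH: "tr (2 * Suc j) > \<rho> * tr (2 * Suc (Suc j))" "tr (2 * Suc (Suc j)) > 0"
      using Suc j by auto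
    have p: "tr (2 * Suc j) > 0" using IH \<rho> by (meson less_trans mult_pos_pos)
    have "\<rho> * tr (2 * Suc j) * tr (2 * Suc (Suc j)) < tr (2 * Suc j) * tr (2 * Suc j)"
      using IH(1) p by (simp add: mult.commute mult.left_commute)
    also have "\<dots> \<le> tr (2 * j) * tr (2 * Suc (Suc j))"
      using tr_log_convex[of j] by (simp add: power2_eq_square)
    finally have "\<rho> * tr (2 * Suc j) < tr (2 * j)" using IH(2) by (simp add: mult_less_cancel_right)
    then show ?case using p by (simp add: j_def[symmetric])
  qed (use * pos in auto)
  from this have step: "tr (2 * j) > \<rho> * tr (2 * Suc j)" if "j \<le> k" for j
    using that by (metis diff_diff_cancel diff_le_self)
  have "tr 0 > \<rho> ^ Suc j * tr (2 * Suc j)" if "j \<le> k" for j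
    using that
  proof (induction j)
    case (Suc j)
    have "\<rho> ^ Suc (Suc j) * tr (2 * Suc (Suc j)) = \<rho> ^ Suc j * (\<rho> * tr (2 * Suc (Suc j)))" by simp
    also have "\<dots> < \<rho> ^ Suc j * tr (2 * Suc j)"
      using step[of "Suc j"] Suc.prems \<rho> by (intro mult_strict_left_mono) auto
    finally show ?case using Suc by simp
  qed (use step[of 0] in simp)
  from this[of k] b show False by simp
qed

lemma sum_walks:
  "a \<in> S \<Longrightarrow> b \<in> S \<Longrightarrow> (\<Sum>xs\<in>lists_of S n. walk_weight M (a # xs @ [b])) = mp (Suc n) a b"
proof (induction n arbitrary: a)
  case 0
  have "lists_of S 0 = {[]}" by (auto simp: lists_of_def)
  then show ?case using 0 by simp
next
  case (Suc n)
  have "(\<Sum>xs\<in>lists_of S (Suc n). walk_weight M (a # xs @ [b])) =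
        (\<Sum>c\<in>S. M a c * (\<Sum>xs\<in>lists_of S n. walk_weight M (c # xs @ [b])))"
    by (simp add: sum_lists_of_Suc sum_distrib_left)
  also have "\<dots> = (\<Sum>c\<in>S. M a c * mp (Suc n) c b)"
    using Suc by (intro sum.cong refl) (simp del: mp.simps)
  finally show ?case by simp
qed

lemma sum_closed: "n > 0 \<Longrightarrow> (\<Sum>xs\<in>lists_of S n. closed_weight M xs) = tr n"
proof (cases n)
  case (Suc m)
  have "(\<Sum>xs\<in>lists_of S n. closed_weight M xs) =
        (\<Sum>a\<in>S. \<Sum>xs\<in>lists_of S m. walk_weight M (a # xs @ [a]))"
    by (simp add: Suc sum_lists_of_Suc closed_weight_def)
  then show ?thesis by (simp add: sum_walks Suc tr_def del: mp.simps)
qed simp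

lemma sum_closed_pair_0:
  assumes "0 < j" "j < n"
  shows "(\<Sum>xs\<in>lists_of S n. g (xs ! 0) (xs ! j) * closed_weight M xs) =
         (\<Sum>a\<in>S. \<Sum>b\<in>S. g a b * mp j a b * mp (n - j) b a)"
proof -
  obtain i where i: "j = Suc i" using assms(1) by (cases j) auto
  obtain l where l: "n = Suc (i + Suc l)" using assms(2) i
    by (metis add_Suc_right less_iff_Suc_add add_Suc)
  have "(\<Sum>xs\<in>lists_of S n. g (xs ! 0) (xs ! j) * closed_weight M xs) =
        (\<Sum>a\<in>S. \<Sum>ys\<in>lists_of S i. \<Sum>b\<in>S. \<Sum>zs\<in>lists_of S l.
           g ((a # ys @ b # zs) ! 0) ((a # ys @ b # zs) ! j) * closed_weight M (a # ys @ b # zs))"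
    unfolding l by (simp only: sum_lists_of_Suc sum_lists_of_split)
  also have "\<dots> = (\<Sum>a\<in>S. \<Sum>ys\<in>lists_of S i. \<Sum>b\<in>S. \<Sum>zs\<in>lists_of S l.
           g a b * (walk_weight M (a # ys @ [b]) * walk_weight M (b # zs @ [a])))"
  proof (intro sum.cong refl)
    fix a b ys zs assume "ys \<in> lists_of S i"
    then have "(a # ys @ b # zs) ! j = b" by (simp add: i lists_of_def nth_append)
    moreover have "closed_weight M (a # ys @ b # zs) =
        walk_weight M (a # ys @ [b]) * walk_weight M (b # zs @ [a])"
      using walk_weight_append[of M "a # ys" b "zs @ [a]"] by (simp add: closed_weight_def)
    ultimately show "g ((a # ys @ b # zs) ! 0) ((a # ys @ b # zs) ! j) * closed_weight M (a # ys @ b # zs)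
      = g a b * (walk_weight M (a # ys @ [b]) * walk_weight M (b # zs @ [a]))" by simp
  qed
  also have "\<dots> = (\<Sum>a\<in>S. \<Sum>b\<in>S. \<Sum>ys\<in>lists_of S i. \<Sum>zs\<in>lists_of S l.
           g a b * (walk_weight M (a # ys @ [b]) * walk_weight M (b # zs @ [a])))"
    by (intro sum.cong refl sum.swap)
  also have "\<dots> = (\<Sum>a\<in>S. \<Sum>b\<in>S. g a b * ((\<Sum>ys\<in>lists_of S i. walk_weight M (a # ys @ [b])) *
           (\<Sum>zs\<in>lists_of S l. walk_weight M (b # zs @ [a]))))"
    by (intro sum.cong refl) (simp only: sum_product sum_distrib_left [symmetric])
  also have "\<dots> = (\<Sum>a\<in>S. \<Sum>b\<in>S. g a b * (mp (Suc i) a b * mp (Suc l) b a))"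
    by (intro sum.cong refl) (simp add: sum_walks del: mp.simps)
  finally show ?thesis by (simp add: i l mult.assoc del: mp.simps)
qed

text \<open>Closed walks may be rotated so that position \<open>i\<close> comes first; the two arcs
  between the marked positions then sum independently to matrix powers.\<close>

lemma sum_closed_pair:
  assumes "i < j" "j < n"
  shows "(\<Sum>xs\<in>lists_of S n. g (xs ! i) (xs ! j) * closed_weight M xs) =
         (\<Sum>a\<in>S. \<Sum>b\<in>S. g a b * mp (j - i) a b * mp (n - (j - i)) b a)"
proof -
  have "(\<Sum>xs\<in>lists_of S n. g (xs ! i) (xs ! j) * closed_weight M xs) =
        (\<Sum>xs\<in>lists_of S n. g (rotate i xs ! 0) (rotate i xs ! (j - i)) * closed_weight M (rotate i xs))"
    using assms by (intro sum.cong refl) (auto simp: nth_rotate closed_weight_rotate lists_of_def)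
  also have "\<dots> = (\<Sum>xs\<in>lists_of S n. g (xs ! 0) (xs ! (j - i)) * closed_weight M xs)"
    by (rule sum.reindex_bij_betw[OF bij_rotate_lists_of])
  also have "\<dots> = (\<Sum>a\<in>S. \<Sum>b\<in>S. g a b * mp (j - i) a b * mp (n - (j - i)) b a)"
    using assms by (intro sum_closed_pair_0) auto
  finally show ?thesis .
qed

lemma walk_weight_nonneg: "walk_weight M xs \<ge> 0"
  by (induction xs rule: induct_list012) (auto intro!: mult_nonneg_nonneg nonneg)

end

lemma sum_swap3:
  "(\<Sum>b\<in>B. \<Sum>r\<in>R. \<Sum>p\<in>P. g b r p) = (\<Sum>p\<in>P. \<Sum>r\<in>R. \<Sum>b\<in>B. g b r p)"
proof -
  have "(\<Sum>b\<in>B. \<Sum>r\<in>R. \<Sum>p\<in>P. g b r p) = (\<Sum>b\<in>B. \<Sum>p\<in>P. \<Sum>r\<in>R. g b r p)"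
    by (intro sum.cong refl sum.swap)
  also have "\<dots> = (\<Sum>p\<in>P. \<Sum>b\<in>B. \<Sum>r\<in>R. g b r p)" by (rule sum.swap)
  also have "\<dots> = (\<Sum>p\<in>P. \<Sum>r\<in>R. \<Sum>b\<in>B. g b r p)"
    by (intro sum.cong refl sum.swap)
  finally show ?thesis .
qed

context sym_kernel
begin

text \<open>A closed walk is cut at \<open>b\<close> and at the vertex \<open>p\<close> opposite to
  \<open>b\<close>; the half that contains \<open>a\<close> ends with a step \<open>r\<close> to
  \<open>b\<close>. Splitting the weight of this one step by the weighted AM-GM inequality
  \<open>split\<close> separates the halves: the first term keeps the conflict, which costs
  \<open>A\<close>, and leaves the square of \<open>mp (k - 1)\<close>; the second forgets it and
  leaves the square of \<open>mp k\<close>.\<close>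

lemma conflict_at_distance:
  assumes nn: "\<And>r q. \<alpha> r q \<ge> 0" "\<And>r q. \<beta> r q \<ge> 0"
    and split: "\<And>r q x y. r \<in> S \<Longrightarrow> q \<in> S \<Longrightarrow> M r q * (x * y) \<le> \<alpha> r q * x\<^sup>2 + \<beta> r q * y\<^sup>2"
    and A: "\<And>a r. a \<in> S \<Longrightarrow> r \<in> S \<Longrightarrow> (\<Sum>q\<in>S. of_bool (conf a q) * \<alpha> r q) \<le> A"
    and B: "\<And>q. q \<in> S \<Longrightarrow> (\<Sum>r\<in>S. \<beta> r q) \<le> B"
    and j: "0 < j" "j \<le> k"
  shows "(\<Sum>a\<in>S. \<Sum>b\<in>S. of_bool (conf a b) * mp j a b * mp (2 * k - j) b a)
           \<le> A * tr (2 * (k - 1)) + B * tr (2 * k)"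
proof -
  \<comment> \<open>Weight of the walks of length \<open>k - 1\<close> from \<open>p\<close> to
    \<open>r\<close> whose vertex \<open>a\<close>, lying \<open>j - 1\<close> steps before
    \<open>r\<close>, conflicts with \<open>b\<close>.\<close>
  define f where "f p r b = (\<Sum>a\<in>S. of_bool (conf a b) * mp (k - j) p a * mp (j - 1) a r)" for p r b
  have f_nonneg: "f p r b \<ge> 0" for p r b
    unfolding f_def by (intro sum_nonneg mult_nonneg_nonneg mp_nonneg) auto
  have mp_eq: "mp (k - 1) p r = (\<Sum>a\<in>S. mp (k - j) p a * mp (j - 1) a r)" if "p \<in> S" for p r
    using mp_add[OF that, of "k - j" "j - 1" r] j by simp
  have f_le: "f p r b \<le> mp (k - 1) p r" if "p \<in> S" for p r b
    unfolding f_def mp_eq[OF that] by (intro sum_mono) (auto simp: mp_nonneg)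
  have "(\<Sum>a\<in>S. \<Sum>b\<in>S. of_bool (conf a b) * mp j a b * mp (2 * k - j) b a)
      = (\<Sum>a\<in>S. \<Sum>b\<in>S. \<Sum>r\<in>S. \<Sum>p\<in>S.
           (of_bool (conf a b) * mp (k - j) p a * mp (j - 1) a r) * M r b * mp k p b)"
  proof (intro sum.cong refl)
    fix a b assume ab: "a \<in> S" "b \<in> S"
    have "mp j a b = (\<Sum>r\<in>S. mp (j - 1) a r * M r b)"
      using mp_add[OF ab(1), of "j - 1" "Suc 0" b] j mp_1[OF ab(2)] by (simp del: mp.simps)
    moreover have "mp (2 * k - j) b a = (\<Sum>p\<in>S. mp k p b * mp (k - j) p a)"
      using mp_add[OF ab(2), of k "k - j" a] j mp_sym[OF ab(2), of _ k]
      by (simp add: mult_2 cong: sum.cong)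
    ultimately show "of_bool (conf a b) * mp j a b * mp (2 * k - j) b a = (\<Sum>r\<in>S. \<Sum>p\<in>S.
           (of_bool (conf a b) * mp (k - j) p a * mp (j - 1) a r) * M r b * mp k p b)"
      by (simp add: sum_product sum_distrib_left mult_ac)
  qed
  also have "\<dots> = (\<Sum>a\<in>S. \<Sum>p\<in>S. \<Sum>r\<in>S. \<Sum>b\<in>S.
           (of_bool (conf a b) * mp (k - j) p a * mp (j - 1) a r) * M r b * mp k p b)"
    by (rule sum.cong[OF refl], rule sum_swap3)
  also have "\<dots> = (\<Sum>p\<in>S. \<Sum>r\<in>S. \<Sum>b\<in>S. f p r b * (M r b * mp k p b))"
  proof -
    have "(\<Sum>a\<in>S. \<Sum>p\<in>S. \<Sum>r\<in>S. \<Sum>b\<in>S. g a p r b) = (\<Sum>p\<in>S. \<Sum>r\<in>S. \<Sum>b\<in>S. \<Sum>a\<in>S. g a p r b)"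
      for g :: "'a \<Rightarrow> 'a \<Rightarrow> 'a \<Rightarrow> 'a \<Rightarrow> real"
    proof -
      have "(\<Sum>a\<in>S. \<Sum>p\<in>S. \<Sum>r\<in>S. \<Sum>b\<in>S. g a p r b) = (\<Sum>p\<in>S. \<Sum>a\<in>S. \<Sum>r\<in>S. \<Sum>b\<in>S. g a p r b)"
        by (rule sum.swap)
      also have "\<dots> = (\<Sum>p\<in>S. \<Sum>b\<in>S. \<Sum>r\<in>S. \<Sum>a\<in>S. g a p r b)"
        by (rule sum.cong[OF refl], rule sum_swap3)
      also have "\<dots> = (\<Sum>p\<in>S. \<Sum>r\<in>S. \<Sum>b\<in>S. \<Sum>a\<in>S. g a p r b)"
        by (rule sum.cong[OF refl], rule sum.swap)
      finally show ?thesis .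
    qed
    then show ?thesis
      by (simp add: f_def sum_distrib_right mult.assoc)
  qed
  also have "\<dots> \<le> (\<Sum>p\<in>S. \<Sum>r\<in>S. \<Sum>b\<in>S. \<alpha> r b * f p r b * mp (k - 1) p r + \<beta> r b * (mp k p b)\<^sup>2)"
  proof (intro sum_mono)
    fix p r b assume prb: "p \<in> S" "r \<in> S" "b \<in> S"
    show "f p r b * (M r b * mp k p b) \<le> \<alpha> r b * f p r b * mp (k - 1) p r + \<beta> r b * (mp k p b)\<^sup>2"
    proof (cases "mp (k - 1) p r = 0")
      case True
      then have "f p r b = 0" using f_le[OF prb(1)] f_nonneg by (metis antisym)
      then show ?thesis using nn by simp
    next
      case False
      \<comment> \<open>\<open>t\<close> is the conflicting fraction of the walks from
        \<open>p\<close> to \<open>r\<close>. The split is applied to the full weights, and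
        \<open>t <= 1\<close> is dropped only in the second term, so the first still knows about the
        conflict.\<close>
      define m1 t where "m1 = mp (k - 1) p r" and "t = f p r b / m1"
      have m1: "m1 > 0" using False mp_nonneg[of "k - 1" p r] by (simp add: m1_def)
      have t: "0 \<le> t" "t \<le> 1" "f p r b = t * m1"
        using f_le[OF prb(1)] f_nonneg[of p r b] m1 by (auto simp: t_def m1_def)
      have "f p r b * (M r b * mp k p b) = t * (M r b * (m1 * mp k p b))"
        by (simp add: t(3))
      also have "\<dots> \<le> t * (\<alpha> r b * m1\<^sup>2 + \<beta> r b * (mp k p b)\<^sup>2)"
        using split[OF prb(2,3)] t(1) by (intro mult_left_mono)
      also have "\<dots> = \<alpha> r b * (t * m1) * m1 + t * (\<beta> r b * (mp k p b)\<^sup>2)"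
        by (simp add: algebra_simps power2_eq_square)
      also have "\<dots> \<le> \<alpha> r b * (t * m1) * m1 + 1 * (\<beta> r b * (mp k p b)\<^sup>2)"
        using t nn by (intro add_left_mono mult_right_mono) auto
      finally have "f p r b * (M r b * mp k p b) \<le> \<alpha> r b * f p r b * m1 + \<beta> r b * (mp k p b)\<^sup>2"
        by (simp only: t(3)[symmetric] mult_1)
      then show ?thesis by (simp only: m1_def)
    qed
  qed
  also have "\<dots> = (\<Sum>p\<in>S. \<Sum>r\<in>S. mp (k - 1) p r * (\<Sum>b\<in>S. \<alpha> r b * f p r b))
                + (\<Sum>p\<in>S. \<Sum>b\<in>S. (mp k p b)\<^sup>2 * (\<Sum>r\<in>S. \<beta> r b))"
  proof -
    have "(\<Sum>r\<in>S. \<Sum>b\<in>S. \<beta> r b * (mp k p b)\<^sup>2) = (\<Sum>b\<in>S. (mp k p b)\<^sup>2 * (\<Sum>r\<in>S. \<beta> r b))" for p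
    proof -
      have "(\<Sum>r\<in>S. \<Sum>b\<in>S. \<beta> r b * (mp k p b)\<^sup>2) = (\<Sum>b\<in>S. \<Sum>r\<in>S. \<beta> r b * (mp k p b)\<^sup>2)"
        by (rule sum.swap)
      also have "\<dots> = (\<Sum>b\<in>S. (\<Sum>r\<in>S. \<beta> r b) * (mp k p b)\<^sup>2)"
        by (simp only: sum_distrib_right)
      finally show ?thesis by (simp only: mult.commute)
    qed
    moreover have "(\<Sum>b\<in>S. \<alpha> r b * f p r b * mp (k - 1) p r) = mp (k - 1) p r * (\<Sum>b\<in>S. \<alpha> r b * f p r b)" for p r
      by (simp only: sum_distrib_right[symmetric] mult.commute)
    ultimately show ?thesis by (simp only: sum.distrib)
  qed
  also have "\<dots> \<le> (\<Sum>p\<in>S. \<Sum>r\<in>S. mp (k - 1) p r * (mp (k - 1) p r * A))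
                + (\<Sum>p\<in>S. \<Sum>b\<in>S. (mp k p b)\<^sup>2 * B)"
  proof (intro add_mono sum_mono mult_left_mono mp_nonneg B)
    fix p r assume pr: "p \<in> S" "r \<in> S"
    have "(\<Sum>b\<in>S. \<alpha> r b * f p r b) =
        (\<Sum>a\<in>S. mp (k - j) p a * mp (j - 1) a r * (\<Sum>b\<in>S. of_bool (conf a b) * \<alpha> r b))"
    proof -
      have "(\<Sum>b\<in>S. \<alpha> r b * f p r b) =
          (\<Sum>b\<in>S. \<Sum>a\<in>S. mp (k - j) p a * mp (j - 1) a r * (of_bool (conf a b) * \<alpha> r b))"
        unfolding f_def sum_distrib_left
        by (rule sum.cong[OF refl], rule sum.cong[OF refl]) (simp only: mult_ac)
      also have "\<dots> = (\<Sum>a\<in>S. \<Sum>b\<in>S. mp (k - j) p a * mp (j - 1) a r * (of_bool (conf a b) * \<alpha> r b))"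
        by (rule sum.swap)
      finally show ?thesis by (simp only: sum_distrib_left)
    qed
    also have "\<dots> \<le> (\<Sum>a\<in>S. mp (k - j) p a * mp (j - 1) a r * A)"
      using A pr by (intro sum_mono mult_left_mono mult_nonneg_nonneg mp_nonneg) auto
    finally show "(\<Sum>b\<in>S. \<alpha> r b * f p r b) \<le> mp (k - 1) p r * A"
      by (simp only: mp_eq[OF pr(1)] sum_distrib_right)
  qed auto
  also have "\<dots> = A * tr (2 * (k - 1)) + B * tr (2 * k)"
  proof -
    have "mp (k - 1) p r * (mp (k - 1) p r * A) = A * (mp (k - 1) p r)\<^sup>2" for p r
      by (simp add: power2_eq_square)
    then show ?thesis by (simp only: tr_double sum_distrib_left mult.commute[of B])
  qed
  finally show ?thesis .
qed

text \<open>Union bound over the fewer than \<open>(2 * k)^2\<close> pairs of positions. Small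
  \<open>A\<close> counts against the shorter trace \<open>tr (2 * (k - 1))\<close>, which
  \<open>tr_ratio\<close> later compares with \<open>tr (2 * k)\<close>.\<close>

lemma sum_closed_conflicts:
  assumes conf_sym: "\<And>a b. conf a b \<Longrightarrow> conf b a"
    and nn: "\<And>r q. \<alpha> r q \<ge> 0" "\<And>r q. \<beta> r q \<ge> 0"
    and split: "\<And>r q x y. r \<in> S \<Longrightarrow> q \<in> S \<Longrightarrow> M r q * (x * y) \<le> \<alpha> r q * x\<^sup>2 + \<beta> r q * y\<^sup>2"
    and A: "\<And>a r. a \<in> S \<Longrightarrow> r \<in> S \<Longrightarrow> (\<Sum>q\<in>S. of_bool (conf a q) * \<alpha> r q) \<le> A"
    and B: "\<And>q. q \<in> S \<Longrightarrow> (\<Sum>r\<in>S. \<beta> r q) \<le> B"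
    and AB: "A \<ge> 0" "B \<ge> 0" and k: "k > 0"
  shows "(\<Sum>xs\<in>lists_of S (2 * k). of_bool (\<exists>i j. i < j \<and> j < 2 * k \<and> conf (xs ! i) (xs ! j)) * closed_weight M xs)
           \<le> (2 * k)\<^sup>2 * (A * tr (2 * (k - 1)) + B * tr (2 * k))"
proof -
  define C where "C = A * tr (2 * (k - 1)) + B * tr (2 * k)"
  have C: "C \<ge> 0" unfolding C_def using AB by (intro add_nonneg_nonneg mult_nonneg_nonneg tr_nonneg)
  have cw: "closed_weight M xs \<ge> 0" for xs
    unfolding closed_weight_def by (rule walk_weight_nonneg)
  have dist: "(\<Sum>a\<in>S. \<Sum>b\<in>S. of_bool (conf a b) * mp j a b * mp (2 * k - j) b a) \<le> C"
    if "0 < j" "j < 2 * k" for j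
  proof (cases "j \<le> k")
    case True
    show ?thesis unfolding C_def
      using that True by (intro conflict_at_distance[OF nn split A B]) auto
  next
    case False
    \<comment> \<open>Beyond half the length the pair is read the other way round, at distance
      \<open>2 * k - j\<close>, by symmetry of \<open>conf\<close>.\<close>
    have "(\<Sum>a\<in>S. \<Sum>b\<in>S. of_bool (conf a b) * mp j a b * mp (2 * k - j) b a) =
          (\<Sum>b\<in>S. \<Sum>a\<in>S. of_bool (conf b a) * mp (2 * k - j) b a * mp (2 * k - (2 * k - j)) a b)"
      using conf_sym that by (subst sum.swap, intro sum.cong refl) (auto simp: of_bool_def)
    also have "\<dots> \<le> C" unfolding C_def
      using that False by (intro conflict_at_distance[OF nn split A B]) auto
    finally show ?thesis .
  qed
  let ?P = "{(i, j). i < j \<and> j < 2 * k}"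
  have finP: "finite ?P" by (rule finite_subset[of _ "{..<2*k} \<times> {..<2*k}"]) auto
  have "card ?P \<le> card ({..<2*k} \<times> {..<2*k})" by (intro card_mono) auto
  then have cardP: "real (card ?P) \<le> (2 * k)\<^sup>2"
    by (simp add: power2_eq_square flip: of_nat_mult)
  have "(\<Sum>xs\<in>lists_of S (2 * k). of_bool (\<exists>i j. i < j \<and> j < 2 * k \<and> conf (xs ! i) (xs ! j)) * closed_weight M xs)
     \<le> (\<Sum>xs\<in>lists_of S (2 * k). (\<Sum>(i, j)\<in>?P. of_bool (conf (xs ! i) (xs ! j)) * closed_weight M xs))"
  proof (rule sum_mono)
    fix xs
    show "of_bool (\<exists>i j. i < j \<and> j < 2 * k \<and> conf (xs ! i) (xs ! j)) * closed_weight M xs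
       \<le> (\<Sum>(i, j)\<in>?P. of_bool (conf (xs ! i) (xs ! j)) * closed_weight M xs)"
    proof (cases "\<exists>i j. i < j \<and> j < 2 * k \<and> conf (xs ! i) (xs ! j)")
      case True
      then obtain i j where ij: "i < j" "j < 2 * k" "conf (xs ! i) (xs ! j)" by blast
      have "(case (i, j) of (i, j) \<Rightarrow> of_bool (conf (xs ! i) (xs ! j)) * closed_weight M xs)
         \<le> (\<Sum>(i, j)\<in>?P. of_bool (conf (xs ! i) (xs ! j)) * closed_weight M xs)"
        using ij finP cw by (intro member_le_sum) auto
      then show ?thesis using True ij by simp
    qed (auto intro!: sum_nonneg simp: cw)
  qed
  also have "\<dots> = (\<Sum>(i, j)\<in>?P. \<Sum>xs\<in>lists_of S (2 * k). of_bool (conf (xs ! i) (xs ! j)) * closed_weight M xs)"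
    by (subst sum.swap) (simp add: case_prod_beta)
  also have "\<dots> \<le> (\<Sum>(i, j)\<in>?P. C)"
  proof (rule sum_mono, clarify)
    fix i j assume ij: "i < j" "j < 2 * k"
    have "(\<Sum>xs\<in>lists_of S (2 * k). of_bool (conf (xs ! i) (xs ! j)) * closed_weight M xs) =
      (\<Sum>a\<in>S. \<Sum>b\<in>S. of_bool (conf a b) * mp (j - i) a b * mp (2 * k - (j - i)) b a)"
      using sum_closed_pair[of i j "2 * k" "\<lambda>a b. of_bool (conf a b)"] ij by simp
    also have "\<dots> \<le> C" using ij by (intro dist) auto
    finally show "(\<Sum>xs\<in>lists_of S (2 * k). of_bool (conf (xs ! i) (xs ! j)) * closed_weight M xs) \<le> C" .
  qed
  also have "\<dots> = card ?P * C" by simp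
  also have "\<dots> \<le> (2 * k)\<^sup>2 * C" using cardP C by (intro mult_right_mono) auto
  finally show ?thesis by (simp add: C_def)
qed

text \<open>The remaining \<open>2 * k - 2\<close> steps are cut at their midpoint \<open>x\<close>,
  and AM-GM decouples the halves starting at \<open>a\<close> and \<open>b\<close>. By symmetry of
  \<open>h\<close> both terms are equal, and in each the heavy double step sums to at most
  \<open>\<Phi>\<close>.\<close>

lemma heavy_steps:
  assumes sym_h: "\<And>a b. h a b \<Longrightarrow> h b a"
    and \<Phi>: "\<And>a. a \<in> S \<Longrightarrow> (\<Sum>b\<in>S. of_bool (h a b) * mp 2 a b) \<le> \<Phi>"
    and k: "k > 0"
  shows "(\<Sum>a\<in>S. \<Sum>b\<in>S. of_bool (h a b) * mp 2 a b * mp (2 * k - 2) b a) \<le> \<Phi> * tr (2 * k - 2)"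
proof -
  let ?w = "mp (k - 1)"
  let ?H = "\<lambda>a b. of_bool (h a b) * mp 2 a b"
  have "(\<Sum>a\<in>S. \<Sum>b\<in>S. ?H a b * mp (2 * k - 2) b a)
     = (\<Sum>a\<in>S. \<Sum>b\<in>S. \<Sum>x\<in>S. ?H a b * (?w a x * ?w b x))"
  proof (intro sum.cong refl)
    fix a b assume ab: "a \<in> S" "b \<in> S"
    have "mp (2 * k - 2) b a = mp ((k - 1) + (k - 1)) b a"
      by (rule arg_cong[where f = "\<lambda>n. mp n b a"]) simp
    also have "\<dots> = (\<Sum>x\<in>S. ?w a x * ?w b x)"
      unfolding mp_add[OF ab(2)]
    proof (intro sum.cong refl)
      fix c assume "c \<in> S"
      then show "?w b c * ?w c a = ?w a c * ?w b c" using mp_sym[OF \<open>c \<in> S\<close> ab(1), of "k - 1"] by simp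
    qed
    finally show "?H a b * mp (2 * k - 2) b a = (\<Sum>x\<in>S. ?H a b * (?w a x * ?w b x))"
      by (simp add: sum_distrib_left)
  qed
  also have "\<dots> \<le> (\<Sum>a\<in>S. \<Sum>b\<in>S. \<Sum>x\<in>S. ?H a b * ((?w a x)\<^sup>2 / 2 + (?w b x)\<^sup>2 / 2))"
  proof (intro sum_mono mult_left_mono)
    fix a b x
    show "?w a x * ?w b x \<le> (?w a x)\<^sup>2 / 2 + (?w b x)\<^sup>2 / 2"
      using sum_squares_bound[of "?w a x" "?w b x"] by simp
  qed (auto simp: mp_nonneg)
  also have "\<dots> = (\<Sum>a\<in>S. \<Sum>b\<in>S. \<Sum>x\<in>S. ?H a b * ((?w a x)\<^sup>2 / 2))
                + (\<Sum>a\<in>S. \<Sum>b\<in>S. \<Sum>x\<in>S. ?H a b * ((?w b x)\<^sup>2 / 2))"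
    by (simp add: sum.distrib distrib_left)
  also have "(\<Sum>a\<in>S. \<Sum>b\<in>S. \<Sum>x\<in>S. ?H a b * ((?w b x)\<^sup>2 / 2))
           = (\<Sum>a\<in>S. \<Sum>b\<in>S. \<Sum>x\<in>S. ?H a b * ((?w a x)\<^sup>2 / 2))"
  proof -
    have "(\<Sum>a\<in>S. \<Sum>b\<in>S. \<Sum>x\<in>S. ?H a b * ((?w b x)\<^sup>2 / 2))
        = (\<Sum>b\<in>S. \<Sum>a\<in>S. \<Sum>x\<in>S. ?H a b * ((?w b x)\<^sup>2 / 2))" by (rule sum.swap)
    also have "\<dots> = (\<Sum>a\<in>S. \<Sum>b\<in>S. \<Sum>x\<in>S. ?H a b * ((?w a x)\<^sup>2 / 2))"
    proof (rule sum.cong[OF refl], rule sum.cong[OF refl], rule sum.cong[OF refl])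
      fix a b x assume "b \<in> S" "a \<in> S"
      then have "mp 2 b a = mp 2 a b" by (rule mp_sym)
      moreover have "h b a = h a b" using sym_h by blast
      ultimately show "?H b a * ((?w a x)\<^sup>2 / 2) = ?H a b * ((?w a x)\<^sup>2 / 2)" by (simp only:)
    qed
    finally show ?thesis .
  qed
  also have "(\<Sum>a\<in>S. \<Sum>b\<in>S. \<Sum>x\<in>S. ?H a b * ((?w a x)\<^sup>2 / 2)) + (\<Sum>a\<in>S. \<Sum>b\<in>S. \<Sum>x\<in>S. ?H a b * ((?w a x)\<^sup>2 / 2))
     = (\<Sum>a\<in>S. \<Sum>x\<in>S. (?w a x)\<^sup>2 * (\<Sum>b\<in>S. ?H a b))"
  proof -
    have "(\<Sum>a\<in>S. \<Sum>b\<in>S. \<Sum>x\<in>S. ?H a b * ((?w a x)\<^sup>2 / 2)) = (\<Sum>a\<in>S. \<Sum>x\<in>S. (?w a x)\<^sup>2 * (\<Sum>b\<in>S. ?H a b)) / 2"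
    proof -
      have "(\<Sum>b\<in>S. \<Sum>x\<in>S. ?H a b * ((?w a x)\<^sup>2 / 2)) = (\<Sum>x\<in>S. (?w a x)\<^sup>2 * (\<Sum>b\<in>S. ?H a b)) / 2" for a
      proof -
        have "(\<Sum>b\<in>S. \<Sum>x\<in>S. ?H a b * ((?w a x)\<^sup>2 / 2)) = (\<Sum>x\<in>S. \<Sum>b\<in>S. ?H a b * ((?w a x)\<^sup>2 / 2))"
          by (rule sum.swap)
        also have "\<dots> = (\<Sum>x\<in>S. (\<Sum>b\<in>S. ?H a b) * ((?w a x)\<^sup>2 / 2))"
          by (simp only: sum_distrib_right)
        finally show ?thesis by (simp only: sum_divide_distrib times_divide_eq_right mult.commute)
      qed
      then show ?thesis by (simp only: sum_divide_distrib)
    qed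
    then show ?thesis by simp
  qed
  also have "\<dots> \<le> (\<Sum>a\<in>S. \<Sum>x\<in>S. (?w a x)\<^sup>2 * \<Phi>)"
    using \<Phi> by (intro sum_mono mult_left_mono) auto
  also have "\<dots> = \<Phi> * tr (2 * (k - 1))"
    by (simp add: tr_double sum_distrib_left mult_ac)
  finally show ?thesis by (simp add: right_diff_distrib')
qed

text \<open>If \<open>M\<close> is a random walk kernel made symmetric, \<open>v\<close> being the square root of the stationary
  measure, then \<open>1\<close> is an eigenvalue of \<open>M\<close>.\<close>

lemma tr_ge_1:
  assumes v: "\<And>a. a \<in> S \<Longrightarrow> v a > 0" and eig: "\<And>a. a \<in> S \<Longrightarrow> (\<Sum>b\<in>S. M a b * v b) = v a"
    and ne: "S \<noteq> {}"
  shows "tr (2 * k) \<ge> 1"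
proof -
  have eig_k: "(\<Sum>b\<in>S. mp k a b * v b) = v a" if "a \<in> S" for a
    using that
  proof (induction k arbitrary: a)
    case (Suc k)
    have "(\<Sum>b\<in>S. mp (Suc k) a b * v b) = (\<Sum>c\<in>S. M a c * (\<Sum>b\<in>S. mp k c b * v b))"
      by (simp add: sum_distrib_left sum_distrib_right mult.assoc) (rule sum.swap)
    also have "\<dots> = v a" using Suc eig by simp
    finally show ?case .
  qed simp
  define s where "s = (\<Sum>a\<in>S. (v a)\<^sup>2)"
  have s: "s > 0" unfolding s_def using ne by (intro sum_pos fin zero_less_power v)
  have "(\<Sum>a\<in>S. \<Sum>b\<in>S. mp k a b * (v a * v b)) = (\<Sum>a\<in>S. v a * (\<Sum>b\<in>S. mp k a b * v b))"
    unfolding sum_distrib_left by (rule sum.cong[OF refl], rule sum.cong[OF refl]) simp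
  also have "\<dots> = s" by (simp add: eig_k s_def power2_eq_square)
  finally have "s\<^sup>2 \<le> (\<Sum>a\<in>S. \<Sum>b\<in>S. (mp k a b)\<^sup>2) * (\<Sum>a\<in>S. \<Sum>b\<in>S. (v a * v b)\<^sup>2)"
    using cauchy_schwarz_double_sum[where f = "mp k" and g = "\<lambda>a b. v a * v b" and A = S and B = S] by simp
  also have "(\<Sum>a\<in>S. \<Sum>b\<in>S. (v a * v b)\<^sup>2) = s\<^sup>2"
    unfolding s_def power2_eq_square[of "sum _ _"] sum_product power_mult_distrib ..
  also have "(\<Sum>a\<in>S. \<Sum>b\<in>S. (mp k a b)\<^sup>2) = tr (2 * k)" by (rule tr_double[symmetric])
  finally show ?thesis using s by simp
qed

end

text \<open>An extremal choice instead of repeated deletion: \<open>X\<close> maximises its size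
  minus the total cost \<open>m\<close> of its images. Removing a fibre that is smaller than its own
  cost would increase this quantity, and it is positive at the start.\<close>

lemma fiber_pruning:
  fixes \<phi> :: "'i \<Rightarrow> 'x \<Rightarrow> 'y" and m :: "'i \<Rightarrow> 'y \<Rightarrow> real"
  assumes fin: "finite X0" "finite I" and m: "\<And>i y. m i y \<ge> 0"
    and big: "(\<Sum>i\<in>I. \<Sum>y\<in>\<phi> i ` X0. m i y) < card X0"
  obtains X where "X \<subseteq> X0" "X \<noteq> {}" "\<And>i x. i \<in> I \<Longrightarrow> x \<in> X \<Longrightarrow> m i (\<phi> i x) \<le> card {x' \<in> X. \<phi> i x' = \<phi> i x}"
proof -
  define F where "F X = real (card X) - (\<Sum>i\<in>I. \<Sum>y\<in>\<phi> i ` X. m i y)" for X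
  have "finite (F ` Pow X0)" "F ` Pow X0 \<noteq> {}" using fin by auto
  from Max_in[OF this] obtain X where X: "X \<subseteq> X0" "F X = Max (F ` Pow X0)" by auto
  have max: "F Z \<le> F X" if "Z \<subseteq> X0" for Z
    unfolding X(2) using that fin by (intro Max_ge) auto
  have "F X0 > 0" using big by (simp add: F_def)
  with max[of X0] have "F X > 0" by simp
  then have ne: "X \<noteq> {}" by (auto simp: F_def)
  have finX: "finite X" using X fin finite_subset by blast
  have "m i (\<phi> i x) \<le> card {x' \<in> X. \<phi> i x' = \<phi> i x}" if ix: "i \<in> I" "x \<in> X" for i x
  proof (rule ccontr)
    assume less: "\<not> ?thesis"
    let ?A = "{x' \<in> X. \<phi> i x' = \<phi> i x}"
    let ?Z = "X - ?A"
    have 1: "real (card ?Z) = card X - card ?A"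
      using finX by (subst card_Diff_subset) (auto simp: card_mono)
    have "(\<Sum>l\<in>I. \<Sum>y\<in>\<phi> l ` ?Z. m l y) = (\<Sum>y\<in>\<phi> i ` ?Z. m i y) + (\<Sum>l\<in>I - {i}. \<Sum>y\<in>\<phi> l ` ?Z. m l y)"
      using sum.remove[OF fin(2) ix(1)] by simp
    also have "\<dots> \<le> (\<Sum>y\<in>\<phi> i ` X - {\<phi> i x}. m i y) + (\<Sum>l\<in>I - {i}. \<Sum>y\<in>\<phi> l ` X. m l y)"
      using finX m by (intro add_mono sum_mono sum_mono2) auto
    also have "\<dots> = (\<Sum>l\<in>I. \<Sum>y\<in>\<phi> l ` X. m l y) - m i (\<phi> i x)"
      using sum.remove[OF fin(2) ix(1), of "\<lambda>l. \<Sum>y\<in>\<phi> l ` X. m l y"]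
        sum.remove[of "\<phi> i ` X" "\<phi> i x" "m i"] finX ix by simp
    finally have "F ?Z > F X" using 1 less by (simp add: F_def)
    moreover have "F ?Z \<le> F X" using X by (intro max) auto
    ultimately show False by simp
  qed
  with X(1) ne show ?thesis using that by blast
qed

section \<open>Pruned closed walks in a host graph\<close>

text \<open>A graph is stored as a symmetric set of ordered pairs, so that adjacency is a symmetric
  kernel and \<open>card E / n\<close> is the average degree.\<close>

locale host =
  fixes V :: "'a set" and E :: "('a \<times> 'a) set"
  assumes finV: "finite V" and E_sub: "E \<subseteq> V \<times> V"
    and symE: "\<And>a b. (a, b) \<in> E \<Longrightarrow> (b, a) \<in> E" and ne: "V \<noteq> {}"
begin

abbreviation adj :: "'a \<Rightarrow> 'a \<Rightarrow> real" where
  "adj a b \<equiv> of_bool ((a, b) \<in> E)"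

sublocale sym_kernel V adj
  using finV symE by unfold_locales (auto simp: of_bool_def)

definition n :: real where "n = card V"
definition d :: real where "d = card E / n"

lemma n_pos: "n > 0"
  using finV ne by (simp add: n_def card_gt_0_iff)

lemma finE: "finite E"
  using E_sub finV finite_subset by blast

lemma d_nonneg: "d \<ge> 0"
  using n_pos by (simp add: d_def)

lemma sum_adj: "(\<Sum>b\<in>V. adj a b) = card (E `` {a})"
proof -
  have "V \<inter> {b. (a, b) \<in> E} = E `` {a}" using E_sub by auto
  then show ?thesis using finV by (simp add: sum_of_bool_eq)
qed

lemma mp_2_eq: "b \<in> V \<Longrightarrow> mp 2 a b = card (E `` {a} \<inter> E `` {b})"
proof -
  assume b: "b \<in> V"
  have "mp 2 a b = (\<Sum>c\<in>V. of_bool ((a, c) \<in> E \<and> (c, b) \<in> E))"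
    using b by (simp add: numeral_2_eq_2 of_bool_conj)
  also have "\<dots> = card (V \<inter> {c. (a, c) \<in> E \<and> (c, b) \<in> E})"
    using finV by (simp add: sum_of_bool_eq)
  also have "V \<inter> {c. (a, c) \<in> E \<and> (c, b) \<in> E} = E `` {a} \<inter> E `` {b}"
    using E_sub symE by auto
  finally show ?thesis .
qed

lemma walk_weight_adj: "walk_weight adj xs = of_bool (successively (\<lambda>a b. (a, b) \<in> E) xs)"
  by (induction xs rule: induct_list012) (auto simp: of_bool_def)

definition CW :: "nat \<Rightarrow> 'a list set" where
  "CW L = {xs \<in> lists_of V L. closed_weight adj xs \<noteq> 0}"

lemma finite_CW: "finite (CW L)"
  unfolding CW_def using finite_lists_of[OF finV] by simp

lemma closed_weight_CW: "xs \<in> CW L \<Longrightarrow> closed_weight adj xs = 1"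
  by (simp add: CW_def closed_weight_def walk_weight_adj)

lemma sum_closed_filter:
  "(\<Sum>xs\<in>lists_of V L. of_bool (P xs) * closed_weight adj xs) = card {xs \<in> CW L. P xs}"
proof -
  have "(\<Sum>xs\<in>lists_of V L. of_bool (P xs) * closed_weight adj xs)
      = (\<Sum>xs\<in>lists_of V L. of_bool (xs \<in> CW L \<and> P xs))"
  proof (rule sum.cong[OF refl])
    fix xs assume "xs \<in> lists_of V L"
    then show "of_bool (P xs) * closed_weight adj xs = of_bool (xs \<in> CW L \<and> P xs)"
      using closed_weight_CW[of xs L] by (cases "closed_weight adj xs = 0") (auto simp: CW_def)
  qed
  also have "\<dots> = card (lists_of V L \<inter> {xs. xs \<in> CW L \<and> P xs})"
    using finite_lists_of[OF finV] by (simp add: sum_of_bool_eq)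
  also have "lists_of V L \<inter> {xs. xs \<in> CW L \<and> P xs} = {xs \<in> CW L. P xs}"
    by (auto simp: CW_def)
  finally show ?thesis .
qed

lemma card_CW: "L > 0 \<Longrightarrow> card (CW L) = tr L"
  using sum_closed[of L] sum_closed_filter[of "\<lambda>_. True" L] by simp

lemma CW_adj: "xs \<in> CW L \<Longrightarrow> i < L \<Longrightarrow> (xs ! i, xs ! (Suc i mod L)) \<in> E"
  using closed_weight_nonzero[of adj xs i] by (auto simp: CW_def lists_of_def of_bool_def split: if_splits)

lemma length_CW: "xs \<in> CW L \<Longrightarrow> length xs = L"
  by (simp add: CW_def lists_of_def)

lemma set_CW: "xs \<in> CW L \<Longrightarrow> set xs \<subseteq> V"
  by (simp add: CW_def lists_of_def)

text \<open>The number of walks of length \<open>2 j\<close> is the sum of the squares of the numbers of walks of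
  length \<open>j\<close> that start at a given vertex.\<close>

lemma walks_double:
  "(\<Sum>a\<in>V. \<Sum>b\<in>V. mp j a b)\<^sup>2 \<le> n * (\<Sum>a\<in>V. \<Sum>b\<in>V. mp (2 * j) a b)"
proof -
  define s where "s c = (\<Sum>b\<in>V. mp j c b)" for c
  have "(\<Sum>a\<in>V. \<Sum>b\<in>V. mp (2 * j) a b) = (\<Sum>a\<in>V. \<Sum>b\<in>V. \<Sum>c\<in>V. mp j a c * mp j c b)"
    by (rule sum.cong[OF refl], rule sum.cong[OF refl]) (simp add: mp_add mult_2)
  also have "\<dots> = (\<Sum>c\<in>V. \<Sum>b\<in>V. \<Sum>a\<in>V. mp j a c * mp j c b)"
    by (rule sum_swap3)
  also have "\<dots> = (\<Sum>c\<in>V. s c * s c)"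
  proof (rule sum.cong[OF refl])
    fix c assume c: "c \<in> V"
    have "(\<Sum>a\<in>V. mp j a c) = s c"
      unfolding s_def by (rule sum.cong[OF refl]) (simp add: mp_sym c)
    then show "(\<Sum>b\<in>V. \<Sum>a\<in>V. mp j a c * mp j c b) = s c * s c"
      by (simp add: s_def flip: sum_distrib_right sum_distrib_left)
  qed
  finally have *: "(\<Sum>a\<in>V. \<Sum>b\<in>V. mp (2 * j) a b) = (\<Sum>c\<in>V. (s c)\<^sup>2)"
    by (simp add: power2_eq_square)
  have "(\<Sum>c\<in>V. 1 * s c)\<^sup>2 \<le> (\<Sum>c\<in>V. 1\<^sup>2) * (\<Sum>c\<in>V. (s c)\<^sup>2)"
    by (rule Cauchy_Schwarz_ineq_sum)
  then show ?thesis by (simp add: * n_def s_def)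
qed

text \<open>Repeated squaring by \<open>walks_double\<close>, starting from the average degree;
  hence only walk lengths that are powers of two.\<close>

lemma walks_pow2: "n * d ^ (2 ^ j) \<le> (\<Sum>a\<in>V. \<Sum>b\<in>V. mp (2 ^ j) a b)"
proof (induction j)
  case 0
  have "(\<Sum>a\<in>V. \<Sum>b\<in>V. mp (Suc 0) a b) = (\<Sum>a\<in>V. real (card (E `` {a})))"
    by (simp add: sum_adj[symmetric] cong: sum.cong)
  also have "\<dots> = card (SIGMA a:V. E `` {a})"
    using finV finE by (simp add: card_SigmaI finite_Image)
  also have "(SIGMA a:V. E `` {a}) = E" using E_sub by auto
  finally show ?case using n_pos by (simp add: d_def del: mp.simps)
next
  case (Suc j)
  have "(n * d ^ 2 ^ j)\<^sup>2 \<le> (\<Sum>a\<in>V. \<Sum>b\<in>V. mp (2 ^ j) a b)\<^sup>2"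
    using Suc n_pos d_nonneg by (intro power_mono) auto
  also have "\<dots> \<le> n * (\<Sum>a\<in>V. \<Sum>b\<in>V. mp (2 ^ Suc j) a b)"
    using walks_double[of "2 ^ j"] by simp
  finally have "n * (n * d ^ 2 ^ Suc j) \<le> n * (\<Sum>a\<in>V. \<Sum>b\<in>V. mp (2 ^ Suc j) a b)"
    by (simp add: power_mult_distrib power2_eq_square mult_ac flip: power_add mult_2)
  then show ?case using n_pos by simp
qed

text \<open>Cauchy-Schwarz against the constant 1 passes from the number of walks of length 16 to
  the squared norm of \<open>mp 16\<close>, and the factors \<open>n^2\<close> cancel.\<close>

lemma tr_32: "tr 32 \<ge> d ^ 32"
proof -
  have "(n * d ^ 16)\<^sup>2 \<le> (\<Sum>a\<in>V. \<Sum>b\<in>V. mp 16 a b * 1)\<^sup>2"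
    using walks_pow2[of 4] n_pos d_nonneg by (intro power_mono) auto
  also have "\<dots> \<le> (\<Sum>a\<in>V. \<Sum>b\<in>V. (mp 16 a b)\<^sup>2) * (\<Sum>a\<in>V. \<Sum>b\<in>V. 1\<^sup>2)"
    by (rule cauchy_schwarz_double_sum)
  also have "\<dots> = tr 32 * n\<^sup>2"
    using tr_double[of 16] by (simp add: n_def power2_eq_square)
  finally show ?thesis using n_pos by (simp add: power_mult_distrib)
qed

definition arc :: "nat \<Rightarrow> nat \<Rightarrow> nat list" where
  "arc s m = map (\<lambda>i. (s + i) mod 32) [0..<m]"

definition sel :: "nat list \<Rightarrow> 'a list \<Rightarrow> 'a list" where
  "sel P xs = map ((!) xs) P"

lemma card_walks:
  assumes "\<And>a. real (card (E `` {a})) \<le> \<Delta>"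
  shows "card {xs \<in> lists_of V (Suc m). successively (\<lambda>a b. (a, b) \<in> E) xs} \<le> n * \<Delta> ^ m"
proof (induction m)
  case 0
  have "{xs \<in> lists_of V (Suc 0). successively (\<lambda>a b. (a, b) \<in> E) xs} \<subseteq> (\<lambda>x. [x]) ` V"
    by (auto simp: lists_of_def length_Suc_conv)
  then have "card {xs \<in> lists_of V (Suc 0). successively (\<lambda>a b. (a, b) \<in> E) xs} \<le> card V"
    using finV by (meson card_image_le card_mono finite_imageI le_trans)
  then show ?case by (simp add: n_def)
next
  case (Suc m)
  let ?W = "\<lambda>m. {xs \<in> lists_of V (Suc m). successively (\<lambda>a b. (a, b) \<in> E) xs}"
  have fin: "finite (?W m)" using finite_lists_of[OF finV] by simp
  have "?W (Suc m) \<subseteq> (\<lambda>(xs, x). x # xs) ` (SIGMA xs:?W m. E `` {hd xs})"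
  proof
    fix xs assume "xs \<in> ?W (Suc m)"
    then obtain x y ys where "xs = x # y # ys" "(x, y) \<in> E" "y # ys \<in> ?W m"
      by (auto simp: lists_of_def length_Suc_conv)
    then show "xs \<in> (\<lambda>(xs, x). x # xs) ` (SIGMA xs:?W m. E `` {hd xs})"
      using symE by (intro image_eqI[of _ _ "(y # ys, x)"]) auto
  qed
  then have "card (?W (Suc m)) \<le> card (SIGMA xs:?W m. E `` {hd xs})"
    using fin finE by (intro surj_card_le finite_SigmaI finite_Image)
  also have "\<dots> = (\<Sum>xs\<in>?W m. card (E `` {hd xs}))"
    using fin finE by (simp add: card_SigmaI finite_Image)
  finally have "real (card (?W (Suc m))) \<le> (\<Sum>xs\<in>?W m. real (card (E `` {hd xs})))"
    by (simp flip: of_nat_sum)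
  also have "\<dots> \<le> (\<Sum>xs\<in>?W m. \<Delta>)" using assms by (intro sum_mono)
  also have "\<dots> \<le> (n * \<Delta> ^ m) * \<Delta>"
    using Suc assms[of undefined] by (simp add: mult_right_mono)
  finally show ?case by (simp add: mult_ac)
qed

lemma card_sel_arc:
  assumes "\<And>a. real (card (E `` {a})) \<le> \<Delta>"
  shows "card (sel (arc s (Suc m)) ` CW 32) \<le> n * \<Delta> ^ m"
proof -
  have "sel (arc s (Suc m)) ` CW 32 \<subseteq> {xs \<in> lists_of V (Suc m). successively (\<lambda>a b. (a, b) \<in> E) xs}"
  proof clarify
    fix xs assume xs: "xs \<in> CW 32"
    have "(xs ! ((s + i) mod 32), xs ! ((s + Suc i) mod 32)) \<in> E" for i
      using CW_adj[OF xs, of "(s + i) mod 32"] by (simp add: mod_Suc_eq)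
    then have "successively (\<lambda>a b. (a, b) \<in> E) (sel (arc s (Suc m)) xs)"
      unfolding successively_conv_nth by (simp add: sel_def arc_def del: upt_Suc)
    moreover have "set (sel (arc s (Suc m)) xs) \<subseteq> V"
      using set_CW[OF xs] length_CW[OF xs] by (force simp: sel_def arc_def simp del: upt_Suc)
    ultimately show "sel (arc s (Suc m)) xs \<in> lists_of V (Suc m) \<and> successively (\<lambda>a b. (a, b) \<in> E) (sel (arc s (Suc m)) xs)"
      by (simp add: lists_of_def sel_def arc_def del: upt_Suc)
  qed
  then have "card (sel (arc s (Suc m)) ` CW 32) \<le> card {xs \<in> lists_of V (Suc m). successively (\<lambda>a b. (a, b) \<in> E) xs}"
    using finite_lists_of[OF finV] by (intro card_mono) auto
  then show ?thesis using card_walks[OF assms, of m] by linarith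
qed

end

text \<open>A closed walk \<open>v\<^sub>0, \<dots>, v\<^sub>3\<^sub>1\<close> is read as two rows of sixteen vertices, \<open>v\<^sub>0 v\<^sub>1 | v\<^sub>4 v\<^sub>5 | \<dots>\<close> and
  \<open>v\<^sub>2 v\<^sub>3 | v\<^sub>6 v\<^sub>7 | \<dots>\<close>, aligned so that vertices in equal columns are consecutive on the walk.\<close>

definition pos :: "bool \<Rightarrow> nat \<Rightarrow> nat" where
  "pos t j = (if t then (if even j then 2 * j + 31 else 2 * j) mod 32 else 2 * j - j mod 2)"

definition cols :: "bool \<Rightarrow> nat list" where
  "cols t = map (pos t) [0..<16]"

lemma cols_eval:
  "cols False = [0, 1, 4, 5, 8, 9, 12, 13, 16, 17, 20, 21, 24, 25, 28, 29]"
  "cols True = [31, 2, 3, 6, 7, 10, 11, 14, 15, 18, 19, 22, 23, 26, 27, 30]"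
  by (simp_all add: cols_def pos_def upt_rec)

context host
begin

lemma card_heavy_CW:
  assumes heavy: "\<And>a. a \<in> V \<Longrightarrow> (\<Sum>b\<in>V. of_bool (mp 2 a b > t) * mp 2 a b) \<le> \<Phi>"
    and i: "i < 32"
  shows "card {xs \<in> CW 32. mp 2 (xs ! i) (xs ! ((i + 2) mod 32)) > t} \<le> \<Phi> * tr 30"
proof -
  define h where "h a b \<longleftrightarrow> mp 2 a b > t \<and> a \<in> V \<and> b \<in> V" for a b
  have h_sym: "h a b \<Longrightarrow> h b a" for a b by (simp add: h_def mp_sym del: mp.simps)
  have bound: "(\<Sum>a\<in>V. \<Sum>b\<in>V. of_bool (h a b) * mp 2 a b * mp 30 b a) \<le> \<Phi> * tr 30"
  proof -
    have "(\<Sum>b\<in>V. of_bool (h a b) * mp 2 a b) \<le> \<Phi>" if "a \<in> V" for a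
      using heavy[OF that] that by (simp add: h_def cong: sum.cong)
    from heavy_steps[OF h_sym this, of 16] show ?thesis by simp
  qed
  have mem: "xs ! j \<in> V" if "xs \<in> CW 32" "j < 32" for xs j
    using set_CW[OF that(1)] length_CW[OF that(1)] that(2) by auto
  show ?thesis
  proof (cases "i < 30")
    case True
    have "real (card {xs \<in> CW 32. mp 2 (xs ! i) (xs ! ((i + 2) mod 32)) > t})
        = card {xs \<in> CW 32. h (xs ! i) (xs ! (i + 2))}"
      using True mem by (intro arg_cong[where f = "\<lambda>A. real (card A)"]) (auto simp: h_def)
    also have "\<dots> = (\<Sum>a\<in>V. \<Sum>b\<in>V. of_bool (h a b) * mp (i + 2 - i) a b * mp (32 - (i + 2 - i)) b a)"
      unfolding sum_closed_filter[symmetric] using True by (intro sum_closed_pair) auto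
    finally show ?thesis using bound by simp
  next
    \<comment> \<open>Here the pair wraps around the end of the list: it is read as positions
      \<open>j < i\<close> at distance 30, and symmetry exchanges the two arcs.\<close>
    case False
    define j where "j = i - 30"
    have j: "(i + 2) mod 32 = j" "i = j + 30" "j < 2" using False i by (auto simp: j_def mod_if)
    have "real (card {xs \<in> CW 32. mp 2 (xs ! i) (xs ! ((i + 2) mod 32)) > t})
        = card {xs \<in> CW 32. h (xs ! j) (xs ! i)}"
      using i j mem h_sym by (intro arg_cong[where f = "\<lambda>A. real (card A)"]) (auto simp: h_def mp_sym)
    also have "\<dots> = (\<Sum>a\<in>V. \<Sum>b\<in>V. of_bool (h a b) * mp (i - j) a b * mp (32 - (i - j)) b a)"
      unfolding sum_closed_filter[symmetric] using i j by (intro sum_closed_pair) auto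
    also have "\<dots> = (\<Sum>a\<in>V. \<Sum>b\<in>V. of_bool (h a b) * mp 2 a b * mp 30 b a)"
    proof (rule sum.cong[OF refl], rule sum.cong[OF refl])
      fix a b assume "a \<in> V" "b \<in> V"
      then show "of_bool (h a b) * mp (i - j) a b * mp (32 - (i - j)) b a = of_bool (h a b) * mp 2 a b * mp 30 b a"
        using mp_sym[of a b 2] mp_sym[of a b 30] j by (simp del: mp.simps)
    qed
    finally show ?thesis using bound by simp
  qed
qed

lemma card_repeating_CW:
  assumes deg: "\<And>a. real (card (E `` {a})) \<le> \<Delta>" and \<Delta>: "\<Delta> > 0"
  shows "card {xs \<in> CW 32. \<not> distinct xs} \<le> 4 * 32 ^ 4 * \<Delta> * tr 30 + tr 32 / 16"
proof -
  \<comment> \<open>A repetition is a conflict for equality. The AM-GM weight makes the contribution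
    of the longer trace \<open>32^2 * \<Delta> / (2 * \<mu>) = 1 / 16\<close>; the other
    contribution is \<open>32^2 * \<mu> / 2 = 4 * 32^4 * \<Delta>\<close> times
    \<open>tr 30\<close>.\<close>
  define \<mu> where "\<mu> = 8192 * \<Delta>"
  have \<mu>: "\<mu> > 0" using \<Delta> by (simp add: \<mu>_def)
  have "(\<Sum>xs\<in>lists_of V (2 * 16). of_bool (\<exists>i j. i < j \<and> j < 2 * 16 \<and> xs ! i = xs ! j) * closed_weight adj xs)
     \<le> (2 * 16)\<^sup>2 * (\<mu> / 2 * tr (2 * (16 - 1)) + \<Delta> / (2 * \<mu>) * tr (2 * 16))"
  proof (rule order_trans[OF sum_closed_conflicts[where \<alpha> = "\<lambda>r q. \<mu> / 2 * adj r q" and \<beta> = "\<lambda>r q. 1 / (2 * \<mu>) * adj r q"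
        and A = "\<mu> / 2" and B = "\<Delta> / (2 * \<mu>)"]])
    show "adj r q * (x * y) \<le> \<mu> / 2 * adj r q * x\<^sup>2 + 1 / (2 * \<mu>) * adj r q * y\<^sup>2" for r q x y
    proof -
      have "0 \<le> (\<mu> * x - y)\<^sup>2 / (2 * \<mu>)" using \<mu> by simp
      also have "\<dots> = \<mu> / 2 * x\<^sup>2 + 1 / (2 * \<mu>) * y\<^sup>2 - x * y"
        using \<mu> by (simp add: field_simps power2_eq_square)
      finally show ?thesis by (auto simp: of_bool_def)
    qed
    show "(\<Sum>q\<in>V. of_bool (a = q) * (\<mu> / 2 * adj r q)) \<le> \<mu> / 2" if "a \<in> V" for a r
      using \<mu> delta_sum(1)[OF that, of "\<lambda>q. \<mu> / 2 * adj r q"] by (auto simp: of_bool_def)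
    show "(\<Sum>r\<in>V. 1 / (2 * \<mu>) * adj r q) \<le> \<Delta> / (2 * \<mu>)" for q
    proof -
      have "(\<Sum>r\<in>V. adj r q) = (\<Sum>r\<in>V. adj q r)" using symE by (intro sum.cong refl) (auto simp: of_bool_def)
      also have "\<dots> \<le> \<Delta>" using sum_adj deg by metis
      finally have "(1 / (2 * \<mu>)) * (\<Sum>r\<in>V. adj r q) \<le> (1 / (2 * \<mu>)) * \<Delta>"
        using \<mu> by (intro mult_left_mono) auto
      then show ?thesis by (simp only: sum_distrib_left) simp
    qed
  qed (use \<mu> \<Delta> in auto)
  also have "(\<Sum>xs\<in>lists_of V (2 * 16). of_bool (\<exists>i j. i < j \<and> j < 2 * 16 \<and> xs ! i = xs ! j) * closed_weight adj xs)
     = card {xs \<in> CW 32. \<exists>i j. i < j \<and> j < 32 \<and> xs ! i = xs ! j}"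
    using sum_closed_filter[of "\<lambda>xs. \<exists>i j. i < j \<and> j < 32 \<and> xs ! i = xs ! j" 32] by simp
  also have "{xs \<in> CW 32. \<exists>i j. i < j \<and> j < 32 \<and> xs ! i = xs ! j} = {xs \<in> CW 32. \<not> distinct xs}"
  proof -
    have "(\<exists>i j. i < j \<and> j < 32 \<and> xs ! i = xs ! j) \<longleftrightarrow> \<not> distinct xs" if len: "length xs = 32" for xs :: "'a list"
    proof
      assume "\<not> distinct xs"
      then obtain i j where "i < 32" "j < 32" "i \<noteq> j" "xs ! i = xs ! j"
        using len by (auto simp: distinct_conv_nth)
      then show "\<exists>i j. i < j \<and> j < 32 \<and> xs ! i = xs ! j" by (metis linorder_neqE_nat)
    next
      assume "\<exists>i j. i < j \<and> j < 32 \<and> xs ! i = xs ! j"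
      then obtain i j where "i < j" "j < 32" "xs ! i = xs ! j" by blast
      then show "\<not> distinct xs" using len nth_eq_iff_index_eq[of xs i j] by auto
    qed
    then show ?thesis using length_CW by blast
  qed
  also have "(2 * 16)\<^sup>2 * (\<mu> / 2 * tr (2 * (16 - 1)) + \<Delta> / (2 * \<mu>) * tr (2 * 16))
      = 4 * 32 ^ 4 * \<Delta> * tr 30 + tr 32 / 16"
    using \<Delta> by (simp add: \<mu>_def field_simps)
  finally show ?thesis by simp
qed

definition light :: "real \<Rightarrow> 'a list \<Rightarrow> bool" where
  "light t xs \<longleftrightarrow> (\<forall>i<32. mp 2 (xs ! i) (xs ! ((i + 2) mod 32)) \<le> t)"

text \<open>Budget in units of \<open>tr 32\<close>: repeated vertices and heavy pairs take at most
  \<open>1 / 8\<close> each, so \<open>3 / 4\<close> of the closed walks enter the pruning. Its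
  costs are at most \<open>1 / 8\<close> for each of the three kinds of projection: omitting a pair,
  omitting one position, keeping one row.\<close>

lemma pruned_closed_walks:
  fixes \<Delta> \<rho> m0 K0 t \<Phi> :: real
  assumes deg: "\<And>a. real (card (E `` {a})) \<le> \<Delta>" and pos: "\<Delta> > 0" "d > 0" "\<rho> > 0" "m0 \<ge> 0" "K0 \<ge> 0"
    and heavy: "\<And>a. a \<in> V \<Longrightarrow> (\<Sum>b\<in>V. of_bool (mp 2 a b > t) * mp 2 a b) \<le> \<Phi>"
    and N1: "n \<le> \<rho> ^ 16 * d ^ 32" and N2: "32 * \<Phi> * \<rho> \<le> 1 / 8" and N3: "4 * 32 ^ 4 * \<Delta> * \<rho> \<le> 1 / 16"
    and N4: "16 * m0 * (n * \<Delta> ^ 29) \<le> d ^ 32 / 8" and N5: "2 * K0 * (n * \<Delta> ^ 30) \<le> d ^ 32 / 8"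
  obtains X where "X \<subseteq> CW 32" "X \<noteq> {}" "\<And>v. v \<in> X \<Longrightarrow> distinct v \<and> light t v"
    "\<And>v j. v \<in> X \<Longrightarrow> j < 16 \<Longrightarrow> m0 \<le> card {v' \<in> X. sel (arc (2 * j + 2) 30) v' = sel (arc (2 * j + 2) 30) v}"
    "\<And>v. v \<in> X \<Longrightarrow> K0 \<le> card {v' \<in> X. sel (arc 2 31) v' = sel (arc 2 31) v}"
    "\<And>v. v \<in> X \<Longrightarrow> K0 \<le> card {v' \<in> X. sel (arc 3 31) v' = sel (arc 3 31) v}"
    "\<And>v s. v \<in> X \<Longrightarrow> card {v' \<in> CW 32. sel (cols s) v' = sel (cols s) v} / 16
                        \<le> card {v' \<in> X. sel (cols s) v' = sel (cols s) v}"
proof -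
  define X0 where "X0 = {xs \<in> CW 32. distinct xs \<and> light t xs}"
  have trp: "tr 32 > 0" "tr 32 \<ge> d ^ 32" using tr_32 pos by (auto intro: less_le_trans[OF _ tr_32])
  have "tr (2 * 15) \<le> \<rho> * tr (2 * Suc 15)"
  proof (rule tr_ratio)
    have "n \<le> \<rho> ^ 16 * tr 32" using N1 trp pos by (meson mult_left_mono order_trans zero_le_power less_imp_le)
    then show "tr 0 \<le> \<rho> ^ Suc 15 * tr (2 * Suc 15)" by (simp add: tr_0 n_def)
  qed (use pos trp in auto)
  then have tr30: "tr 30 \<le> \<rho> * tr 32" by simp
  have card_CW: "real (card (CW 32)) = tr 32" by (rule card_CW) simp
  have "CW 32 \<subseteq> X0 \<union> {xs \<in> CW 32. \<not> distinct xs} \<union>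
      (\<Union>i<32. {xs \<in> CW 32. mp 2 (xs ! i) (xs ! ((i + 2) mod 32)) > t})"
    by (auto simp: X0_def light_def not_le)
  then have "card (CW 32) \<le> card (X0 \<union> {xs \<in> CW 32. \<not> distinct xs} \<union>
      (\<Union>i<32. {xs \<in> CW 32. mp 2 (xs ! i) (xs ! ((i + 2) mod 32)) > t}))"
    using finite_CW by (intro card_mono) (auto simp: X0_def)
  also have "\<dots> \<le> card X0 + card {xs \<in> CW 32. \<not> distinct xs} +
      (\<Sum>i<32. card {xs \<in> CW 32. mp 2 (xs ! i) (xs ! ((i + 2) mod 32)) > t})"
    by (intro order_trans[OF card_Un_le] add_mono card_UN_le card_Un_le) auto
  finally have "tr 32 \<le> card X0 + real (card {xs \<in> CW 32. \<not> distinct xs}) +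
      (\<Sum>i<32. real (card {xs \<in> CW 32. mp 2 (xs ! i) (xs ! ((i + 2) mod 32)) > t}))"
    unfolding card_CW[symmetric] by (simp flip: of_nat_sum of_nat_add del: of_nat_sum of_nat_add)
  also have "\<dots> \<le> card X0 + (4 * 32 ^ 4 * \<Delta> * tr 30 + tr 32 / 16) + (\<Sum>i<(32::nat). \<Phi> * tr 30)"
    by (intro add_mono sum_mono card_repeating_CW[OF deg pos(1)] card_heavy_CW[OF heavy]) auto
  also have "\<dots> \<le> card X0 + (1 / 16 * tr 32 + tr 32 / 16) + 1 / 8 * tr 32"
  proof -
    obtain a where a: "a \<in> V" using ne by auto
    have "0 \<le> \<Phi>" by (rule order_trans[OF _ heavy[OF a]]) (auto intro!: sum_nonneg mp_nonneg simp del: mp.simps)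
    then have "(32 * \<Phi>) * tr 30 \<le> (32 * \<Phi>) * (\<rho> * tr 32)" using tr30 by (intro mult_left_mono) auto
    also have "\<dots> \<le> 1 / 8 * tr 32" using mult_right_mono[OF N2, of "tr 32"] trp by (simp add: mult_ac)
    finally have 1: "(32 * \<Phi>) * tr 30 \<le> 1 / 8 * tr 32" .
    have "(4 * 32 ^ 4 * \<Delta>) * tr 30 \<le> (4 * 32 ^ 4 * \<Delta>) * (\<rho> * tr 32)"
      using tr30 pos by (intro mult_left_mono) auto
    also have "\<dots> \<le> 1 / 16 * tr 32" using mult_right_mono[OF N3, of "tr 32"] trp by (simp add: mult_ac)
    finally show ?thesis using 1 by simp
  qed
  finally have X0: "real (card X0) \<ge> 3 / 4 * tr 32" by simp
  \<comment> \<open>Indices below 16 leave a pair of consecutive positions free, 16 and 17 leave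
    position 1 or 2 free, and 18 and 19 fix a single row.\<close>
  define P where "P i = (if i < 16 then arc (2 * i + 2) 30 else if i = 16 then arc 2 31
      else if i = 17 then arc 3 31 else cols (i = (18::nat)))" for i
  \<comment> \<open>For rows the cost is a sixteenth of the whole fibre in \<open>CW 32\<close>, so
    it sums to \<open>tr 32 / 16\<close> however many fibres there are.\<close>
  define m where "m i y = (if i < 16 then m0 else if i < 18 then K0
      else real (card {v' \<in> CW 32. sel (P i) v' = y}) / 16)" for i :: nat and y
  have X0_sub: "X0 \<subseteq> CW 32" by (auto simp: X0_def)
  have arc_bound: "(\<Sum>y\<in>sel (arc s (Suc l)) ` X0. c) \<le> c * (n * \<Delta> ^ l)" if "c \<ge> 0" for s l c
  proof -
    have "card (sel (arc s (Suc l)) ` X0) \<le> card (sel (arc s (Suc l)) ` CW 32)"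
      using X0_sub finite_CW by (intro card_mono) auto
    then have "real (card (sel (arc s (Suc l)) ` X0)) \<le> n * \<Delta> ^ l"
      using card_sel_arc[OF deg, of s l] by linarith
    then show ?thesis using that by (simp add: mult.commute mult_left_mono)
  qed
  have b0: "(\<Sum>y\<in>sel (P i) ` X0. m i y) \<le> m0 * (n * \<Delta> ^ 29)" if "i < 16" for i
    using arc_bound[of m0 "2 * i + 2" 29] pos that by (simp add: P_def m_def)
  have b1: "(\<Sum>y\<in>sel (P i) ` X0. m i y) \<le> K0 * (n * \<Delta> ^ 30)" if "i = 16 \<or> i = 17" for i
    using arc_bound[of K0 2 30] arc_bound[of K0 3 30] pos that by (auto simp: P_def m_def)
  have b2: "(\<Sum>y\<in>sel (P i) ` X0. m i y) \<le> tr 32 / 16" if "i \<ge> 18" for i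
  proof -
    have "(\<Sum>y\<in>sel (P i) ` X0. m i y) \<le> (\<Sum>y\<in>sel (P i) ` CW 32. m i y)"
      using X0_sub finite_CW by (intro sum_mono2) (auto simp: m_def that pos)
    also have "\<dots> = (\<Sum>y\<in>sel (P i) ` CW 32. real (card {v' \<in> CW 32. sel (P i) v' = y})) / 16"
      using that by (simp add: m_def sum_divide_distrib)
    also have "(\<Sum>y\<in>sel (P i) ` CW 32. real (card {v' \<in> CW 32. sel (P i) v' = y})) = card (CW 32)"
      using sum.group[OF finite_CW[of 32] finite_imageI[OF finite_CW[of 32]] subset_refl, where g = "sel (P i)" and h = "\<lambda>_. 1::nat"]
      by (simp flip: of_nat_sum)
    finally show ?thesis using card_CW by simp
  qed
  have split20: "{..<20} = {..<16} \<union> {16, 17} \<union> {18, 19::nat}" by auto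
  have "(\<Sum>i<20. \<Sum>y\<in>sel (P i) ` X0. m i y) =
      (\<Sum>i<16. \<Sum>y\<in>sel (P i) ` X0. m i y) + (\<Sum>y\<in>sel (P 16) ` X0. m 16 y) + (\<Sum>y\<in>sel (P 17) ` X0. m 17 y)
      + (\<Sum>y\<in>sel (P 18) ` X0. m 18 y) + (\<Sum>y\<in>sel (P 19) ` X0. m 19 y)"
    unfolding split20 by (subst sum.union_disjoint; (simp add: sum.union_disjoint)?)
  also have "\<dots> \<le> (\<Sum>i<(16::nat). m0 * (n * \<Delta> ^ 29)) + K0 * (n * \<Delta> ^ 30) + K0 * (n * \<Delta> ^ 30) + tr 32 / 16 + tr 32 / 16"
    using b0 b1 b2 by (intro add_mono sum_mono) auto
  also have "\<dots> \<le> d ^ 32 / 8 + d ^ 32 / 8 + tr 32 / 8" using N4 N5 by simp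
  also have "\<dots> < card X0" using trp X0 by linarith
  finally have "(\<Sum>i\<in>{..<20}. \<Sum>y\<in>sel (P i) ` X0. m i y) < card X0" .
  moreover have "m i y \<ge> 0" for i y using pos by (simp add: m_def)
  moreover have "finite X0" using X0_sub finite_CW finite_subset by blast
  ultimately obtain X where X: "X \<subseteq> X0" "X \<noteq> {}"
    "\<And>i x. i \<in> {..<20} \<Longrightarrow> x \<in> X \<Longrightarrow> m i (sel (P i) x) \<le> card {x' \<in> X. sel (P i) x' = sel (P i) x}"
    using fiber_pruning[of X0 "{..<20}" m "\<lambda>i. sel (P i)"] by blast
  show ?thesis
  proof (rule that)
    show "X \<subseteq> CW 32" using X X0_sub by blast
    show "distinct v \<and> light t v" if "v \<in> X" for v using X that by (auto simp: X0_def)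
    show "m0 \<le> card {v' \<in> X. sel (arc (2 * j + 2) 30) v' = sel (arc (2 * j + 2) 30) v}" if "v \<in> X" "j < 16" for v j
      using X(3)[of j v] that by (simp add: m_def P_def)
    show "K0 \<le> card {v' \<in> X. sel (arc 2 31) v' = sel (arc 2 31) v}" if "v \<in> X" for v
      using X(3)[of 16 v] that by (simp add: m_def P_def)
    show "K0 \<le> card {v' \<in> X. sel (arc 3 31) v' = sel (arc 3 31) v}" if "v \<in> X" for v
      using X(3)[of 17 v] that by (simp add: m_def P_def)
    show "card {v' \<in> CW 32. sel (cols s) v' = sel (cols s) v} / 16
        \<le> card {v' \<in> X. sel (cols s) v' = sel (cols s) v}" if "v \<in> X" for v s
      using X(3)[of 18 v] X(3)[of 19 v] that by (cases s) (simp_all add: m_def P_def)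
  qed (use X in auto)
qed

end

section \<open>Rarity of a prescribed vertex among the rows that extend a given row\<close>

lemma card_eq_sum_fibers:
  assumes "finite A"
  shows "card A = (\<Sum>u\<in>f ` A. card {a \<in> A. f a = u})"
  using sum.group[OF assms finite_imageI[OF assms] subset_refl, where g = f and h = "\<lambda>_. 1::nat"] by simp

context host
begin

lemma sel_eq_iff: "sel P v = sel P v' \<longleftrightarrow> (\<forall>i\<in>set P. v ! i = v' ! i)"
  by (auto simp: sel_def)

lemma set_arc_30:
  assumes "j < 16"
  shows "set (arc (2 * j + 2) 30) = {..<32} - {2 * j, 2 * j + 1}"
proof -
  have "\<forall>j\<in>set [0..<16]. set (map (\<lambda>i. (2 * j + 2 + i) mod 32) [0..<30]) = set [0..<32] - {2 * j, 2 * j + 1}"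
    by code_simp
  then show ?thesis using assms by (auto simp: arc_def)
qed

lemma set_arc_31: "set (arc 2 31) = {..<32} - {1}" "set (arc 3 31) = {..<32} - {2}"
proof -
  have "set (map (\<lambda>i. (2 + i) mod 32) [0..<31]) = set [0..<32] - {1}"
    "set (map (\<lambda>i. (3 + i) mod 32) [0..<31]) = set [0..<32] - {2}" by code_simp+
  then show "set (arc 2 31) = {..<32} - {1}" "set (arc 3 31) = {..<32} - {2}"
    by (auto simp: arc_def)
qed

text \<open>Both rows are unions of pairs \<open>2 * q\<close>, \<open>2 * q + 1\<close>; replacing
  the pair that contains a position of one row therefore leaves the other row intact, which is the
  third claim.\<close>

lemma set_cols:
  "set (cols s) \<subseteq> {..<32}" "set (cols False) \<union> set (cols True) = {..<32}"
  "p \<in> set (cols (\<not> s)) \<Longrightarrow> 2 * (p div 2) \<notin> set (cols s) \<and> 2 * (p div 2) + 1 \<notin> set (cols s)"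
proof -
  have u: "set (cols False) \<union> set (cols True) = {..<32}"
  proof -
    have "set (cols False) \<union> set (cols True) = set [0..<32]" unfolding cols_eval by code_simp
    then show ?thesis by (simp only: set_upt lessThan_atLeast0)
  qed
  then show "set (cols False) \<union> set (cols True) = {..<32}" "set (cols s) \<subseteq> {..<32}" by (cases s; auto)+
  show "p \<in> set (cols (\<not> s)) \<Longrightarrow> 2 * (p div 2) \<notin> set (cols s) \<and> 2 * (p div 2) + 1 \<notin> set (cols s)"
  proof (cases s)
    case True
    have "\<forall>p\<in>set (cols False). 2 * (p div 2) \<notin> set (cols True) \<and> 2 * (p div 2) + 1 \<notin> set (cols True)"
      unfolding cols_eval by code_simp
    then show "p \<in> set (cols (\<not> s)) \<Longrightarrow> ?thesis" using True by simp
  next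
    case False
    have "\<forall>p\<in>set (cols True). 2 * (p div 2) \<notin> set (cols False) \<and> 2 * (p div 2) + 1 \<notin> set (cols False)"
      unfolding cols_eval by code_simp
    then show "p \<in> set (cols (\<not> s)) \<Longrightarrow> ?thesis" using False by simp
  qed
qed

lemma nth_CW_mem: "v \<in> CW 32 \<Longrightarrow> i < 32 \<Longrightarrow> v ! i \<in> V"
  using set_CW[of v 32] length_CW[of v 32] by auto

lemma card_common_neighbours:
  assumes "v \<in> CW 32" "light t v" "i < 32"
  shows "real (card (E `` {v ! i} \<inter> E `` {v ! ((i + 2) mod 32)})) \<le> t"
proof -
  have "v ! ((i + 2) mod 32) \<in> V" using assms(1) by (intro nth_CW_mem) auto
  from mp_2_eq[OF this, of "v ! i"] show ?thesis using assms(2,3) by (metis light_def)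
qed

text \<open>Double counting. Walks with \<open>v ! p = y\<close> that agree outside the pair of
  \<open>p\<close> differ only at the partner of \<open>p\<close>, a common neighbour of two fixed
  vertices, so there are at most \<open>t\<close> of them. Each such class gives at least
  \<open>m0\<close> walks of \<open>X\<close> with the same row \<open>s\<close> when the whole pair
  is replaced.\<close>

lemma card_fixed_position:
  fixes m0 t :: real
  assumes X: "X \<subseteq> CW 32" and light: "\<And>v. v \<in> X \<Longrightarrow> light t v"
    and pairs: "\<And>v j. v \<in> X \<Longrightarrow> j < 16 \<Longrightarrow>
      m0 \<le> card {v' \<in> X. sel (arc (2 * j + 2) 30) v' = sel (arc (2 * j + 2) 30) v}"
    and p: "p \<in> set (cols (\<not> s))" and t: "t \<ge> 0"
  shows "m0 * card {v \<in> X. sel (cols s) v = w \<and> v ! p = y} \<le> t * card {v \<in> CW 32. sel (cols s) v = w}"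
proof -
  define j where "j = p div 2"
  have p32: "p < 32" using set_cols(1) p by blast
  then have j: "j < 16" by (simp add: j_def)
  define \<psi> where "\<psi> = sel (arc (2 * j + 2) 30)"
  have \<psi>: "\<psi> v = \<psi> v' \<longleftrightarrow> (\<forall>i<32. i \<noteq> 2 * j \<and> i \<noteq> 2 * j + 1 \<longrightarrow> v ! i = v' ! i)" for v v'
    unfolding \<psi>_def sel_eq_iff set_arc_30[OF j] by auto
  define Z where "Z = {v \<in> X. sel (cols s) v = w \<and> v ! p = y}"
  have finX: "finite X" using X finite_CW finite_subset by blast
  then have finZ: "finite Z" by (simp add: Z_def)
  have cols_\<psi>: "sel (cols s) v = sel (cols s) v'" if "\<psi> v = \<psi> v'" for v v'
    using that set_cols(1)[of s] set_cols(3)[OF p] unfolding \<psi> sel_eq_iff by (auto simp: j_def)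
  have "real (card {v \<in> Z. \<psi> v = u}) \<le> t" if "u \<in> \<psi> ` Z" for u
  proof -
    from that obtain v1 where v1: "v1 \<in> Z" "u = \<psi> v1" by blast
    \<comment> \<open>\<open>q\<close> is the partner of \<open>p\<close> in its pair, and
      \<open>i'\<close> the position cyclically before \<open>q\<close>. One of \<open>i'\<close>
      and \<open>i' + 2\<close> is \<open>p\<close>, the other lies outside the pair, so both
      neighbours of \<open>q\<close> are fixed.\<close>
    define q where "q = (if even p then p + 1 else p - 1)"
    define i' where "i' = (if p = 1 then 31 else if even p then p else p - 2)"
    have pj: "(p = 2 * j \<and> q = 2 * j + 1) \<or> (p = 2 * j + 1 \<and> q = 2 * j)"
      unfolding q_def j_def by (cases "even p") (auto elim: oddE)
    have i': "i' < 32" using p32 by (simp add: i'_def less_imp_diff_less)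
    have mid: "Suc i' mod 32 = q \<and> Suc q mod 32 = (i' + 2) mod 32 \<and> q < 32 \<and> i' \<noteq> q \<and> (i' + 2) mod 32 \<noteq> q"
      unfolding i'_def q_def
    proof -
      have "\<forall>p\<in>set [0..<32]. Suc (if p = 1 then 31 else if even p then p else p - 2) mod 32 = (if even p then p + 1 else p - 1)
        \<and> Suc (if even p then p + 1 else p - 1) mod 32 = ((if p = 1 then 31 else if even p then p else p - 2) + 2) mod 32
        \<and> (if even p then p + 1 else p - 1) < 32 \<and> (if p = 1 then 31 else if even p then p else p - 2) \<noteq> (if even p then p + 1 else p - 1)
        \<and> ((if p = 1 then 31 else if even p then p else p - 2) + 2) mod 32 \<noteq> (if even p then p + 1 else p - (1::nat))"
        by code_simp
      then show "Suc (if p = 1 then 31 else if even p then p else p - 2) mod 32 = (if even p then p + 1 else p - 1)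
        \<and> Suc (if even p then p + 1 else p - 1) mod 32 = ((if p = 1 then 31 else if even p then p else p - 2) + 2) mod 32
        \<and> (if even p then p + 1 else p - 1) < 32 \<and> (if p = 1 then 31 else if even p then p else p - 2) \<noteq> (if even p then p + 1 else p - 1)
        \<and> ((if p = 1 then 31 else if even p then p else p - 2) + 2) mod 32 \<noteq> (if even p then p + 1 else p - (1::nat))"
        by (rule bspec) (use p32 in simp)
    qed
    have same: "v ! i' = v1 ! i' \<and> v ! ((i' + 2) mod 32) = v1 ! ((i' + 2) mod 32)" if "v \<in> Z" "\<psi> v = u" for v
    proof -
      have "v ! r = v1 ! r" if "r = i' \<or> r = (i' + 2) mod 32" for r
      proof (cases "r = p")
        case True
        then show ?thesis using \<open>v \<in> Z\<close> v1(1) by (simp add: Z_def)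
      next
        case False
        have "r \<noteq> q" "r < 32" using that mid i' by auto
        then show ?thesis using \<open>\<psi> v = u\<close> v1(2) pj False by (auto simp: \<psi>)
      qed
      then show ?thesis by blast
    qed
    have inj: "inj_on (\<lambda>v. v ! q) {v \<in> Z. \<psi> v = u}"
    proof (rule inj_onI)
      fix v v' assume v: "v \<in> {v \<in> Z. \<psi> v = u}" and v': "v' \<in> {v \<in> Z. \<psi> v = u}" and eq: "v ! q = v' ! q"
      have l: "length v = 32" "length v' = 32" using v v' X length_CW by (auto simp: Z_def)
      have "v ! i = v' ! i" if "i < 32" for i
      proof -
        have "\<psi> v = \<psi> v'" "v ! p = v' ! p" using v v' by (auto simp: Z_def)
        then show ?thesis using that eq pj unfolding \<psi> by metis
      qed
      then show "v = v'" using l by (intro nth_equalityI) auto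
    qed
    have "(\<lambda>v. v ! q) ` {v \<in> Z. \<psi> v = u} \<subseteq> E `` {v1 ! i'} \<inter> E `` {v1 ! ((i' + 2) mod 32)}"
    proof clarify
      fix v assume v: "v \<in> Z" "u = \<psi> v"
      then have CW: "v \<in> CW 32" using X by (auto simp: Z_def)
      have "(v ! i', v ! q) \<in> E" using CW_adj[OF CW i'] mid by simp
      moreover have "(v ! q, v ! ((i' + 2) mod 32)) \<in> E" using CW_adj[OF CW, of q] mid by simp
      ultimately show "v ! q \<in> E `` {v1 ! i'} \<inter> E `` {v1 ! ((i' + 2) mod 32)}"
        using same[OF v(1)] v(2) symE by auto
    qed
    then have "card {v \<in> Z. \<psi> v = u} \<le> card (E `` {v1 ! i'} \<inter> E `` {v1 ! ((i' + 2) mod 32)})"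
      using finE by (intro card_inj_on_le[OF inj]) (auto intro: finite_Image)
    moreover have "real (card (E `` {v1 ! i'} \<inter> E `` {v1 ! ((i' + 2) mod 32)})) \<le> t"
      using v1 X light i' by (intro card_common_neighbours) (auto simp: Z_def)
    ultimately show ?thesis by linarith
  qed
  then have "(\<Sum>u\<in>\<psi> ` Z. real (card {v \<in> Z. \<psi> v = u})) \<le> (\<Sum>u\<in>\<psi> ` Z. t)" by (rule sum_mono)
  then have 1: "real (card Z) \<le> t * card (\<psi> ` Z)"
    using card_eq_sum_fibers[OF finZ, of \<psi>] by (simp add: mult.commute flip: of_nat_sum)
  let ?C = "{v \<in> CW 32. sel (cols s) v = w}"
  have "(\<Union>u\<in>\<psi> ` Z. {v \<in> X. \<psi> v = u}) \<subseteq> ?C"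
  proof clarify
    fix v v' assume "v \<in> X" "v' \<in> Z" "\<psi> v = \<psi> v'"
    then show "v \<in> CW 32 \<and> sel (cols s) v = w"
      using X cols_\<psi>[of v v'] by (auto simp: Z_def)
  qed
  then have "card (\<Union>u\<in>\<psi> ` Z. {v \<in> X. \<psi> v = u}) \<le> card ?C"
    using finite_CW by (intro card_mono) auto
  moreover have "card (\<Union>u\<in>\<psi> ` Z. {v \<in> X. \<psi> v = u}) = (\<Sum>u\<in>\<psi> ` Z. card {v \<in> X. \<psi> v = u})"
    using finZ finX by (intro card_UN_disjoint) auto
  ultimately have "(\<Sum>u\<in>\<psi> ` Z. real (card {v \<in> X. \<psi> v = u})) \<le> card ?C"
    by (simp flip: of_nat_sum)
  moreover have "(\<Sum>u\<in>\<psi> ` Z. m0) \<le> (\<Sum>u\<in>\<psi> ` Z. real (card {v \<in> X. \<psi> v = u}))"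
    using pairs j by (intro sum_mono) (auto simp: Z_def \<psi>_def)
  ultimately have 2: "m0 * card (\<psi> ` Z) \<le> card ?C" by (simp add: mult.commute)
  show ?thesis
  proof (cases "m0 \<ge> 0")
    case True
    have "m0 * card Z \<le> m0 * (t * card (\<psi> ` Z))" using 1 True by (intro mult_left_mono)
    also have "\<dots> = t * (m0 * card (\<psi> ` Z))" by simp
    also have "\<dots> \<le> t * card ?C" using 2 t by (intro mult_left_mono)
    finally show ?thesis by (simp add: Z_def)
  next
    case False
    then have "m0 * card Z \<le> 0" by (simp add: mult_nonpos_nonneg)
    also have "0 \<le> t * card ?C" using t by simp
    finally show ?thesis by (simp add: Z_def)
  qed
qed

end

section \<open>The graph of rows and its conflict-free closed walks\<close>

context host
begin

text \<open>The rows of the walks in \<open>X\<close> form a bipartite graph; the Boolean component records the side.\<close>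

definition linked :: "'a list set \<Rightarrow> bool \<times> 'a list \<Rightarrow> bool \<times> 'a list \<Rightarrow> bool" where
  "linked X p q \<longleftrightarrow> (\<exists>v\<in>X. \<exists>s. p = (s, sel (cols s) v) \<and> q = (\<not> s, sel (cols (\<not> s)) v))"

lemma linked_sym: "linked X p q \<Longrightarrow> linked X q p"
  unfolding linked_def by (elim bexE exE conjE, rule bexI, rule exI[where x = "\<not> s" for s]) auto

lemma rows_determine:
  assumes "v \<in> CW 32" "v' \<in> CW 32" "sel (cols s) v = sel (cols s) v'" "sel (cols (\<not> s)) v = sel (cols (\<not> s)) v'"
  shows "v = v'"
proof (rule nth_equalityI)
  fix i assume "i < length v"
  then have "i \<in> set (cols False) \<union> set (cols True)" using set_cols(2) length_CW[OF assms(1)] by simp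
  then have "i \<in> set (cols s) \<or> i \<in> set (cols (\<not> s))" by (cases s) auto
  then show "v ! i = v' ! i" using assms(3,4) unfolding sel_eq_iff by blast
qed (use assms length_CW in auto)

text \<open>The random walk on rows is symmetrised; by \<open>card_fixed_position\<close> and
  \<open>dense\<close> a step conflicts with a given row with probability at most
  \<open>4096 * t / m0\<close>. Conflicting closed walks then weigh at most \<open>3 / 4\<close> of
  the trace, so a conflict-free one remains.\<close>

lemma conflict_free_rows:
  fixes m0 t \<rho> :: real
  assumes X: "X \<subseteq> CW 32" "X \<noteq> {}" and light: "\<And>v. v \<in> X \<Longrightarrow> light t v"
    and pairs: "\<And>v j. v \<in> X \<Longrightarrow> j < 16 \<Longrightarrow>
      m0 \<le> card {v' \<in> X. sel (arc (2 * j + 2) 30) v' = sel (arc (2 * j + 2) 30) v}"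
    and dense: "\<And>v s. v \<in> X \<Longrightarrow> card {v' \<in> CW 32. sel (cols s) v' = sel (cols s) v} / 16
                        \<le> card {v' \<in> X. sel (cols s) v' = sel (cols s) v}"
    and t: "t \<ge> 0" and m0: "m0 > 0" and \<rho>: "\<rho> > 0" and k: "k > 0"
    and N1: "2 * n ^ 16 \<le> \<rho> ^ k" and N2: "16 * real k ^ 4 * (4096 * t / m0) * \<rho> \<le> 1 / 2"
  obtains ws where "length ws = 2 * k" "\<And>i. i < 2 * k \<Longrightarrow> linked X (ws ! i) (ws ! (Suc i mod (2 * k)))"
    "\<And>i j. i < j \<Longrightarrow> j < 2 * k \<Longrightarrow> set (snd (ws ! i)) \<inter> set (snd (ws ! j)) = {}"
proof -
  define \<Omega> where "\<Omega> = {(s, sel (cols s) v) | s v. v \<in> X}"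
  define R where "R = linked X"
  have finX: "finite X" using X finite_CW finite_subset by blast
  have \<Omega>_img: "\<Omega> = (\<lambda>(s, v). (s, sel (cols s) v)) ` (UNIV \<times> X)" by (auto simp: \<Omega>_def)
  have fin\<Omega>: "finite \<Omega>" unfolding \<Omega>_img using finX by simp
  have ne\<Omega>: "\<Omega> \<noteq> {}" unfolding \<Omega>_img using X by simp
  have R_\<Omega>: "p \<in> \<Omega> \<and> q \<in> \<Omega>" if "R p q" for p q
    using that unfolding R_def linked_def \<Omega>_def by blast
  have R_sym: "R p q \<longleftrightarrow> R q p" for p q unfolding R_def using linked_sym by blast
  define g where "g p = real (card {q \<in> \<Omega>. R p q})" for p
  have nbrs: "{q \<in> \<Omega>. R (s, sel (cols s) v0) q} = (\<lambda>v. (\<not> s, sel (cols (\<not> s)) v)) ` {v \<in> X. sel (cols s) v = sel (cols s) v0}"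
    for s v0
  proof (intro set_eqI iffI)
    fix q assume "q \<in> {q \<in> \<Omega>. R (s, sel (cols s) v0) q}"
    then show "q \<in> (\<lambda>v. (\<not> s, sel (cols (\<not> s)) v)) ` {v \<in> X. sel (cols s) v = sel (cols s) v0}"
      unfolding R_def linked_def by auto
  next
    fix q assume "q \<in> (\<lambda>v. (\<not> s, sel (cols (\<not> s)) v)) ` {v \<in> X. sel (cols s) v = sel (cols s) v0}"
    then obtain v where v: "v \<in> X" "sel (cols s) v = sel (cols s) v0" "q = (\<not> s, sel (cols (\<not> s)) v)"
      by blast
    then have "R (s, sel (cols s) v0) q" unfolding R_def linked_def by metis
    then show "q \<in> {q \<in> \<Omega>. R (s, sel (cols s) v0) q}" using R_\<Omega> by blast
  qed
  have inj: "inj_on (\<lambda>v. (\<not> s, sel (cols (\<not> s)) v)) {v \<in> X. sel (cols s) v = w}" for s w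
  proof (rule inj_onI)
    fix v v' assume "v \<in> {v \<in> X. sel (cols s) v = w}" "v' \<in> {v \<in> X. sel (cols s) v = w}"
      "(\<not> s, sel (cols (\<not> s)) v) = (\<not> s, sel (cols (\<not> s)) v')"
    then show "v = v'" using X(1) by (intro rows_determine[of v v' s]) auto
  qed
  have g_eq: "g (s, sel (cols s) v0) = card {v \<in> X. sel (cols s) v = sel (cols s) v0}" for s v0
    unfolding g_def nbrs card_image[OF inj] ..
  have g_pos: "g p > 0" if "p \<in> \<Omega>" for p
  proof -
    obtain s v0 where p: "p = (s, sel (cols s) v0)" "v0 \<in> X" using \<open>p \<in> \<Omega>\<close> by (auto simp: \<Omega>_def)
    then show ?thesis unfolding p(1) g_eq using finX by (auto simp: card_gt_0_iff)
  qed
  \<comment> \<open>\<open>4096 = 16 * 16 * 16\<close>: sixteen vertices of the row to be avoided,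
    sixteen positions of the new row, and the factor lost in \<open>dense\<close>.\<close>
  define \<eta> where "\<eta> = 4096 * t / m0"
  have \<eta>: "\<eta> \<ge> 0" using t m0 by (simp add: \<eta>_def)
  define conf where "conf p q \<longleftrightarrow> set (snd p) \<inter> set (snd q) \<noteq> {}" for p q :: "bool \<times> 'a list"
  have conf_bound: "real (card {q \<in> \<Omega>. R r q \<and> conf a q}) \<le> \<eta> * g r" if a: "a \<in> \<Omega>" and r: "r \<in> \<Omega>" for a r
  proof -
    obtain s v0 where rs: "r = (s, sel (cols s) v0)" "v0 \<in> X" using r by (auto simp: \<Omega>_def)
    define w where "w = sel (cols s) v0"
    let ?F = "\<lambda>y p. {v \<in> X. sel (cols s) v = w \<and> v ! p = y}"
    have "{q \<in> \<Omega>. R r q \<and> conf a q} \<subseteq>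
        (\<Union>y\<in>set (snd a). \<Union>p\<in>set (cols (\<not> s)). (\<lambda>v. (\<not> s, sel (cols (\<not> s)) v)) ` ?F y p)"
    proof
      fix q assume q: "q \<in> {q \<in> \<Omega>. R r q \<and> conf a q}"
      then have "q \<in> {q \<in> \<Omega>. R (s, sel (cols s) v0) q}" by (simp add: rs)
      then obtain v where v: "v \<in> X" "sel (cols s) v = w" "q = (\<not> s, sel (cols (\<not> s)) v)"
        unfolding nbrs by (auto simp: w_def)
      obtain y where y: "y \<in> set (snd a)" "y \<in> set (sel (cols (\<not> s)) v)" using q v by (auto simp: conf_def)
      then obtain p where "p \<in> set (cols (\<not> s))" "y = v ! p" by (auto simp: sel_def)
      with y v show "q \<in> (\<Union>y\<in>set (snd a). \<Union>p\<in>set (cols (\<not> s)). (\<lambda>v. (\<not> s, sel (cols (\<not> s)) v)) ` ?F y p)"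
        by blast
    qed
    then have "card {q \<in> \<Omega>. R r q \<and> conf a q} \<le>
        card (\<Union>y\<in>set (snd a). \<Union>p\<in>set (cols (\<not> s)). (\<lambda>v. (\<not> s, sel (cols (\<not> s)) v)) ` ?F y p)"
      using finX by (intro card_mono) auto
    also have "\<dots> \<le> (\<Sum>y\<in>set (snd a). \<Sum>p\<in>set (cols (\<not> s)). card (?F y p))"
      using finX by (intro order_trans[OF card_UN_le] sum_mono card_image_le) auto
    finally have 1: "real (card {q \<in> \<Omega>. R r q \<and> conf a q}) \<le> (\<Sum>y\<in>set (snd a). \<Sum>p\<in>set (cols (\<not> s)). real (card (?F y p)))"
      by (simp flip: of_nat_sum)
    define c where "c = t * real (card {v \<in> CW 32. sel (cols s) v = w}) / m0"
    have "c \<ge> 0" using t m0 by (simp add: c_def)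
    have "real (card (?F y p)) \<le> c" if "p \<in> set (cols (\<not> s))" for y p
      using card_fixed_position[OF X(1) light pairs that t, of w y] m0
      by (simp add: c_def field_simps)
    then have "(\<Sum>y\<in>set (snd a). \<Sum>p\<in>set (cols (\<not> s)). real (card (?F y p)))
        \<le> (\<Sum>y\<in>set (snd a). \<Sum>p\<in>set (cols (\<not> s)). c)"
      by (intro sum_mono)
    also have "\<dots> = real (card (set (snd a)) * card (set (cols (\<not> s)))) * c" by simp
    also have "\<dots> \<le> real (16 * 16) * c"
    proof -
      have "length (snd a) = 16" using a by (auto simp: \<Omega>_def sel_def cols_def)
      then have "card (set (snd a)) \<le> 16" using card_length[of "snd a"] by simp
      moreover have "card (set (cols (\<not> s))) \<le> 16" using card_length[of "cols (\<not> s)"] by (simp add: cols_def)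
      ultimately have "card (set (snd a)) * card (set (cols (\<not> s))) \<le> 16 * 16" by (rule mult_le_mono)
      then show ?thesis using \<open>c \<ge> 0\<close> by (intro mult_right_mono of_nat_mono)
    qed
    also have "\<dots> \<le> \<eta> * g r"
    proof -
      have "real (card {v \<in> CW 32. sel (cols s) v = w}) \<le> 16 * g r"
        using dense[OF rs(2), of s] by (simp add: w_def rs(1) g_eq)
      then have "t * real (card {v \<in> CW 32. sel (cols s) v = w}) \<le> t * (16 * g r)" using t by (intro mult_left_mono)
      then have "c \<le> t * (16 * g r) / m0" unfolding c_def using m0 by (simp add: divide_right_mono)
      moreover have "\<eta> * g r = real (16 * 16) * (t * (16 * g r) / m0)" by (simp add: \<eta>_def)
      ultimately show ?thesis by (simp only: mult_left_mono of_nat_0_le_iff)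
    qed
    finally show ?thesis using 1 by linarith
  qed
  \<comment> \<open>Transition probabilities \<open>1 / g p\<close> conjugated into symmetric form;
    \<open>sqrt (g p)\<close> is an eigenvector for the eigenvalue 1, so even traces are at least
    1.\<close>
  define M where "M p q = of_bool (R p q) / sqrt (g p * g q)" for p q
  interpret K: sym_kernel \<Omega> M
    using fin\<Omega> R_sym by unfold_locales (auto simp: M_def g_def mult.commute)
  \<comment> \<open>Chosen so that the second term of the union bound is
    \<open>(2 * k)^2 / (2 * \<mu>) = 1 / 4\<close>; the first becomes
    \<open>16 * k^4 * \<eta> * \<rho>\<close>, the quantity bounded in \<open>N2\<close>.\<close>
  define \<mu> where "\<mu> = 8 * (real k)\<^sup>2"
  have \<mu>: "\<mu> > 0" using k by (simp add: \<mu>_def)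
  have sum_R: "(\<Sum>q\<in>\<Omega>. of_bool (R p q)) = g p" for p
    using fin\<Omega> by (simp add: g_def Int_def conj_commute)
  have tr1: "K.tr (2 * j) \<ge> 1" for j
  proof (rule K.tr_ge_1[where v = "\<lambda>p. sqrt (g p)"])
    fix p assume p: "p \<in> \<Omega>"
    have "(\<Sum>q\<in>\<Omega>. M p q * sqrt (g q)) = (\<Sum>q\<in>\<Omega>. of_bool (R p q) / sqrt (g p))"
    proof (rule sum.cong[OF refl])
      fix q assume "q \<in> \<Omega>"
      then show "M p q * sqrt (g q) = of_bool (R p q) / sqrt (g p)"
        using g_pos[of q] by (simp add: M_def real_sqrt_mult)
    qed
    also have "\<dots> = g p / sqrt (g p)" by (simp only: sum_divide_distrib[symmetric] sum_R)
    also have "\<dots> = sqrt (g p)" using g_pos[OF p] by (simp add: real_div_sqrt)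
    finally show "(\<Sum>q\<in>\<Omega>. M p q * sqrt (g q)) = sqrt (g p)" .
  qed (use g_pos ne\<Omega> in auto)
  obtain k' where k': "k = Suc k'" using k by (cases k) auto
  have "K.tr (2 * k') \<le> \<rho> * K.tr (2 * Suc k')"
  proof (rule K.tr_ratio[OF \<rho>])
    \<comment> \<open>The trivial count of rows is enough, since its \<open>k\<close>-th root is at
      most \<open>\<rho>\<close> by \<open>N1\<close>.\<close>
    have "card \<Omega> \<le> card (UNIV \<times> lists_of V 16 :: (bool \<times> 'a list) set)"
    proof (rule card_mono)
      show "\<Omega> \<subseteq> UNIV \<times> lists_of V 16"
      proof
        fix p assume "p \<in> \<Omega>"
        then obtain s v where p: "p = (s, sel (cols s) v)" "v \<in> X" by (auto simp: \<Omega>_def)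
        then have "v \<in> CW 32" using X by blast
        then have "set (sel (cols s) v) \<subseteq> V" using set_cols(1) nth_CW_mem by (fastforce simp: sel_def)
        then show "p \<in> UNIV \<times> lists_of V 16" by (simp add: p lists_of_def sel_def cols_def)
      qed
    qed (use finite_lists_of[OF finV] in simp)
    also have "\<dots> = 2 * card V ^ 16" by (simp add: card_cartesian_product card_lists_of[OF finV])
    finally have "real (card \<Omega>) \<le> 2 * n ^ 16" unfolding n_def by (metis of_nat_le_iff of_nat_mult of_nat_numeral of_nat_power)
    also have "\<dots> \<le> \<rho> ^ k" by (rule N1)
    also have "\<dots> \<le> \<rho> ^ k * K.tr (2 * k)" using tr1[of k] \<rho> by simp
    finally show "K.tr 0 \<le> \<rho> ^ Suc k' * K.tr (2 * Suc k')" by (simp add: K.tr_0 k')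
  qed (use tr1[of k] k' in simp)
  then have ratio: "K.tr (2 * (k - 1)) \<le> \<rho> * K.tr (2 * k)" by (simp add: k')
  have "(\<Sum>xs\<in>lists_of \<Omega> (2 * k). of_bool (\<exists>i j. i < j \<and> j < 2 * k \<and> conf (xs ! i) (xs ! j)) * closed_weight M xs)
     \<le> (2 * real k)\<^sup>2 * (\<mu> * \<eta> / 2 * K.tr (2 * (k - 1)) + 1 / (2 * \<mu>) * K.tr (2 * k))"
  \<comment> \<open>AM-GM undoes the symmetrisation: \<open>\<alpha>\<close> is proportional to the
    transition probability out of \<open>r\<close>, and \<open>\<beta>\<close> to the one out of
    \<open>q\<close>, which sums to 1 over \<open>r\<close>.\<close>
  proof (rule K.sum_closed_conflicts[where \<alpha> = "\<lambda>r q. \<mu> / (2 * g r) * of_bool (R r q)" and \<beta> = "\<lambda>r q. 1 / (2 * \<mu> * g q) * of_bool (R r q)"])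
    show "conf a b \<Longrightarrow> conf b a" for a b by (auto simp: conf_def)
    show "M r q * (x * y) \<le> \<mu> / (2 * g r) * of_bool (R r q) * x\<^sup>2 + 1 / (2 * \<mu> * g q) * of_bool (R r q) * y\<^sup>2"
      if "r \<in> \<Omega>" "q \<in> \<Omega>" for r q x y
    proof -
      define u v where "u = sqrt (\<mu> / g r) * x" and "v = y / sqrt (\<mu> * g q)"
      have gp: "g r > 0" "g q > 0" using that g_pos by auto
      have "x * y / sqrt (g r * g q) = u * v"
        using gp \<mu> by (simp add: u_def v_def real_sqrt_divide real_sqrt_mult field_simps)
      also have "\<dots> \<le> u\<^sup>2 / 2 + v\<^sup>2 / 2" using sum_squares_bound[of u v] by simp
      also have "\<dots> = \<mu> / (2 * g r) * x\<^sup>2 + 1 / (2 * \<mu> * g q) * y\<^sup>2"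
        using gp \<mu> by (simp add: u_def v_def power_mult_distrib power_divide)
      finally show ?thesis by (simp add: M_def of_bool_def)
    qed
    show "(\<Sum>q\<in>\<Omega>. of_bool (conf a q) * (\<mu> / (2 * g r) * of_bool (R r q))) \<le> \<mu> * \<eta> / 2"
      if "a \<in> \<Omega>" "r \<in> \<Omega>" for a r
    proof -
      have "(\<Sum>q\<in>\<Omega>. of_bool (conf a q) * (\<mu> / (2 * g r) * of_bool (R r q)))
          = (\<Sum>q\<in>\<Omega>. \<mu> / (2 * g r) * of_bool (R r q \<and> conf a q))"
        by (intro sum.cong refl) (auto simp: of_bool_def)
      also have "\<dots> = \<mu> / (2 * g r) * (\<Sum>q\<in>\<Omega>. of_bool (R r q \<and> conf a q))" by (simp only: sum_distrib_left)
      also have "(\<Sum>q\<in>\<Omega>. of_bool (R r q \<and> conf a q)) = real (card {q \<in> \<Omega>. R r q \<and> conf a q})"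
        using fin\<Omega> by (simp add: Int_def conj_commute)
      also have "\<mu> / (2 * g r) * \<dots> \<le> \<mu> / (2 * g r) * (\<eta> * g r)"
        using conf_bound[OF that] \<mu> g_pos[OF that(2)] by (intro mult_left_mono) auto
      also have "\<dots> = \<mu> * \<eta> / 2" using g_pos[OF that(2)] by simp
      finally show ?thesis .
    qed
    show "(\<Sum>r\<in>\<Omega>. 1 / (2 * \<mu> * g q) * of_bool (R r q)) \<le> 1 / (2 * \<mu>)" if "q \<in> \<Omega>" for q
    proof -
      have "(\<Sum>r\<in>\<Omega>. 1 / (2 * \<mu> * g q) * of_bool (R r q)) = 1 / (2 * \<mu> * g q) * (\<Sum>r\<in>\<Omega>. of_bool (R q r))"
        by (simp only: sum_distrib_left R_sym[of _ q])
      also have "\<dots> = 1 / (2 * \<mu>)" unfolding sum_R using g_pos[OF that] by simp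
      finally show ?thesis by simp
    qed
  qed (use \<mu> \<eta> k in \<open>auto simp: g_def\<close>)
  also have "\<dots> \<le> (2 * real k)\<^sup>2 * (\<mu> * \<eta> / 2 * (\<rho> * K.tr (2 * k)) + 1 / (2 * \<mu>) * K.tr (2 * k))"
    using ratio \<mu> \<eta> by (intro mult_left_mono add_right_mono) auto
  also have "\<dots> = (16 * real k ^ 4 * \<eta> * \<rho> + 1 / 4) * K.tr (2 * k)"
    using k by (simp add: \<mu>_def field_simps power2_eq_square power4_eq_xxxx)
  also have "\<dots> \<le> (1 / 2 + 1 / 4) * K.tr (2 * k)"
    using N2 tr1[of k] by (intro mult_right_mono add_right_mono) (auto simp: \<eta>_def)
  also have "\<dots> < K.tr (2 * k)" using tr1[of k] by simp
  also have "\<dots> = (\<Sum>xs\<in>lists_of \<Omega> (2 * k). closed_weight M xs)"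
    using k by (intro K.sum_closed[symmetric]) simp
  finally have "\<exists>xs\<in>lists_of \<Omega> (2 * k). of_bool (\<exists>i j. i < j \<and> j < 2 * k \<and> conf (xs ! i) (xs ! j)) * closed_weight M xs < closed_weight M xs"
    by (meson not_le sum_mono)
  then obtain ws where ws: "ws \<in> lists_of \<Omega> (2 * k)" and free: "\<not> (\<exists>i j. i < j \<and> j < 2 * k \<and> conf (ws ! i) (ws ! j))"
    and cw: "closed_weight M ws \<noteq> 0"
    by (auto simp: of_bool_def split: if_splits)
  show ?thesis
  proof (rule that)
    show len: "length ws = 2 * k" using ws by (simp add: lists_of_def)
    show "linked X (ws ! i) (ws ! (Suc i mod (2 * k)))" if "i < 2 * k" for i
      using closed_weight_nonzero[OF cw, of i] that len by (auto simp: M_def R_def)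
    show "set (snd (ws ! i)) \<inter> set (snd (ws ! j)) = {}" if "i < j" "j < 2 * k" for i j
      using free that by (auto simp: conf_def)
  qed
qed

end

section \<open>From a closed walk of rows to the wall with its two extra vertices\<close>

lemma pos_adjacent:
  assumes "j < 16"
  shows "even j \<Longrightarrow> Suc (pos False j) mod 32 = pos False (Suc j mod 16)"
    "odd j \<Longrightarrow> Suc (pos True j) mod 32 = pos True (Suc j mod 16)"
    "Suc (pos False j) mod 32 = pos True j \<or> Suc (pos True j) mod 32 = pos False j"
    "pos s j < 32"
proof -
  have "\<forall>j\<in>set [0..<16]. (even j \<longrightarrow> Suc (pos False j) mod 32 = pos False (Suc j mod 16)) \<and>
    (odd j \<longrightarrow> Suc (pos True j) mod 32 = pos True (Suc j mod 16)) \<and>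
    (Suc (pos False j) mod 32 = pos True j \<or> Suc (pos True j) mod 32 = pos False j) \<and>
    pos False j < 32 \<and> pos True j < 32"
    unfolding pos_def by code_simp
  then have *: "(even j \<longrightarrow> Suc (pos False j) mod 32 = pos False (Suc j mod 16)) \<and>
    (odd j \<longrightarrow> Suc (pos True j) mod 32 = pos True (Suc j mod 16)) \<and>
    (Suc (pos False j) mod 32 = pos True j \<or> Suc (pos True j) mod 32 = pos False j) \<and>
    pos False j < 32 \<and> pos True j < 32"
    by (rule bspec) (use assms in simp)
  then show "even j \<Longrightarrow> Suc (pos False j) mod 32 = pos False (Suc j mod 16)"
    "odd j \<Longrightarrow> Suc (pos True j) mod 32 = pos True (Suc j mod 16)"
    "Suc (pos False j) mod 32 = pos True j \<or> Suc (pos True j) mod 32 = pos False j" by blast+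
  show "pos s j < 32" using * by (cases s) simp_all
qed

lemma distinct_cols: "distinct (cols s)"
  by (cases s) (simp_all add: cols_eval)

context host
begin

text \<open>Walks that agree away from \<open>p\<close> are told apart by their entry at
  \<open>p\<close>, so a fibre larger than \<open>U\<close> supplies an entry outside
  \<open>U\<close>.\<close>

lemma avoiding_flip:
  fixes K0 :: real
  assumes X: "X \<subseteq> CW 32" and v: "v \<in> X" and P: "set P = {..<32} - {p}"
    and full: "K0 \<le> card {v' \<in> X. sel P v' = sel P v}" and U: "finite U" "card U < K0"
  obtains v' where "v' \<in> X" "\<And>i. i < 32 \<Longrightarrow> i \<noteq> p \<Longrightarrow> v' ! i = v ! i" "v' ! p \<notin> U"
proof -
  let ?F = "{v' \<in> X. sel P v' = sel P v}"
  have agree: "v' ! i = v ! i" if "v' \<in> ?F" "i < 32" "i \<noteq> p" for v' i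
    using that unfolding sel_eq_iff P by blast
  have "inj_on (\<lambda>v'. v' ! p) ?F"
  proof (rule inj_onI)
    fix a b assume ab: "a \<in> ?F" "b \<in> ?F" "a ! p = b ! p"
    have "length a = 32" "length b = 32" using ab X length_CW by blast+
    moreover have "a ! i = b ! i" if "i < 32" for i
      using agree[OF ab(1) that] agree[OF ab(2) that] ab(3) by (cases "i = p") auto
    ultimately show "a = b" by (intro nth_equalityI) auto
  qed
  then have "\<not> (\<lambda>v'. v' ! p) ` ?F \<subseteq> U"
    using card_inj_on_le[of "\<lambda>v'. v' ! p" ?F U] U full by auto
  then obtain v' where "v' \<in> ?F" "v' ! p \<notin> U" by blast
  then show ?thesis using that agree by blast
qed

text \<open>Two linked rows come from one walk, on which entries in equal columns are consecutive;
  this gives the vertical edges, and the remaining steps of the walk are the rungs. In the walk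
  behind rows 0 and 1, positions 0, 2, 3 hold \<open>\<theta> 0 0\<close>,
  \<open>\<theta> 1 1\<close>, \<open>\<theta> 1 2\<close>. A new vertex at position 1 is
  \<open>w\<close>; with \<open>w\<close> in place, a new vertex at position 2 is
  \<open>z\<close>.\<close>

lemma brick_wall:
  fixes m0 t \<rho> K0 :: real
  assumes X: "X \<subseteq> CW 32" "X \<noteq> {}" and light: "\<And>v. v \<in> X \<Longrightarrow> distinct v \<and> light t v"
    and pairs: "\<And>v j. v \<in> X \<Longrightarrow> j < 16 \<Longrightarrow>
      m0 \<le> card {v' \<in> X. sel (arc (2 * j + 2) 30) v' = sel (arc (2 * j + 2) 30) v}"
    and flip: "\<And>v. v \<in> X \<Longrightarrow> K0 \<le> card {v' \<in> X. sel (arc 2 31) v' = sel (arc 2 31) v}"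
      "\<And>v. v \<in> X \<Longrightarrow> K0 \<le> card {v' \<in> X. sel (arc 3 31) v' = sel (arc 3 31) v}"
    and dense: "\<And>v s. v \<in> X \<Longrightarrow> card {v' \<in> CW 32. sel (cols s) v' = sel (cols s) v} / 16
                        \<le> card {v' \<in> X. sel (cols s) v' = sel (cols s) v}"
    and t: "t \<ge> 0" and m0: "m0 > 0" and \<rho>: "\<rho> > 0" and k: "k > 0"
    and N1: "2 * n ^ 16 \<le> \<rho> ^ k" and N2: "16 * real k ^ 4 * (4096 * t / m0) * \<rho> \<le> 1 / 2"
    and K0: "K0 > 32 * real k + 1"
  obtains \<theta> :: "nat \<Rightarrow> nat \<Rightarrow> 'a" and w z where
    "inj_on (\<lambda>(i, j). \<theta> i j) ({..<2 * k} \<times> {..<16})"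
    "\<And>i j. i < 2 * k \<Longrightarrow> j < 16 \<Longrightarrow> \<theta> i j \<in> V"
    "\<And>i j. i < 2 * k \<Longrightarrow> j < 16 \<Longrightarrow> (\<theta> i j, \<theta> (Suc i mod (2 * k)) j) \<in> E"
    "\<And>i j. i < 2 * k \<Longrightarrow> j < 16 \<Longrightarrow> even (i + j) \<Longrightarrow> (\<theta> i j, \<theta> i (Suc j mod 16)) \<in> E"
    "w \<in> V" "z \<in> V" "w \<noteq> z" "\<And>i j. i < 2 * k \<Longrightarrow> j < 16 \<Longrightarrow> w \<noteq> \<theta> i j \<and> z \<noteq> \<theta> i j"
    "(w, \<theta> 0 0) \<in> E" "(w, \<theta> 1 1) \<in> E" "(z, w) \<in> E" "(z, \<theta> 1 2) \<in> E"
proof -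
  obtain ws where len: "length ws = 2 * k" and link: "\<And>i. i < 2 * k \<Longrightarrow> linked X (ws ! i) (ws ! (Suc i mod (2 * k)))"
    and disj: "\<And>i j. i < j \<Longrightarrow> j < 2 * k \<Longrightarrow> set (snd (ws ! i)) \<inter> set (snd (ws ! j)) = {}"
    using conflict_free_rows[OF X _ pairs dense t m0 \<rho> k N1 N2] light by blast
  have link': "linked X (ws ! (i mod (2 * k))) (ws ! (Suc i mod (2 * k)))" for i
    using link[of "i mod (2 * k)"] k by (simp add: mod_Suc_eq)
  have side: "fst (ws ! (i mod (2 * k))) \<longleftrightarrow> (fst (ws ! 0) \<noteq> odd i)" for i
  proof (induction i)
    case (Suc i)
    have "fst (ws ! (Suc i mod (2 * k))) \<longleftrightarrow> \<not> fst (ws ! (i mod (2 * k)))"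
      using link'[of i] by (auto simp: linked_def)
    then show ?case using Suc by simp
  qed simp
  \<comment> \<open>Sides alternate along the closed walk; shifting the index by \<open>c\<close>
    puts side \<open>False\<close> on the even rows, as the parity of the rungs demands.\<close>
  define c where "c = (if fst (ws ! 0) then 1 else 0 :: nat)"
  define row where "row i = ws ! ((i + c) mod (2 * k))" for i
  define \<theta> where "\<theta> i j = snd (row i) ! j" for i j
  have row_side: "fst (row i) \<longleftrightarrow> odd i" for i
    unfolding row_def side by (auto simp: c_def)
  have row_link: "\<exists>v\<in>X. row i = (odd i, sel (cols (odd i)) v) \<and> row (Suc i) = (even i, sel (cols (even i)) v)" for i
    using link'[of "i + c"] row_side[of i] unfolding row_def linked_def by fastforce
  have row_mod: "row (i mod (2 * k)) = row i" for i
    by (simp add: row_def mod_add_left_eq)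
  have \<theta>_mod: "\<theta> (Suc i mod (2 * k)) j = \<theta> (Suc i) j" for i j
    unfolding \<theta>_def row_mod ..
  have \<theta>_row: "\<exists>v\<in>X. (\<forall>j<16. \<theta> i j = v ! pos (odd i) j) \<and> (\<forall>j<16. \<theta> (Suc i) j = v ! pos (even i) j)" for i
    using row_link[of i] by (auto simp: \<theta>_def sel_def cols_def intro!: bexI)
  have wsdist: "set (snd (ws ! i)) \<inter> set (snd (ws ! j)) = {}" if "i < 2 * k" "j < 2 * k" "i \<noteq> j" for i j
    using disj[of i j] disj[of j i] that by (cases "i < j") auto
  have rowdist: "set (snd (row i)) \<inter> set (snd (row j)) = {}" if "i < 2 * k" "j < 2 * k" "i \<noteq> j" for i j
  proof -
    have "(i + c) mod (2 * k) \<noteq> (j + c) mod (2 * k)"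
      using that by (auto simp: c_def mod_Suc split: if_splits)
    then show ?thesis unfolding row_def using k by (intro wsdist) auto
  qed
  have row_len: "length (snd (row i)) = 16" and row_distinct: "distinct (snd (row i))" and row_V: "set (snd (row i)) \<subseteq> V" for i
  proof -
    obtain v where v: "v \<in> X" "row i = (odd i, sel (cols (odd i)) v)" using row_link by blast
    then have CW: "v \<in> CW 32" using X by blast
    show "length (snd (row i)) = 16" by (simp add: v sel_def cols_def)
    have "inj_on ((!) v) (set (cols (odd i)))"
      using set_cols(1) light[OF v(1)] length_CW[OF CW] by (intro inj_on_nth) auto
    then show "distinct (snd (row i))" using distinct_cols by (simp add: v sel_def distinct_map)
    show "set (snd (row i)) \<subseteq> V" using set_cols(1) nth_CW_mem[OF CW] by (fastforce simp: v sel_def)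
  qed
  have \<theta>_inj: "i = i' \<and> j = j'"
    if *: "i < 2 * k" "i' < 2 * k" "j < 16" "j' < 16" "\<theta> i j = \<theta> i' j'" for i i' j j'
  proof -
    have mem: "\<theta> i j \<in> set (snd (row i))" if "j < 16" for i j
      unfolding \<theta>_def using that row_len[of i] by (intro nth_mem) simp
    have "\<theta> i j \<in> set (snd (row i))" "\<theta> i j \<in> set (snd (row i'))"
      using mem[of j i] mem[of j' i'] * by auto
    then have "i = i'" using rowdist[of i i'] * by auto
    then show ?thesis using * row_len row_distinct[of i] by (auto simp: \<theta>_def nth_eq_iff_index_eq)
  qed
  have inj: "inj_on (\<lambda>(i, j). \<theta> i j) ({..<2 * k} \<times> {..<16})"
    by (rule inj_onI) (use \<theta>_inj in fastforce)
  have \<theta>V: "\<theta> i j \<in> V" if "j < 16" for i j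
    using row_V[of i] row_len[of i] that by (auto simp: \<theta>_def)
  have col: "(\<theta> i j, \<theta> (Suc i) j) \<in> E" if j: "j < 16" for i j
  proof -
    obtain v where v: "v \<in> X" "\<theta> i j = v ! pos (odd i) j" "\<theta> (Suc i) j = v ! pos (even i) j"
      using \<theta>_row[of i] j by blast
    then have CW: "v \<in> CW 32" using X by blast
    from CW_adj[OF CW pos_adjacent(4)[OF j]] pos_adjacent(3)[OF j]
    have "(v ! pos False j, v ! pos True j) \<in> E" using symE by metis
    then show ?thesis using v symE by (cases "odd i") auto
  qed
  have rung: "(\<theta> i j, \<theta> i (Suc j mod 16)) \<in> E" if "j < 16" "even (i + j)" for i j
  proof -
    obtain v where v: "v \<in> X" "\<forall>j<16. \<theta> i j = v ! pos (odd i) j" using \<theta>_row by blast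
    then have CW: "v \<in> CW 32" using X by blast
    have "Suc (pos (odd i) j) mod 32 = pos (odd i) (Suc j mod 16)"
      using pos_adjacent(1,2)[OF that(1)] that(2) by (cases "odd i") auto
    then show ?thesis using v that CW_adj[OF CW pos_adjacent(4)[OF that(1)], of "odd i"] by simp
  qed
  define U where "U = (\<lambda>(i, j). \<theta> i j) ` ({..<2 * k} \<times> {..<16})"
  have U: "finite U" "real (card U) \<le> 32 * real k"
    using card_image_le[of "{..<2 * k} \<times> {..<16::nat}" "\<lambda>(i, j). \<theta> i j"] by (auto simp: U_def)
  obtain v where v: "v \<in> X" "\<forall>j<16. \<theta> 0 j = v ! pos False j" "\<forall>j<16. \<theta> 1 j = v ! pos True j"
    using \<theta>_row[of 0] by auto
  obtain v1 where v1: "v1 \<in> X" "\<And>i. i < 32 \<Longrightarrow> i \<noteq> 1 \<Longrightarrow> v1 ! i = v ! i" "v1 ! 1 \<notin> U"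
    using avoiding_flip[OF X(1) v(1) set_arc_31(1) flip(1)[OF v(1)] U(1)] U K0 by auto
  \<comment> \<open>\<open>z\<close> has to avoid \<open>w\<close> besides the \<open>32 * k\<close>
    sites, hence the \<open>+ 1\<close> in the bound on \<open>K0\<close>.\<close>
  have "card (insert (v1 ! 1) U) \<le> Suc (card U)" by (rule card_insert_le_m1) auto
  then have "real (card (insert (v1 ! 1) U)) \<le> 32 * real k + 1" using U(2) by linarith
  then obtain v2 where v2: "v2 \<in> X" "\<And>i. i < 32 \<Longrightarrow> i \<noteq> 2 \<Longrightarrow> v2 ! i = v1 ! i" "v2 ! 2 \<notin> insert (v1 ! 1) U"
    using avoiding_flip[OF X(1) v1(1) set_arc_31(2) flip(2)[OF v1(1)], of "insert (v1 ! 1) U"] U K0 by auto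
  have v1CW: "v1 \<in> CW 32" and v2CW: "v2 \<in> CW 32" using v1 v2 X by auto
  have \<theta>v: "\<theta> 0 0 = v ! 0" "\<theta> 1 1 = v ! 2" "\<theta> 1 2 = v ! 3" using v by (auto simp: pos_def)
  show ?thesis
  proof (rule that[of \<theta> "v1 ! 1" "v2 ! 2"])
    show "(v1 ! 1, \<theta> 0 0) \<in> E" using CW_adj[OF v1CW, of 0] v1(2)[of 0] \<theta>v symE by simp
    show "(v1 ! 1, \<theta> 1 1) \<in> E" using CW_adj[OF v1CW, of 1] v1(2)[of 2] \<theta>v by (simp add: numeral_2_eq_2)
    show "(v2 ! 2, v1 ! 1) \<in> E" using CW_adj[OF v2CW, of 1] v2(2)[of 1] symE by (simp add: numeral_2_eq_2)
    show "(v2 ! 2, \<theta> 1 2) \<in> E" using CW_adj[OF v2CW, of 2] v1(2)[of 3] v2(2)[of 3] \<theta>v by simp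
    show "v1 ! 1 \<noteq> \<theta> i j \<and> v2 ! 2 \<noteq> \<theta> i j" if "i < 2 * k" "j < 16" for i j
    proof -
      have "\<theta> i j \<in> U" using that by (auto simp: U_def)
      then show ?thesis using v1(3) v2(3) by auto
    qed
  qed (use inj \<theta>V col rung \<theta>_mod v1CW v2CW v2(3) nth_CW_mem in auto)
qed

end

section \<open>The critical graphs\<close>

text \<open>The shift by two keeps \<open>0\<close> and \<open>1\<close> free for the extra
  vertices.\<close>

definition site :: "nat \<Rightarrow> nat \<Rightarrow> nat" where
  "site i j = Suc (Suc (prod_encode (i, j)))"

text \<open>A brick wall on the torus with one rung replaced by the path through the vertices \<open>0\<close> and \<open>1\<close>.\<close>

definition critical_wall :: "nat \<Rightarrow> nat graph" where
  "critical_wall m = Graph ({0, 1} \<union> {site i j | i j. i < m \<and> j < 16})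
     ({{site i j, site (Suc i mod m) j} | i j. i < m \<and> j < 16} \<union>
      ({{site i j, site i (Suc j mod 16)} | i j. i < m \<and> j < 16 \<and> even (i + j)} - {{site 1 1, site 1 2}}) \<union>
      {{1, site 0 0}, {1, site 1 1}, {0, 1}, {0, site 1 2}})"

lemma site_eq [simp]: "site i j = site i' j' \<longleftrightarrow> i = i' \<and> j = j'"
  by (simp add: site_def)

lemma site_neq [simp]: "site i j \<noteq> 0" "site i j \<noteq> Suc 0" "0 \<noteq> site i j" "Suc 0 \<noteq> site i j"
  by (simp_all add: site_def)

lemma Suc_mod_eq_iff:
  "a < m \<Longrightarrow> i < m \<Longrightarrow> Suc a mod m = i \<longleftrightarrow> a = (if i = 0 then m - 1 else i - 1)" for m :: nat
  by (auto simp: mod_Suc)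

lemma degree_ge_3:
  assumes "finite (edges G)" "{v, a} \<in> edges G" "{v, b} \<in> edges G" "{v, c} \<in> edges G"
    "a \<noteq> b" "a \<noteq> c" "b \<noteq> c"
  shows "degree G v \<ge> 3"
proof -
  have "card {{v, a}, {v, b}, {v, c}} = 3" using assms by (simp add: doubleton_eq_iff)
  moreover have "card {{v, a}, {v, b}, {v, c}} \<le> degree G v"
    unfolding degree_def using assms by (intro card_mono) auto
  ultimately show ?thesis by simp
qed

lemma degree_le_2:
  assumes "{e \<in> edges G. v \<in> e} \<subseteq> {x, y}"
  shows "degree G v \<le> 2"
proof -
  have "degree G v \<le> card {x, y}" unfolding degree_def using assms by (intro card_mono) auto
  also have "\<dots> \<le> 2" by (simp add: card_insert_if)
  finally show ?thesis .
qed

context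
  fixes m :: nat
  assumes m: "m \<ge> 4" "even m"
begin

definition prev :: "nat \<Rightarrow> nat" where
  "prev i = (if i = 0 then m - 1 else i - 1)"

definition up :: "nat \<Rightarrow> nat \<Rightarrow> nat set" where
  "up i j = {site i j, site (Suc i mod m) j}"

text \<open>The rung as seen from either end: it leaves to the next column if \<open>i + j\<close>
  is even and to the previous one otherwise, so each site of the unmodified wall has exactly
  one.\<close>

definition rung :: "nat \<Rightarrow> nat \<Rightarrow> nat set" where
  "rung i j = {site i j, site i (if even (i + j) then Suc j mod 16 else if j = 0 then 15 else j - 1)}"

abbreviation H :: "nat graph" where "H \<equiv> critical_wall m"

lemma verts_H: "verts H = {0, 1} \<union> (\<lambda>(i, j). site i j) ` ({..<m} \<times> {..<16})"
  by (auto simp: critical_wall_def)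

lemma finite_verts_H: "finite (verts H)"
  by (simp add: verts_H)

lemma card_verts_H: "card (verts H) = 16 * m + 2"
proof -
  have "inj_on (\<lambda>(i, j). site i j) ({..<m} \<times> {..<16})" by (auto simp: inj_on_def)
  then have "card ((\<lambda>(i, j). site i j) ` ({..<m} \<times> {..<16})) = m * 16"
    by (simp add: card_image card_cartesian_product)
  moreover have "{0, 1} \<inter> (\<lambda>(i, j). site i j) ` ({..<m} \<times> {..<16}) = {}" by auto
  ultimately show ?thesis unfolding verts_H by (subst card_Un_disjoint) auto
qed

lemma edge_cases:
  assumes "e \<in> edges H"
  obtains i j where "e = up i j" "i < m" "j < 16"
  | i j where "e = rung i j" "i < m" "j < 16" "even (i + j)" "e \<noteq> {site 1 1, site 1 2}"
  | "e = {1, site 0 0}" | "e = {1, site 1 1}" | "e = {0, 1}" | "e = {0, site 1 2}"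
proof -
  let ?A = "{{site i j, site (Suc i mod m) j} | i j. i < m \<and> j < 16}"
  let ?B = "{{site i j, site i (Suc j mod 16)} | i j. i < m \<and> j < 16 \<and> even (i + j)} - {{site 1 1, site 1 2}}"
  have "e \<in> ?A \<or> e \<in> ?B \<or> e \<in> {{1, site 0 0}, {1, site 1 1}, {0, 1}, {0, site 1 2}}"
    using assms by (simp only: critical_wall_def graph.sel Un_iff disj_assoc)
  then show ?thesis
  proof (elim disjE)
    assume "e \<in> ?A"
    then obtain i j where "e = {site i j, site (Suc i mod m) j}" "i < m" "j < 16" by blast
    then show ?thesis using that(1)[of i j] by (simp only: up_def)
  next
    assume "e \<in> ?B"
    then obtain i j where "e = {site i j, site i (Suc j mod 16)}" "i < m" "j < 16" "even (i + j)" "e \<noteq> {site 1 1, site 1 2}"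
      by blast
    then show ?thesis using that(2)[of i j] by (simp only: rung_def if_True simp_thms)
  qed (use that(3-) in blast)
qed

lemma up_edge: "i < m \<Longrightarrow> j < 16 \<Longrightarrow> up i j \<in> edges H"
  by (auto simp: critical_wall_def up_def)

lemma rung_edge_even:
  assumes "i < m" "j < 16" "even (i + j)" "(i, j) \<noteq> (1, 1)"
  shows "{site i j, site i (Suc j mod 16)} \<in> edges H"
proof -
  have "{site i j, site i (Suc j mod 16)} \<in> {{site i j, site i (Suc j mod 16)} | i j. i < m \<and> j < 16 \<and> even (i + j)}"
    using assms by blast
  moreover have "{site i j, site i (Suc j mod 16)} \<noteq> {site 1 1, site 1 2}"
    using assms(3,4) by (auto simp: doubleton_eq_iff)
  ultimately show ?thesis by (simp add: critical_wall_def)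
qed

lemma rung_edge:
  assumes "i < m" "j < 16" "(i, j) \<noteq> (1, 1)" "(i, j) \<noteq> (1, 2)"
  shows "rung i j \<in> edges H"
proof (cases "even (i + j)")
  case True
  then show ?thesis using rung_edge_even[OF assms(1,2) True assms(3)] by (simp add: rung_def)
next
  case False
  define j' where "j' = (if j = 0 then 15 else j - 1)"
  have j': "j' < 16" "Suc j' mod 16 = j" using assms by (auto simp: j'_def)
  have "even (i + j')" using False by (cases "j = 0") (auto simp: j'_def)
  moreover have "(i, j') \<noteq> (1, 1)" using assms by (auto simp: j'_def)
  moreover have "rung i j = {site i j', site i (Suc j' mod 16)}"
    using False unfolding j'(2) by (auto simp: rung_def j'_def)
  ultimately show ?thesis using rung_edge_even[OF assms(1) j'(1)] by simp
qed

lemma simple_H: "simple_graph H"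
  unfolding simple_graph_def
proof (intro conjI ballI)
  fix e assume "e \<in> edges H"
  then show "e \<subseteq> verts H" "card e = 2"
    using m by (elim edge_cases; auto simp: verts_H up_def rung_def mod_Suc)+
qed (rule finite_verts_H)

lemma finite_edges_H: "finite (edges H)"
proof (rule finite_subset)
  show "edges H \<subseteq> Pow (verts H)" using simple_H by (auto simp: simple_graph_def)
qed (simp add: finite_verts_H)

lemma edges_at_0: "{e \<in> edges H. 0 \<in> e} = {{0, 1}, {0, site 1 2}}"
proof (intro equalityI subsetI)
  fix e assume "e \<in> {e \<in> edges H. 0 \<in> e}"
  then have "e \<in> edges H" "0 \<in> e" by auto
  then show "e \<in> {{0, 1}, {0, site 1 2}}" by (elim edge_cases) (auto simp: up_def rung_def)
qed (auto simp: critical_wall_def)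

lemma degree_0: "degree H 0 = 2"
  unfolding degree_def edges_at_0 by (simp add: doubleton_eq_iff)

lemma edges_at_1:
  "e \<in> edges H \<Longrightarrow> 1 \<in> e \<Longrightarrow> 0 \<in> e \<or> e = {1, site 0 0} \<or> e = {1, site 1 1}"
  by (elim edge_cases) (auto simp: up_def rung_def)

lemma edges_at_site:
  assumes "e \<in> edges H" "site i j \<in> e" "i < m" "j < 16"
  shows "0 \<in> e \<or> 1 \<in> e \<or> e = up i j \<or> e = up (prev i) j \<or> (e = rung i j \<and> (i, j) \<noteq> (1, 1) \<and> (i, j) \<noteq> (1, 2))"
  using assms(1)
proof (cases rule: edge_cases)
  case (1 a b)
  then have "(a = i \<or> Suc a mod m = i) \<and> b = j" using assms(2) by (auto simp: up_def)
  then show ?thesis using 1 assms Suc_mod_eq_iff[of a m i] by (auto simp: prev_def)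
next
  case (2 a b)
  then have a: "a = i" and b: "b = j \<or> Suc b mod 16 = j" using assms(2) by (auto simp: rung_def)
  have e: "e = rung i j"
  proof (cases "b = j")
    case False
    then have *: "Suc b mod 16 = j" using b by blast
    then have b_eq: "b = (if j = 0 then 15 else j - 1)" using Suc_mod_eq_iff[of b 16 j] 2 assms by auto
    have "odd (i + j)" using 2(3,4) a * by (cases "b = 15") (auto simp: mod_Suc)
    then have "rung i j = {site i j, site i b}" unfolding b_eq by (simp add: rung_def)
    moreover have "rung a b = {site i b, site i j}" using 2(4) a * by (simp add: rung_def)
    ultimately show ?thesis using 2(1) by (simp add: insert_commute)
  qed (use 2 a in simp)
  moreover have "(i, j) \<noteq> (1, 1)"
  proof
    assume "(i, j) = (1, 1)"
    then have "rung i j = {site 1 1, site 1 2}" by (simp add: rung_def numeral_2_eq_2)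
    then show False using 2(5) e by simp
  qed
  moreover have "(i, j) \<noteq> (1, 2)"
  proof
    assume "(i, j) = (1, 2)"
    then have "rung i j = {site 1 1, site 1 2}" by (simp add: rung_def insert_commute)
    then show False using 2(5) e by simp
  qed
  ultimately show ?thesis by blast
qed auto

lemma extra_edges: "{1, site 0 0} \<in> edges H" "{1, site 1 1} \<in> edges H" "{0, 1} \<in> edges H" "{0, site 1 2} \<in> edges H"
  by (simp_all add: critical_wall_def)

lemma degree_ge: "v \<in> verts H - {0} \<Longrightarrow> degree H v \<ge> 3"
proof -
  assume v: "v \<in> verts H - {0}"
  show ?thesis
  proof (cases "v = 1")
    case True
    show ?thesis unfolding True
      by (rule degree_ge_3[OF finite_edges_H, of _ 0 "site 0 0" "site 1 1"]) (use extra_edges in \<open>auto simp: insert_commute\<close>)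
  next
    case False
    then obtain i j where ij: "v = site i j" "i < m" "j < 16" using v by (auto simp: verts_H)
    have 1: "{v, site (Suc i mod m) j} \<in> edges H" using up_edge[OF ij(2,3)] by (simp add: up_def ij)
    have p: "prev i < m" "Suc (prev i) mod m = i" "prev i \<noteq> Suc i mod m"
      using ij m by (auto simp: prev_def mod_Suc)
    have 2: "{v, site (prev i) j} \<in> edges H"
      using up_edge[OF p(1) ij(3)] p(2) by (simp add: up_def ij insert_commute)
    have "\<exists>x. {v, x} \<in> edges H \<and> x \<noteq> site (prev i) j \<and> x \<noteq> site (Suc i mod m) j"
    \<comment> \<open>At the two ends of the missing rung the third neighbour is one of the extra
      vertices.\<close>
    proof (cases "(i, j) = (1, 1) \<or> (i, j) = (1, 2)")
      case True
      then have "v = site 1 1 \<or> v = site 1 2" using ij(1) by auto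
      then have "{v, Suc 0} \<in> edges H \<or> {v, 0} \<in> edges H"
        using extra_edges(2,4) by (auto simp: insert_commute)
      then show ?thesis using site_neq by metis
    next
      case False
      then have "rung i j \<in> edges H" using ij by (intro rung_edge) auto
      moreover have "(if even (i + j) then Suc j mod 16 else if j = 0 then 15 else j - 1) \<noteq> j"
        using ij(3) by (auto simp: mod_Suc)
      ultimately show ?thesis unfolding rung_def ij(1)[symmetric] using site_eq by blast
    qed
    then obtain x where "{v, x} \<in> edges H" "x \<noteq> site (prev i) j" "x \<noteq> site (Suc i mod m) j" by blast
    with degree_ge_3[OF finite_edges_H 1 2] p(3) show ?thesis by auto
  qed
qed

text \<open>Peeling: \<open>0\<close>, \<open>1\<close> and the ends of the missing rung cannot lie in a subgraph of minimum degree
  three, and every other site forces all its neighbours to lie in it.\<close>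

lemma degenerate_H: "degenerate 2 H"
  unfolding degenerate_def
proof (intro allI impI, elim conjE)
  fix K assume K: "subgraph K H" "verts K \<noteq> {}"
  have KH: "verts K \<subseteq> verts H" "edges K \<subseteq> edges H" and eK: "\<And>e. e \<in> edges K \<Longrightarrow> e \<subseteq> verts K"
    using K by (auto simp: subgraph_def simple_graph_def)
  have finK: "finite (verts K)" using KH finite_verts_H finite_subset by blast
  show "min_degree K \<le> 2"
  proof (rule ccontr)
    assume "\<not> min_degree K \<le> 2"
    then have big: "\<not> degree K v \<le> 2" if "v \<in> verts K" for v
      using Min_le[OF finite_imageI[OF finK] imageI[OF that], of "degree K"] unfolding min_degree_def by linarith
    have n0: "0 \<notin> verts K"
      using big[of 0] degree_le_2[of K 0 "{0, 1}" "{0, site 1 2}"] KH edges_at_0 by blast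
    then have e0: "0 \<notin> e" if "e \<in> edges K" for e using eK that by blast
    have n1: "1 \<notin> verts K"
      using big[of 1] degree_le_2[of K 1 "{1, site 0 0}" "{1, site 1 1}"] KH edges_at_1 e0 by blast
    then have e1: "1 \<notin> e" if "e \<in> edges K" for e using eK that by blast
    have closed: "up i j \<in> edges K \<and> rung i j \<in> edges K \<and> (i, j) \<noteq> (1, 1)"
      if v: "site i j \<in> verts K" for i j
    proof -
      have ij: "i < m" "j < 16" using v KH by (auto simp: verts_H)
      have sub: "e = up i j \<or> e = up (prev i) j \<or> (e = rung i j \<and> (i, j) \<noteq> (1, 1) \<and> (i, j) \<noteq> (1, 2))"
        if "e \<in> edges K" "site i j \<in> e" for e
        using edges_at_site[of e i j] that ij e0 e1 KH by blast
      have "up i j \<in> edges K"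
        using big[OF v] degree_le_2[of K "site i j" "up (prev i) j" "rung i j"] sub by blast
      moreover have "rung i j \<in> edges K \<and> (i, j) \<noteq> (1, 1)"
        using big[OF v] degree_le_2[of K "site i j" "up (prev i) j" "up i j"] sub by blast
      ultimately show ?thesis by blast
    qed
    have up': "site (Suc i mod m) j \<in> verts K" if "site i j \<in> verts K" for i j
      using closed[OF that] eK by (auto simp: up_def)
    have col: "site ((i + r) mod m) j \<in> verts K" if "site i j \<in> verts K" for i j r
    proof (induction r)
      case 0
      then show ?case using that KH by (auto simp: verts_H)
    next
      case (Suc r)
      then show ?case using up'[of "(i + r) mod m" j] by (simp add: mod_Suc_eq)
    qed
    have all_rows: "site i' j \<in> verts K" if "site i j \<in> verts K" "i' < m" for i i' j
    proof -
      have "i < m" using that KH by (auto simp: verts_H)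
      then show ?thesis using col[OF that(1), of "i' + m - i"] that by simp
    qed
    have next_col: "site 0 (Suc j mod 16) \<in> verts K" if "site 0 j \<in> verts K" for j
    proof -
      \<comment> \<open>In row \<open>j mod 2\<close> the rung at column \<open>j\<close> leads to
        the next column, because \<open>j mod 2 + j\<close> is even.\<close>
      have "j mod 2 < m" using m by (auto intro: less_le_trans[of _ 2])
      then have "site (j mod 2) j \<in> verts K" using all_rows that by blast
      then have "rung (j mod 2) j \<subseteq> verts K" using closed eK by blast
      then have "site (j mod 2) (Suc j mod 16) \<in> verts K"
        by (simp add: rung_def split: if_splits)
      then show ?thesis using all_rows m by auto
    qed
    obtain v where v: "v \<in> verts K" using K by blast
    moreover have "v \<noteq> 0" "v \<noteq> 1" using v n0 n1 by metis+
    ultimately obtain i j where "site i j \<in> verts K" and j: "j < 16" using KH by (fastforce simp: verts_H)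
    then have "site 0 j \<in> verts K" using all_rows m by auto
    then have "site 0 ((j + r) mod 16) \<in> verts K" for r
    proof (induction r)
      case (Suc r)
      then show ?case using next_col[of "(j + r) mod 16"] by (simp add: mod_Suc_eq)
    qed (use j in simp)
    \<comment> \<open>\<open>j + (17 - j)\<close> is 1 modulo 16: the column of the end of the
      missing rung.\<close>
    from this[of "17 - j"] have "site 0 1 \<in> verts K" using j by simp
    then have "site 1 1 \<in> verts K" using all_rows m by auto
    then show False using closed by blast
  qed
qed

lemma critical_H: "critical_degenerate 2 H"
  unfolding critical_degenerate_def using degenerate_H degree_0 degree_ge
  by (intro conjI bexI[of _ 0] ballI) (auto simp: verts_H)

lemma edges_H_nonempty: "edges H \<noteq> {}"
  by (simp add: critical_wall_def)

lemma contains_critical_wall: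
  fixes G :: "'b graph"
  assumes G: "simple_graph G"
    and \<theta>: "inj_on (\<lambda>(i, j). \<theta> i j) ({..<m} \<times> {..<16})" "\<And>i j. i < m \<Longrightarrow> j < 16 \<Longrightarrow> \<theta> i j \<in> verts G"
    and wz: "w \<in> verts G" "z \<in> verts G" "w \<noteq> z" "\<And>i j. i < m \<Longrightarrow> j < 16 \<Longrightarrow> w \<noteq> \<theta> i j \<and> z \<noteq> \<theta> i j"
    and col: "\<And>i j. i < m \<Longrightarrow> j < 16 \<Longrightarrow> {\<theta> i j, \<theta> (Suc i mod m) j} \<in> edges G"
    and rng: "\<And>i j. i < m \<Longrightarrow> j < 16 \<Longrightarrow> even (i + j) \<Longrightarrow> {\<theta> i j, \<theta> i (Suc j mod 16)} \<in> edges G"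
    and extra: "{w, \<theta> 0 0} \<in> edges G" "{w, \<theta> 1 1} \<in> edges G" "{z, w} \<in> edges G" "{z, \<theta> 1 2} \<in> edges G"
  shows "contains_copy G H"
proof -
  define f where "f x = (if x = 0 then z else if x = Suc 0 then w else
    case prod_decode (x - 2) of (i, j) \<Rightarrow> \<theta> i j)" for x
  have f: "f 0 = z" "f (Suc 0) = w" "f (site i j) = \<theta> i j" for i j
    by (simp_all add: f_def site_def)
  have inj: "inj_on f (verts H)"
  proof (rule inj_onI)
    fix x y assume xy: "x \<in> verts H" "y \<in> verts H" "f x = f y"
    have \<theta>_inj: "i = i' \<and> j = j'" if "i < m" "j < 16" "i' < m" "j' < 16" "\<theta> i j = \<theta> i' j'" for i j i' j'
      using inj_onD[OF \<theta>(1), of "(i, j)" "(i', j')"] that by simp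
    show "x = y" using xy wz(3) wz(4) \<theta>_inj unfolding verts_H by (auto simp: f) metis+
  qed
  define K where "K = Graph (f ` verts H) ((`) f ` edges H)"
  have eK: "f ` e \<in> edges G" if "e \<in> edges H" for e
    using that
  proof (cases rule: edge_cases)
    case (1 i j)
    then show ?thesis using col by (simp add: up_def f)
  next
    case (2 i j)
    then show ?thesis using rng by (simp add: rung_def f)
  qed (use extra in \<open>simp_all add: f insert_commute\<close>)
  have "simple_graph K"
    unfolding simple_graph_def
  proof (intro conjI ballI)
    fix e assume "e \<in> edges K"
    then obtain e' where e': "e' \<in> edges H" "e = f ` e'" by (auto simp: K_def)
    then show "e \<subseteq> verts K" using simple_H by (auto simp: K_def simple_graph_def)
    show "card e = 2" using e' eK G by (auto simp: simple_graph_def)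
  qed (simp add: K_def finite_verts_H)
  moreover have "verts K \<subseteq> verts G" using \<theta> wz by (auto simp: K_def verts_H f)
  moreover have "edges K \<subseteq> edges G" using eK by (auto simp: K_def)
  moreover have "isomorphic H K"
    unfolding isomorphic_def using inj by (intro exI[of _ f]) (auto simp: K_def bij_betw_def)
  ultimately show ?thesis unfolding contains_copy_def subgraph_def by blast
qed

end

section \<open>Regularisation\<close>

text \<open>Discarding an element with the least value never lowers the average; this is repeated
  until \<open>t\<close> elements remain.\<close>

lemma large_subset_sum:
  fixes f :: "'a \<Rightarrow> real"
  assumes "finite U" "t \<le> card U"
  shows "\<exists>W\<subseteq>U. card W = t \<and> t * sum f U \<le> card U * sum f W"
  using assms
proof (induction "card U - t" arbitrary: U)
  case 0
  then show ?case by (intro exI[of _ U]) auto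
next
  case (Suc l)
  then have ne: "U \<noteq> {}" by auto
  define x where "x = arg_min_on f U"
  have x: "x \<in> U" "\<And>u. u \<in> U \<Longrightarrow> f x \<le> f u"
    using arg_min_if_finite[OF Suc.prems(1) ne, of f] by (auto simp: x_def not_less)
  have card: "card (U - {x}) = card U - 1" using x Suc.prems by simp
  have cU: "card U \<ge> 1" using Suc by linarith
  obtain W where W: "W \<subseteq> U - {x}" "card W = t" "t * sum f (U - {x}) \<le> card (U - {x}) * sum f W"
  proof -
    have "l = card (U - {x}) - t" "t \<le> card (U - {x})" using card Suc.hyps(2) by linarith+
    from Suc.hyps(1)[OF this(1) finite_Diff[OF Suc.prems(1)] this(2)] show ?thesis using that by blast
  qed
  have le: "card U * f x \<le> sum f U" using x(2) by (intro sum_bounded_below)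
  have diff: "sum f (U - {x}) = sum f U - f x" using x Suc.prems by (simp add: sum_diff1)
  have "(real (card U) - 1) * sum f U \<le> card U * sum f (U - {x})"
    unfolding diff using le by (simp add: algebra_simps)
  then have "t * ((real (card U) - 1) * sum f U) \<le> t * (card U * sum f (U - {x}))"
    by (intro mult_left_mono) auto
  also have "\<dots> \<le> card U * ((real (card U) - 1) * sum f W)"
    using mult_left_mono[OF W(3), of "card U"] card cU by (simp add: of_nat_diff mult_ac)
  finally have *: "(real (card U) - 1) * (t * sum f U) \<le> (real (card U) - 1) * (card U * sum f W)"
    by (simp add: mult_ac)
  have "t * sum f U \<le> card U * sum f W"
  proof (cases "card U = 1")
    case True
    then have "t = 0" using Suc by auto
    then show ?thesis using W finite_subset[OF W(1)] Suc.prems by auto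
  next
    case False
    then have "real (card U) - 1 > 0" using cU by simp
    with * show ?thesis by (metis mult_le_cancel_left_pos)
  qed
  then show ?case using W by blast
qed

definition pow32 :: "real \<Rightarrow> real" where
  "pow32 x = x * sqrt x"

lemma pow32_mono: "0 \<le> x \<Longrightarrow> x \<le> y \<Longrightarrow> pow32 x \<le> pow32 y"
  by (simp add: pow32_def mult_mono)

text \<open>The constant \<open>c\<close> is attained by \<open>U\<close> and bounds all its
  subsets, so comparing a subset with \<open>U\<close> loses no constant. It may grow with the
  graph, which is why the later estimates keep track of powers of \<open>c\<close>.\<close>

lemma densest_subset:
  fixes C :: real
  assumes fin: "finite V" and E: "E \<subseteq> V \<times> V" and C: "C \<ge> 0" and dense: "card E > C * pow32 (card V)"
  obtains U c where "U \<subseteq> V" "U \<noteq> {}" "c > C" "card (E \<inter> U \<times> U) = c * pow32 (card U)"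
    "\<And>W. W \<subseteq> U \<Longrightarrow> card (E \<inter> W \<times> W) \<le> c * pow32 (card W)"
proof -
  define f where "f U = card (E \<inter> U \<times> U) / pow32 (card U)" for U
  let ?P = "Pow V - {{}}"
  have V: "V \<noteq> {}" using dense E by (auto simp: pow32_def)
  then have "finite (f ` ?P)" "f ` ?P \<noteq> {}" using fin by auto
  from Max_in[OF this] obtain U where "U \<in> ?P" "Max (f ` ?P) = f U" by (rule imageE)
  then have U: "U \<subseteq> V" "U \<noteq> {}" "f U = Max (f ` ?P)" by auto
  have max: "f W \<le> f U" if "W \<subseteq> V" "W \<noteq> {}" for W
    unfolding U(3) using that fin by (intro Max_ge) auto
  have pos: "pow32 (card W) > 0" if "W \<subseteq> V" "W \<noteq> {}" for W
    using that finite_subset[OF that(1) fin] by (simp add: pow32_def card_gt_0_iff)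
  have eq: "card (E \<inter> W \<times> W) = f W * pow32 (card W)" if "W \<subseteq> V" "W \<noteq> {}" for W
    using pos[OF that] by (simp add: f_def)
  have "E \<inter> V \<times> V = E" using E by blast
  then have "C < f V" using dense pos[OF _ V] by (simp add: f_def pos_less_divide_eq)
  then have "C < f U" using max[OF _ V] by fastforce
  moreover have "card (E \<inter> W \<times> W) \<le> f U * pow32 (card W)" if W: "W \<subseteq> U" for W
  proof (cases "W = {}")
    case False
    then have "W \<subseteq> V" using W U by blast
    then show ?thesis using eq[OF _ False] max[OF _ False] pos[OF _ False] by (simp add: mult_right_mono)
  qed (simp add: pow32_def)
  ultimately show ?thesis using that U eq by blast
qed

lemma card_Times_inter:
  assumes "finite A" "finite B"
  shows "real (card (E \<inter> A \<times> B)) = (\<Sum>b\<in>B. real (card {a \<in> A. (a, b) \<in> E}))"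
proof -
  have "E \<inter> A \<times> B = (\<lambda>(b, a). (a, b)) ` (SIGMA b:B. {a \<in> A. (a, b) \<in> E})" by auto
  then have "card (E \<inter> A \<times> B) = card (SIGMA b:B. {a \<in> A. (a, b) \<in> E})"
    by (simp add: card_image inj_on_def)
  also have "\<dots> = (\<Sum>b\<in>B. card {a \<in> A. (a, b) \<in> E})" using assms by simp
  finally show ?thesis by simp
qed

text \<open>If the vertices of large degree carried many edges, then together with a few of their
  neighbours they would span a denser subgraph.\<close>

lemma truncate_degrees:
  fixes c :: real
  assumes fin: "finite U" "U \<noteq> {}" and sym: "\<And>a b. (a, b) \<in> E \<Longrightarrow> (b, a) \<in> E" and EU: "E \<subseteq> U \<times> U"
    and c: "c \<ge> 60" and card: "card E = c * pow32 (card U)"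
    and sub: "\<And>W. W \<subseteq> U \<Longrightarrow> card (E \<inter> W \<times> W) \<le> c * pow32 (card W)"
  obtains E' where "E' \<subseteq> E" "\<And>a b. (a, b) \<in> E' \<Longrightarrow> (b, a) \<in> E'"
    "card E' \<ge> 3 / 4 * c * pow32 (card U)" "\<And>a. real (card (E' `` {a})) \<le> 3600 * c * sqrt (card U)"
proof -
  define n where "n = real (card U)"
  have n: "n > 0" using fin by (simp add: n_def card_gt_0_iff)
  have finE: "finite E" using EU fin finite_subset by blast
  \<comment> \<open>The trivial bound on the number of pairs gives \<open>c <= sqrt n\<close>, hence
    \<open>n >= 3600\<close>, which absorbs the rounding in \<open>l\<close> below.\<close>
  have "card E \<le> card (U \<times> U)" using EU fin by (intro card_mono) auto
  then have "c * (n * sqrt n) \<le> n * n" using card by (simp add: pow32_def n_def card_cartesian_product flip: of_nat_mult)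
  then have "c * sqrt n \<le> sqrt n * sqrt n" using n by (simp add: mult.left_commute)
  then have sq: "c \<le> sqrt n" using n by (simp only: mult_le_cancel_right_pos real_sqrt_gt_zero)
  then have "60\<^sup>2 \<le> (sqrt n)\<^sup>2" using c by (intro power_mono) auto
  then have n3600: "n \<ge> 3600" using n by simp
  define B where "B = {x \<in> U. card (E `` {x}) > 3600 * c * sqrt n}"
  have B: "B \<subseteq> U" "finite B" using fin by (auto simp: B_def)
  have "card B * (3600 * c * sqrt n) = (\<Sum>x\<in>B. 3600 * c * sqrt n)" by simp
  also have "\<dots> \<le> (\<Sum>x\<in>B. real (card (E `` {x})))" by (intro sum_mono) (auto simp: B_def)
  also have "\<dots> = real (card (SIGMA x:B. E `` {x}))" using B finE by (simp add: finite_Image)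
  also have "\<dots> \<le> card E" using finE by (intro of_nat_mono card_mono) auto
  also have "\<dots> = n / 3600 * (3600 * c * sqrt n)" by (simp add: card pow32_def n_def)
  finally have cardB: "card B \<le> n / 3600" using c n by (simp add: mult_le_cancel_right)
  define D where "D y = real (card {x \<in> B. (x, y) \<in> E})" for y
  define s where "s = real (card (E \<inter> B \<times> U))"
  have s: "s = sum D U" unfolding s_def D_def using card_Times_inter[OF B(2) fin(1)] .
  \<comment> \<open>\<open>W\<close> will consist of about \<open>n / 3600\<close> vertices that
    receive at least their share of the \<open>s\<close> edges from \<open>B\<close>. With
    \<open>B\<close> they make up at most \<open>n / 1200\<close> vertices, where maximality leaves
    a fraction \<open>1 / (1200 * 34)\<close> of the edges, as \<open>34 <= sqrt 1200\<close>. Since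
    \<open>3600 / (1200 * 34) < 1 / 8\<close>, \<open>s\<close> is small.\<close>
  define l where "l = nat \<lceil>n / 3600\<rceil>"
  have l: "n / 3600 \<le> l" "l \<le> n / 3600 + 1" using n by (auto simp: l_def)
  have "real l \<le> n" using l(2) n3600 by linarith
  then have "l \<le> card U" by (simp add: n_def)
  from large_subset_sum[OF fin(1) this, of D] obtain W where W: "W \<subseteq> U" "card W = l" "l * s \<le> n * sum D W"
    by (auto simp: s n_def)
  have finW: "finite W" using W fin finite_subset by blast
  have "sum D W = card (E \<inter> B \<times> W)" unfolding D_def using card_Times_inter[OF B(2) finW] by simp
  also have "\<dots> \<le> card (E \<inter> (B \<union> W) \<times> (B \<union> W))" using finE by (intro of_nat_mono card_mono) auto
  also have "\<dots> \<le> c * pow32 (card (B \<union> W))" using B W by (intro sub) auto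
  also have "\<dots> \<le> c * pow32 (n / 1200)"
  proof -
    have "real (card (B \<union> W)) \<le> card B + card W" by (metis card_Un_le of_nat_add of_nat_mono)
    also have "\<dots> \<le> n / 1200" using cardB W(2) l n3600 by simp
    finally show ?thesis using c by (intro mult_left_mono pow32_mono) auto
  qed
  also have "\<dots> \<le> c * (n / 1200 * (sqrt n / 34))"
  proof -
    have "sqrt (n / 1200) \<le> sqrt n / 34"
      by (rule real_le_lsqrt) (use n in \<open>auto simp: power_divide\<close>)
    then show ?thesis unfolding pow32_def using c n by (intro mult_left_mono) auto
  qed
  finally have DW: "sum D W \<le> c * n * sqrt n / 40800" by simp
  have "n / 3600 * s \<le> l * s" using l by (intro mult_right_mono) (auto simp: s_def)
  also have "\<dots> \<le> n * (c * n * sqrt n / 40800)" using W(3) DW n by (meson mult_left_mono order_trans less_imp_le)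
  finally have "n * s \<le> n * (3600 * (c * n * sqrt n / 40800))" by simp
  then have "s \<le> 3600 * (c * n * sqrt n / 40800)" using n by (simp only: mult_le_cancel_left_pos)
  moreover have "c * n * sqrt n \<ge> 0" using c n by simp
  ultimately have s_le: "s \<le> 1 / 8 * (c * n * sqrt n)" by simp
  define E' where "E' = E - B \<times> U - U \<times> B"
  have "E - E' \<subseteq> (E \<inter> B \<times> U) \<union> (\<lambda>(a, b). (b, a)) ` (E \<inter> B \<times> U)"
    using sym EU by (force simp: E'_def image_iff)
  then have "card (E - E') \<le> card ((E \<inter> B \<times> U) \<union> (\<lambda>(a, b). (b, a)) ` (E \<inter> B \<times> U))"
    using finE by (intro card_mono) auto
  also have "\<dots> \<le> card (E \<inter> B \<times> U) + card (E \<inter> B \<times> U)"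
    using finE by (intro order_trans[OF card_Un_le] add_left_mono card_image_le) auto
  finally have "real (card (E - E')) \<le> 2 * s" by (simp add: s_def)
  moreover have "real (card E') = card E - real (card (E - E'))"
  proof -
    have "E' \<subseteq> E" by (auto simp: E'_def)
    then have "card E = card E' + card (E - E')"
      using finE by (metis Diff_partition card_Un_disjoint Diff_disjoint finite_Diff finite_subset)
    then show ?thesis by simp
  qed
  ultimately have big: "card E' \<ge> 3 / 4 * c * pow32 (card U)"
    using s_le card by (simp add: pow32_def n_def)
  show ?thesis
  proof (rule that[of E'])
    show "real (card (E' `` {a})) \<le> 3600 * c * sqrt (card U)" for a
    proof (cases "a \<in> U - B")
      case True
      have "card (E' `` {a}) \<le> card (E `` {a})" using finE by (intro card_mono finite_Image) (auto simp: E'_def)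
      then show ?thesis using True by (auto simp: B_def n_def)
    next
      case False
      then have "E' `` {a} = {}" using EU by (auto simp: E'_def)
      then show ?thesis using c by simp
    qed
  qed (use big sym EU in \<open>auto simp: E'_def\<close>)
qed

context host
begin

text \<open>The sum counts the edges between the neighbourhood \<open>N\<close> of \<open>a\<close>
  and the set \<open>S\<close> of heavy partners. There are at most \<open>\<Delta>^2\<close> of
  them, so \<open>S\<close> has at most \<open>\<Delta>^2 / t\<close> elements, and \<open>N\<close>
  is no larger if \<open>S\<close> is nonempty. The density bound on the small set
  \<open>N \<union> S\<close> improves on \<open>\<Delta>^2\<close>.\<close>

lemma heavy_codegrees:
  fixes c t \<Delta> :: real
  assumes deg: "\<And>a. real (card (E `` {a})) \<le> \<Delta>" and sub: "\<And>W. W \<subseteq> V \<Longrightarrow> card (E \<inter> W \<times> W) \<le> c * pow32 (card W)"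
    and pos: "c \<ge> 0" "t > 0" and a: "a \<in> V"
  shows "(\<Sum>b\<in>V. of_bool (mp 2 a b > t) * mp 2 a b) \<le> c * pow32 (2 * \<Delta>\<^sup>2 / t)"
proof -
  define S where "S = {b \<in> V. mp 2 a b > t}"
  define N where "N = E `` {a}"
  have fin: "finite S" "finite N" using finV finE by (auto simp: S_def N_def finite_Image)
  have SV: "S \<subseteq> V" "N \<subseteq> V" using E_sub by (auto simp: S_def N_def)
  have \<Delta>: "\<Delta> \<ge> 0" using deg[of a] by linarith
  have N: "card N \<le> \<Delta>" using deg by (simp add: N_def)
  have mp2: "mp 2 a b = card {x \<in> N. (x, b) \<in> E}" if "b \<in> V" for b
  proof -
    have "E `` {a} \<inter> E `` {b} = {x \<in> N. (x, b) \<in> E}" using symE by (auto simp: N_def)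
    then show ?thesis using mp_2_eq[OF that, of a] by simp
  qed
  have "(\<Sum>b\<in>V. of_bool (mp 2 a b > t) * mp 2 a b) = (\<Sum>b\<in>V. if b \<in> S then mp 2 a b else 0)"
    by (intro sum.cong refl) (auto simp: S_def)
  also have "\<dots> = (\<Sum>b\<in>S. mp 2 a b)"
    using finV SV by (simp add: sum.inter_restrict[symmetric] Int_absorb1 del: mp.simps)
  also have eq: "\<dots> = card (E \<inter> N \<times> S)"
    unfolding card_Times_inter[OF fin(2,1)] using SV by (intro sum.cong refl mp2) auto
  finally have sum_eq: "(\<Sum>b\<in>V. of_bool (mp 2 a b > t) * mp 2 a b) = card (E \<inter> N \<times> S)" .
  have "card (E \<inter> N \<times> S) \<le> card (SIGMA x:N. E `` {x})"
    using fin finE by (intro card_mono finite_SigmaI) (auto intro: finite_Image)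
  also have "\<dots> = (\<Sum>x\<in>N. card (E `` {x}))" using fin finE by (simp add: finite_Image)
  finally have "real (card (E \<inter> N \<times> S)) \<le> (\<Sum>x\<in>N. real (card (E `` {x})))" by (simp flip: of_nat_sum)
  also have "\<dots> \<le> (\<Sum>x\<in>N. \<Delta>)" by (intro sum_mono deg)
  also have "\<dots> \<le> \<Delta>\<^sup>2" using N \<Delta> by (simp add: power2_eq_square mult_right_mono)
  finally have "real (card (E \<inter> N \<times> S)) \<le> \<Delta>\<^sup>2" .
  moreover have "card S * t \<le> (\<Sum>b\<in>S. mp 2 a b)"
    using sum_mono[of S "\<lambda>_. t" "mp 2 a"] by (auto simp: S_def less_imp_le simp del: mp.simps)
  ultimately have S: "card S \<le> \<Delta>\<^sup>2 / t" using eq pos by (simp add: pos_le_divide_eq del: mp.simps)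
  show ?thesis
  proof (cases "S = {}")
    case True
    then show ?thesis unfolding sum_eq using pos by (simp add: pow32_def)
  next
    case False
    then obtain b where b: "b \<in> V" "mp 2 a b > t" by (auto simp: S_def)
    have "mp 2 a b \<le> card N" unfolding mp2[OF b(1)] using fin by (intro of_nat_mono card_mono) auto
    then have "t \<le> \<Delta>" using b N by linarith
    then have "\<Delta> * t \<le> \<Delta>\<^sup>2" using \<Delta> by (simp add: power2_eq_square mult_left_mono)
    then have "\<Delta> \<le> \<Delta>\<^sup>2 / t" using pos by (simp add: pos_le_divide_eq)
    moreover have "real (card (N \<union> S)) \<le> card N + card S" by (metis card_Un_le of_nat_add of_nat_mono)
    ultimately have NS: "card (N \<union> S) \<le> 2 * \<Delta>\<^sup>2 / t" using S N by simp
    have "card (E \<inter> N \<times> S) \<le> card (E \<inter> (N \<union> S) \<times> (N \<union> S))" using finE by (intro card_mono) auto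
    then have "card (E \<inter> N \<times> S) \<le> c * pow32 (card (N \<union> S))" using sub[of "N \<union> S"] SV by simp
    also have "\<dots> \<le> c * pow32 (2 * \<Delta>\<^sup>2 / t)" using NS pos by (intro mult_left_mono pow32_mono) auto
    finally show ?thesis unfolding sum_eq .
  qed
qed

end

section \<open>Choice of the parameters\<close>

context host
begin

text \<open>All quantities are monomials in \<open>c\<close> and \<open>y = n\<^bsup>1/10\<^esup>\<close>, and each estimate gains at least a factor \<open>c\<close>.\<close>

lemma brick_wall_in_dense_host:
  fixes c :: real
  assumes deg: "\<And>a. real (card (E `` {a})) \<le> 3600 * c * sqrt n"
    and sub: "\<And>W. W \<subseteq> V \<Longrightarrow> card (E \<inter> W \<times> W) \<le> c * pow32 (card W)"
    and d: "d \<ge> 3 / 4 * c * sqrt n" and k: "k \<ge> 161" and c: "c \<ge> 10 ^ 200 * (real k + 1) ^ 4"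
  obtains \<theta> :: "nat \<Rightarrow> nat \<Rightarrow> 'a" and w z where
    "inj_on (\<lambda>(i, j). \<theta> i j) ({..<2 * k} \<times> {..<16})"
    "\<And>i j. i < 2 * k \<Longrightarrow> j < 16 \<Longrightarrow> \<theta> i j \<in> V"
    "\<And>i j. i < 2 * k \<Longrightarrow> j < 16 \<Longrightarrow> (\<theta> i j, \<theta> (Suc i mod (2 * k)) j) \<in> E"
    "\<And>i j. i < 2 * k \<Longrightarrow> j < 16 \<Longrightarrow> even (i + j) \<Longrightarrow> (\<theta> i j, \<theta> i (Suc j mod 16)) \<in> E"
    "w \<in> V" "z \<in> V" "w \<noteq> z" "\<And>i j. i < 2 * k \<Longrightarrow> j < 16 \<Longrightarrow> w \<noteq> \<theta> i j \<and> z \<noteq> \<theta> i j"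
    "(w, \<theta> 0 0) \<in> E" "(w, \<theta> 1 1) \<in> E" "(z, w) \<in> E" "(z, \<theta> 1 2) \<in> E"
proof -
  have k1: "(real k + 1) ^ 4 \<ge> 1" "(real k + 1) ^ 4 \<ge> real k + 1" "(real k + 1) ^ 4 \<ge> real k ^ 4"
    using self_le_power[of "real k + 1" 4] by (auto simp: power_mono)
  have "10 ^ 200 * x \<le> c" if "x \<le> (real k + 1) ^ 4" for x
    by (rule order_trans[OF mult_left_mono[OF that] c]) simp
  from this[OF k1(1)] this[OF k1(2)] this[OF k1(3)]
  have c200: "c \<ge> 10 ^ 200" and ck: "c \<ge> 10 ^ 200 * (real k + 1)" and ck4: "c \<ge> 10 ^ 200 * real k ^ 4"
    by (simp_all only: mult_1_right)
  have c0: "c > 0" by (rule less_le_trans[OF _ c200]) simp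
  \<comment> \<open>Up to constant factors, \<open>d\<close> and \<open>\<Delta>\<close> are
    \<open>c * y^5\<close>, \<open>t\<close> is \<open>c^2 * y^4\<close>, the bound on the heavy
    sums is \<open>c * y^9\<close>, \<open>m0\<close> is \<open>c^3 * y^5\<close> and
    \<open>K0\<close> is \<open>c^2\<close>.\<close>
  define y where "y = root 10 n"
  have y10: "n = y ^ 10" using n_pos by (simp add: y_def real_root_pow_pos2)
  have y0: "y > 0" using n_pos by (simp add: y_def)
  have sqrt_n: "sqrt n = y ^ 5"
    by (rule real_sqrt_unique) (use y0 in \<open>simp_all add: y10 flip: power_mult\<close>)
  have d': "d \<ge> 3 / 4 * (c * y ^ 5)" using d by (simp add: sqrt_n)
  have xpos: "c * y ^ 5 > 0" using c0 y0 by simp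
  then have d0: "d > 0" using d' by linarith
  \<comment> \<open>A graph has average degree at most \<open>n\<close>, so a large \<open>c\<close>
    forces a large \<open>n\<close>.\<close>
  have y2: "y \<ge> 2"
  proof -
    have "card E \<le> card (V \<times> V)" using finV E_sub by (intro card_mono) auto
    then have "real (card E) \<le> n * n" by (simp add: n_def card_cartesian_product flip: of_nat_mult)
    then have "d \<le> n" using n_pos by (simp add: d_def pos_divide_le_eq)
    then have "3 / 4 * (c * y ^ 5) \<le> y ^ 5 * y ^ 5" using d' by (simp add: y10 flip: power_add)
    then have "(3 / 4 * c) * y ^ 5 \<le> y ^ 5 * y ^ 5" by (simp only: mult.assoc)
    then have "3 / 4 * c \<le> y ^ 5" using y0 by (simp only: mult_le_cancel_right_pos zero_less_power)
    then have "2 ^ 5 \<le> y ^ 5" using c200 by simp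
    then show ?thesis using power_mono_iff[of 2 y 5] y0 by (simp only: zero_less_numeral less_imp_le zero_le_numeral)
  qed
  have d2: "d\<^sup>2 \<ge> c\<^sup>2 * y ^ 10 / 2"
  proof -
    have "(3 / 4 * (c * y ^ 5))\<^sup>2 \<le> d\<^sup>2" using d' xpos by (intro power_mono) auto
    moreover have "(3 / 4 * (c * y ^ 5))\<^sup>2 = 9 / 16 * (c\<^sup>2 * y ^ 10)"
      by (simp add: power_mult_distrib power_divide flip: power_mult)
    moreover have "c\<^sup>2 * y ^ 10 \<ge> 0" by simp
    ultimately show ?thesis by linarith
  qed
  have d3: "d ^ 3 \<ge> c ^ 3 * y ^ 15 / 4"
  proof -
    have "(3 / 4 * (c * y ^ 5)) ^ 3 \<le> d ^ 3" using d' xpos by (intro power_mono) auto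
    moreover have "(3 / 4 * (c * y ^ 5)) ^ 3 = 27 / 64 * (c ^ 3 * y ^ 15)"
      by (simp add: power_mult_distrib power_divide flip: power_mult)
    moreover have "c ^ 3 * y ^ 15 \<ge> 0" using c0 y0 by simp
    ultimately show ?thesis by linarith
  qed
  define \<Delta> where "\<Delta> = 3600 * (c * y ^ 5)"
  \<comment> \<open>A factor of order \<open>c * y\<close> below \<open>m0\<close>, which makes
    conflicts rare, yet large enough to leave the heavy sums a factor of order \<open>c * y\<close>
    below \<open>d^2\<close>.\<close>
  define t where "t = c\<^sup>2 * y ^ 4"
  \<comment> \<open>\<open>m0\<close> and \<open>K0\<close> exhaust the pruning budgets
    \<open>N4\<close> and \<open>N5\<close>.\<close>
  define m0 where "m0 = d ^ 32 / (128 * (n * \<Delta> ^ 29))"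
  define K0 where "K0 = d ^ 32 / (16 * (n * \<Delta> ^ 30))"
  \<comment> \<open>\<open>4800 = 3600 / (3/4)\<close> compares the maximum with the average degree;
    its powers up to the thirtieth are what \<open>10 ^ 200\<close> absorbs.\<close>
  have \<Delta>: "\<Delta> > 0" "\<Delta> \<le> 4800 * d" using xpos d' by (auto simp: \<Delta>_def)
  have t: "t > 0" using c0 y0 by (simp add: t_def)
  have pos: "m0 > 0" "K0 > 0" using d0 n_pos \<Delta> by (simp_all add: m0_def K0_def)
  have \<Phi>: "c * pow32 (2 * \<Delta>\<^sup>2 / t) \<le> 2 * 10 ^ 11 * c * y ^ 9"
  proof -
    have *: "2 * \<Delta>\<^sup>2 / t = 25920000 * y ^ 6"
      using c0 y0 by (simp add: \<Delta>_def t_def power_mult_distrib field_simps flip: power_mult power_add)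
    have "sqrt (25920000 * y ^ 6) \<le> 5100 * y ^ 3"
      by (rule real_le_lsqrt) (use y0 in \<open>auto simp: power_mult_distrib simp flip: power_mult\<close>)
    then have "pow32 (25920000 * y ^ 6) \<le> (25920000 * y ^ 6) * (5100 * y ^ 3)"
      unfolding pow32_def using y0 by (intro mult_left_mono) auto
    also have "\<dots> = 132192000000 * y ^ 9" by (simp flip: power_add)
    also have "\<dots> \<le> 2 * 10 ^ 11 * y ^ 9" using y0 by simp
    finally show ?thesis unfolding * using c0 by (simp add: mult.left_commute)
  qed
  have heavy: "(\<Sum>b\<in>V. of_bool (mp 2 a b > t) * mp 2 a b) \<le> c * pow32 (2 * \<Delta>\<^sup>2 / t)" if "a \<in> V" for a
  proof (rule heavy_codegrees[OF _ sub _ t that])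
    show "real (card (E `` {a})) \<le> \<Delta>" for a using deg[of a] by (simp add: \<Delta>_def sqrt_n mult.assoc)
  qed (use c0 in auto)
  have big_c: "c * C * y ^ 10 \<le> d\<^sup>2" if "C \<le> 10 ^ 100" for C
  proof -
    have "(2::real) * 10 ^ 100 \<le> 10 ^ 200" by simp
    then have "2 * C \<le> c" using that c200 by linarith
    then have "c * (2 * C) * y ^ 10 \<le> c * c * y ^ 10" using c0 y0 by (intro mult_right_mono mult_left_mono) auto
    then show ?thesis using d2 by (simp add: power2_eq_square)
  qed
  \<comment> \<open>Allowing a loss of \<open>y\<close> for each of 16 double steps gives
    \<open>y^16\<close>, more than the \<open>n = y^10\<close> that \<open>tr 0\<close>
    requires.\<close>
  have N1: "n \<le> (y / d\<^sup>2) ^ 16 * d ^ 32"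
  proof -
    have "(y / d\<^sup>2) ^ 16 * d ^ 32 = y ^ 16" using d0 by (simp add: power_divide flip: power_mult)
    moreover have "y ^ 10 \<le> y ^ 16" using y2 by (intro power_increasing) auto
    ultimately show ?thesis by (simp add: y10)
  qed
  have N2: "32 * (c * pow32 (2 * \<Delta>\<^sup>2 / t)) * (y / d\<^sup>2) \<le> 1 / 8"
  proof -
    have "256 * (c * pow32 (2 * \<Delta>\<^sup>2 / t)) * y \<le> 256 * (2 * 10 ^ 11 * c * y ^ 9) * y"
      using \<Phi> y0 by (intro mult_right_mono mult_left_mono) auto
    also have "\<dots> = c * (512 * 10 ^ 11) * y ^ 10" by (simp add: power_add[of y 9 1, simplified])
    also have "\<dots> \<le> d\<^sup>2" by (rule big_c) simp
    finally show ?thesis using d0 by (simp add: field_simps)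
  qed
  have N3: "4 * 32 ^ 4 * \<Delta> * (y / d\<^sup>2) \<le> 1 / 16"
  proof -
    have "64 * 32 ^ 4 * \<Delta> * y = c * (64 * 32 ^ 4 * 3600) * y ^ 6" by (simp add: \<Delta>_def power_add[of y 5 1, simplified])
    also have "\<dots> \<le> c * (64 * 32 ^ 4 * 3600) * y ^ 10"
      using c0 y2 by (intro mult_left_mono power_increasing) auto
    also have "\<dots> \<le> d\<^sup>2" by (rule big_c) simp
    finally show ?thesis using d0 by (simp add: field_simps)
  qed
  have N4: "16 * m0 * (n * \<Delta> ^ 29) \<le> d ^ 32 / 8" and N5: "2 * K0 * (n * \<Delta> ^ 30) \<le> d ^ 32 / 8"
    using n_pos \<Delta> by (simp_all add: m0_def K0_def)
  have degD: "real (card (E `` {a})) \<le> \<Delta>" for a using deg[of a] by (simp add: \<Delta>_def sqrt_n mult.assoc)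
  have K0_big: "K0 > 32 * real k + 1"
  proof -
    have "\<Delta> ^ 30 \<le> (4800 * d) ^ 30" using \<Delta> by (intro power_mono) auto
    then have D: "\<Delta> ^ 30 \<le> 4800 ^ 30 * d ^ 30" by (simp add: power_mult_distrib)
    have "(32 * real k + 1) * (16 * (n * \<Delta> ^ 30)) \<le> (32 * real k + 1) * (16 * (n * (4800 ^ 30 * d ^ 30)))"
      using D n_pos by (intro mult_left_mono) auto
    also have "\<dots> = (16 * 4800 ^ 30 * (32 * real k + 1)) * y ^ 10 * d ^ 30" by (simp add: y10)
    also have "\<dots> < c\<^sup>2 * y ^ 10 / 2 * d ^ 30"
    proof -
      have "32 * real k + 1 \<le> 32 * (real k + 1)" by simp
      then have "2 * (16 * 4800 ^ 30 * (32 * real k + 1)) \<le> 2 * (16 * 4800 ^ 30 * (32 * (real k + 1)))"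
        by (intro mult_left_mono) auto
      also have "\<dots> = (1024 * 4800 ^ 30) * (real k + 1)" by simp
      also have "\<dots> < 10 ^ 200 * (real k + 1)" by (intro mult_strict_right_mono) auto
      also have "\<dots> \<le> c * 1" using ck by simp
      also have "\<dots> \<le> c * c" using c200 c0 by (intro mult_left_mono) auto
      finally have "16 * 4800 ^ 30 * (32 * real k + 1) < c\<^sup>2 / 2" by (simp add: power2_eq_square)
      then have "(16 * 4800 ^ 30 * (32 * real k + 1)) * (y ^ 10 * d ^ 30) < (c\<^sup>2 / 2) * (y ^ 10 * d ^ 30)"
        using y0 d0 by (intro mult_strict_right_mono) auto
      then show ?thesis by (simp add: mult_ac)
    qed
    also have "\<dots> \<le> d\<^sup>2 * d ^ 30" using d2 d0 by (intro mult_right_mono) auto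
    also have "\<dots> = d ^ 32" by (simp flip: power_add)
    finally show ?thesis unfolding K0_def using n_pos \<Delta> by (simp add: pos_less_divide_eq)
  qed
  \<comment> \<open>A row has 16 vertices, so \<open>n^16 = y^160\<close>, and one more factor
    \<open>y >= 2\<close> pays for the two sides; this is the origin of 161.\<close>
  have M1: "2 * n ^ 16 \<le> y ^ k"
  proof -
    have "2 * n ^ 16 = 2 * y ^ 160" by (simp add: y10 flip: power_mult)
    also have "\<dots> \<le> y * y ^ 160" using y2 by (intro mult_right_mono) auto
    also have "\<dots> = y ^ 161" by (simp flip: power_Suc)
    also have "\<dots> \<le> y ^ k" using y2 k by (intro power_increasing) auto
    finally show ?thesis .
  qed
  \<comment> \<open>\<open>t / m0\<close> is of order \<open>1 / (c * y)\<close> and the trace ratio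
    on rows costs \<open>y\<close>; the product leaves \<open>1 / c\<close>, against which
    \<open>k^4\<close> is absorbed by the lower bound on \<open>c\<close>.\<close>
  have M2: "16 * real k ^ 4 * (4096 * t / m0) * y \<le> 1 / 2"
  proof -
    have "\<Delta> ^ 29 \<le> (4800 * d) ^ 29" using \<Delta> by (intro power_mono) auto
    then have D: "\<Delta> ^ 29 \<le> 4800 ^ 29 * d ^ 29" by (simp add: power_mult_distrib)
    define Q where "Q = 131072 * real k ^ 4"
    have "Q * t * y * (128 * (n * \<Delta> ^ 29)) \<le> Q * t * y * (128 * (n * (4800 ^ 29 * d ^ 29)))"
      using D n_pos t y0 by (intro mult_left_mono) (auto simp: Q_def)
    also have "\<dots> = (512 * 4800 ^ 29 * Q) * (c\<^sup>2 * y ^ 15 / 4) * d ^ 29"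
      by (simp add: y10 t_def power_add[of y 14 1, simplified] power_add[of y 4 10, simplified])
    also have "\<dots> \<le> c * (c\<^sup>2 * y ^ 15 / 4) * d ^ 29"
    proof -
      have "512 * 4800 ^ 29 * Q = (512 * 4800 ^ 29 * 131072) * real k ^ 4" by (simp add: Q_def)
      also have "\<dots> \<le> 10 ^ 200 * real k ^ 4" by (intro mult_right_mono) auto
      also have "\<dots> \<le> c" by (rule ck4)
      finally show ?thesis using y0 d0 by (intro mult_right_mono) auto
    qed
    also have "\<dots> = c ^ 3 * y ^ 15 / 4 * d ^ 29" by (simp add: power3_eq_cube power2_eq_square)
    also have "\<dots> \<le> d ^ 3 * d ^ 29" using d3 d0 by (intro mult_right_mono) auto
    also have "\<dots> = d ^ 32" by (simp flip: power_add)
    finally have "Q * t * y \<le> m0" unfolding m0_def using n_pos \<Delta> by (simp add: pos_le_divide_eq)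
    then have "Q * t * y / m0 \<le> 1" using pos by simp
    then show ?thesis by (simp add: Q_def mult_ac)
  qed
  have rho: "y / d\<^sup>2 > 0" using y0 d0 by simp
  obtain X where X: "X \<subseteq> CW 32" "X \<noteq> {}" "\<And>v. v \<in> X \<Longrightarrow> distinct v \<and> light t v"
    "\<And>v j. v \<in> X \<Longrightarrow> j < 16 \<Longrightarrow> m0 \<le> card {v' \<in> X. sel (arc (2 * j + 2) 30) v' = sel (arc (2 * j + 2) 30) v}"
    "\<And>v. v \<in> X \<Longrightarrow> K0 \<le> card {v' \<in> X. sel (arc 2 31) v' = sel (arc 2 31) v}"
    "\<And>v. v \<in> X \<Longrightarrow> K0 \<le> card {v' \<in> X. sel (arc 3 31) v' = sel (arc 3 31) v}"
    "\<And>v s. v \<in> X \<Longrightarrow> card {v' \<in> CW 32. sel (cols s) v' = sel (cols s) v} / 16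
                        \<le> card {v' \<in> X. sel (cols s) v' = sel (cols s) v}"
    using pruned_closed_walks[OF degD \<Delta>(1) d0 rho less_imp_le[OF pos(1)] less_imp_le[OF pos(2)] heavy N1 N2 N3 N4 N5]
    by blast
  have "k > 0" using k by simp
  from brick_wall[OF X less_imp_le[OF t] pos(1) y0 this M1 M2 K0_big that] show ?thesis .
qed

end

section \<open>The extremal bound and the infinite family\<close>

lemma edges_of_free_graph:
  fixes G :: "nat graph"
  assumes G: "simple_graph G" and free: "\<not> contains_copy G (critical_wall (2 * k))" and k: "k \<ge> 161"
  shows "card (edges G) \<le> 10 ^ 200 * (real k + 1) ^ 4 * pow32 (card (verts G))"
proof (rule ccontr)
  define C where "C = 10 ^ 200 * (real k + 1) ^ 4"
  have C: "C \<ge> 60"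
  proof -
    have "(60::real) * 1 \<le> 10 ^ 200 * (real k + 1) ^ 4" by (intro mult_mono one_le_power) auto
    then show ?thesis by (simp add: C_def)
  qed
  assume "\<not> ?thesis"
  then have many: "card (edges G) > C * pow32 (card (verts G))" by (simp add: C_def)
  have fin: "finite (verts G)" and e2: "\<And>e. e \<in> edges G \<Longrightarrow> e \<subseteq> verts G \<and> card e = 2"
    using G by (auto simp: simple_graph_def)
  define E where "E = {(a, b). {a, b} \<in> edges G}"
  have E_sub: "E \<subseteq> verts G \<times> verts G" using e2 by (auto simp: E_def)
  have symE: "(b, a) \<in> E" if "(a, b) \<in> E" for a b using that by (simp add: E_def insert_commute)
  have finite_E: "finite E" using E_sub fin finite_subset by blast
  have "edges G \<subseteq> (\<lambda>(a, b). {a, b}) ` E"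
  proof
    fix e assume e: "e \<in> edges G"
    then obtain a b where "e = {a, b}" using e2 card_2_iff by metis
    then show "e \<in> (\<lambda>(a, b). {a, b}) ` E" using e by (auto simp: E_def)
  qed
  then have "card (edges G) \<le> card E" by (rule surj_card_le[OF finite_E])
  then have dense: "card E > C * pow32 (card (verts G))" using many by linarith
  have C0: "C \<ge> 0" using C by linarith
  obtain U c where U: "U \<subseteq> verts G" "U \<noteq> {}" "c > C" "card (E \<inter> U \<times> U) = c * pow32 (card U)"
    "\<And>W. W \<subseteq> U \<Longrightarrow> card (E \<inter> W \<times> W) \<le> c * pow32 (card W)"
    by (rule densest_subset[OF fin E_sub C0 dense that])
  have finU: "finite U" using U fin finite_subset by blast
  have inter: "E \<inter> U \<times> U \<inter> W \<times> W = E \<inter> W \<times> W" if "W \<subseteq> U" for W using that by blast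
  obtain E' where E': "E' \<subseteq> E \<inter> U \<times> U" "\<And>a b. (a, b) \<in> E' \<Longrightarrow> (b, a) \<in> E'"
    "card E' \<ge> 3 / 4 * c * pow32 (card U)" "\<And>a. real (card (E' `` {a})) \<le> 3600 * c * sqrt (card U)"
  proof (rule truncate_degrees[OF finU U(2), of "E \<inter> U \<times> U" c])
    show "c \<ge> 60" using C U(3) by linarith
    show "card (E \<inter> U \<times> U \<inter> W \<times> W) \<le> c * pow32 (card W)" if "W \<subseteq> U" for W
      using U(5)[OF that] by (simp only: inter[OF that])
  qed (use U symE in auto)
  interpret host U E'
  proof unfold_locales
    show "finite U" "U \<noteq> {}" by (rule finU, rule U(2))
    show "E' \<subseteq> U \<times> U" using E'(1) by blast
    show "(a, b) \<in> E' \<Longrightarrow> (b, a) \<in> E'" for a b by (rule E'(2))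
  qed
  have avg: "d \<ge> 3 / 4 * c * sqrt n"
  proof -
    have "3 / 4 * c * sqrt n * n \<le> card E'" using E'(3) by (simp add: pow32_def n_def mult_ac)
    then show ?thesis using n_pos by (simp add: d_def pos_le_divide_eq)
  qed
  have sub: "real (card (E' \<inter> W \<times> W)) \<le> c * pow32 (card W)" if "W \<subseteq> U" for W
  proof -
    have "card (E' \<inter> W \<times> W) \<le> card (E \<inter> W \<times> W)" using finite_E E' by (intro card_mono) auto
    then show ?thesis using U(5)[OF that] by linarith
  qed
  have c: "c \<ge> 10 ^ 200 * (real k + 1) ^ 4" using U(3) by (simp add: C_def)
  have deg: "real (card (E' `` {a})) \<le> 3600 * c * sqrt n" for a using E'(4) by (simp add: n_def)
  obtain \<theta> w z where wall: "inj_on (\<lambda>(i, j). \<theta> i j) ({..<2 * k} \<times> {..<16::nat})"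
    "\<And>i j. i < 2 * k \<Longrightarrow> j < 16 \<Longrightarrow> \<theta> i j \<in> U"
    "\<And>i j. i < 2 * k \<Longrightarrow> j < 16 \<Longrightarrow> (\<theta> i j, \<theta> (Suc i mod (2 * k)) j) \<in> E'"
    "\<And>i j. i < 2 * k \<Longrightarrow> j < 16 \<Longrightarrow> even (i + j) \<Longrightarrow> (\<theta> i j, \<theta> i (Suc j mod 16)) \<in> E'"
    "w \<in> U" "z \<in> U" "w \<noteq> z" "\<And>i j. i < 2 * k \<Longrightarrow> j < 16 \<Longrightarrow> w \<noteq> \<theta> i j \<and> z \<noteq> \<theta> i j"
    "(w, \<theta> 0 0) \<in> E'" "(w, \<theta> 1 1) \<in> E'" "(z, w) \<in> E'" "(z, \<theta> 1 2) \<in> E'"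
    by (rule brick_wall_in_dense_host[OF deg sub avg k c that])
  have E'_edge: "{a, b} \<in> edges G" if "(a, b) \<in> E'" for a b using that E'(1) by (auto simp: E_def)
  have "contains_copy G (critical_wall (2 * k))"
    by (rule contains_critical_wall[of "2 * k" G \<theta> w z]) (use k G wall U(1) E'_edge in auto)
  with free show False by simp
qed

lemma ex_number_critical_wall:
  assumes k: "k \<ge> 161"
  shows "(\<lambda>n. real (ex_number n (critical_wall (2 * k)))) \<in> O(\<lambda>n. real n powr (3 / 2))"
proof (rule bigoI)
  let ?H = "critical_wall (2 * k)"
  show "\<forall>\<^sub>F n in sequentially. norm (real (ex_number n ?H)) \<le> (10 ^ 200 * (real k + 1) ^ 4) * norm (real n powr (3 / 2))"
  proof (intro always_eventually allI)
    fix n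
    have "edges ?H \<noteq> {}" using edges_H_nonempty[of "2 * k"] k by simp
    from Max_in[OF finite_edge_numbers edge_numbers_nonempty[OF this, of n]]
    obtain G :: "nat graph" where G: "ex_number n ?H = card (edges G)" "simple_graph G" "card (verts G) = n"
      "\<not> contains_copy G ?H"
      unfolding ex_number_def by blast
    have "real n powr (3 / 2) = pow32 (real n)"
    \<comment> \<open>For base 0 \<open>powr\<close> yields 0, in agreement with
      \<open>pow32\<close>.\<close>
    proof (cases "n = 0")
      case False
      have "real n powr (3 / 2) = real n powr (1 + 1 / 2)" by simp
      also have "\<dots> = pow32 (real n)" using False by (simp only: powr_add powr_one powr_half_sqrt pow32_def of_nat_0_le_iff)
      finally show ?thesis .
    qed (simp add: pow32_def)
    then show "norm (real (ex_number n ?H)) \<le> (10 ^ 200 * (real k + 1) ^ 4) * norm (real n powr (3 / 2))"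
      using edges_of_free_graph[OF G(2,4) k] G by (simp add: pow32_def)
  qed
qed

theorem theorem3:
  "\<exists>S :: nat graph set. infinite S \<and>
     pairwise (\<lambda>G H. \<not> isomorphic G H) S \<and>
     (\<forall>H\<in>S. simple_graph H \<and> critical_degenerate 2 H \<and>
        (\<lambda>n. real (ex_number n H)) \<in> O(\<lambda>n. real n powr (3 / 2)))"
proof (intro exI conjI ballI)
  let ?S = "(\<lambda>k. critical_wall (2 * k)) ` {161..}"
  \<comment> \<open>The number of vertices tells the members of the family apart, up to isomorphism
    as well.\<close>
  have card: "card (verts (critical_wall (2 * k))) = 32 * k + 2" if "k \<ge> 161" for k
    using card_verts_H[of "2 * k"] that by simp
  have "inj_on (\<lambda>k. critical_wall (2 * k)) {161..}"
  proof (rule inj_onI)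
    fix k l :: nat assume "k \<in> {161..}" "l \<in> {161..}" "critical_wall (2 * k) = critical_wall (2 * l)"
    then have "32 * k + 2 = 32 * l + 2" using card[of k] card[of l] by (metis atLeast_iff)
    then show "k = l" by simp
  qed
  then show "infinite ?S" using infinite_Ici[of "161 :: nat"] finite_image_iff by blast
  show "pairwise (\<lambda>G H. \<not> isomorphic G H) ?S"
  proof (rule pairwiseI, rule notI)
    fix G H assume "G \<in> ?S" "H \<in> ?S" "G \<noteq> H" "isomorphic G H"
    then obtain k l where kl: "k \<ge> 161" "l \<ge> 161" "G = critical_wall (2 * k)" "H = critical_wall (2 * l)"
      unfolding image_iff by (metis atLeast_iff)
    have "card (verts G) = card (verts H)"
      using \<open>isomorphic G H\<close> by (auto simp: isomorphic_def dest: bij_betw_same_card)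
    then have "32 * k + 2 = 32 * l + 2" unfolding kl(3,4) card[OF kl(1)] card[OF kl(2)] .
    then show False using kl(3,4) \<open>G \<noteq> H\<close> by simp
  qed
  fix H assume "H \<in> ?S"
  then obtain k where k: "k \<ge> 161" and H: "H = critical_wall (2 * k)" by auto
  show "simple_graph H" "critical_degenerate 2 H"
    using simple_H[of "2 * k"] critical_H[of "2 * k"] k by (simp_all add: H)
  show "(\<lambda>n. real (ex_number n H)) \<in> O(\<lambda>n. real n powr (3 / 2))"
    unfolding H by (rule ex_number_critical_wall[OF k])
qed

end
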